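(* Let $N\ge 1$, let $\Omega\subset\mathbb{R}^N$ be a bounded open set, and let $A\in (L^\infty(\Omega))^{N\times N}$ and $\alpha>0$ be such that $A(x)\xi\cdot\xi\ge\alpha|\xi|^2$ for a.e. $x\in\Omega$ and all $\xi\in\mathbb{R}^N$. Let $F:\Omega\times[0,+\infty)\to[0,+\infty]$ be a Carathéodory function (i.e. $x\mapsto F(x,s)$ is measurable for every $s\in[0,+\infty)$, and for a.e. $x\in\Omega$ the map $s\mapsto F(x,s)\in[0,+\infty]$ is continuous on $[0,+\infty)$) such that $$0\le F(x,s)\le \frac{h(x)}{\Gamma(s)}\quad\text{for a.e. } x\in\Omega,\ \forall s>0,$$ where $h\ge 0$ a.e., $h\in L^r(\Omega)$ with $r=\frac{2N}{N+2}$ if $N\ge3$, $r>1$ if $N=2$, $r=1$ if $N=1$, and where $\Gamma:[0,+\infty)\to[0,+\infty)$ is of class $C^1([0,+\infty))$ with $\Gamma(0)=0$ and $\Gamma'(s)>0$ for all $s>0$. Then every solution $u$, in the sense of the definition given in the context, to the problem $u\ge 0$, $-\operatorname{div}A(x)Du=F(x,u)$ in $\Omega$, $u=0$ on $\partial\Omega$ satisfies $$\|G_k(u)\|_{H_0^1(\Omega)}=\|DG_k(u)\|_{(L^2(\Omega))^N}\le\frac{C_S}{\alpha}\,\frac{\|h\|_{L^r(\Omega)}}{\Gamma(k)}\qquad\forall k>0,$$ where $C_S$ is the (generalized) Sobolev constant described in the context.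
   Context: All functions are real-valued unless otherwise said; $D$ denotes the gradient, ${}^tA$ the transpose of $A$, $\mathcal{D}(\Omega)=C_c^\infty(\Omega)$, $\mathcal{D}'(\Omega)$ the distributions on $\Omega$; no regularity of $\partial\Omega$ is assumed. $H_0^1(\Omega)$ is normed by $\|w\|_{H_0^1(\Omega)}=\|Dw\|_{(L^2(\Omega))^N}$. For $k>0$ and $s\in\mathbb{R}$: $T_k(s)=\max\{-k,\min\{s,k\}\}$, $G_k(s)=s-T_k(s)$. Sobolev constant. Let $2^*$ be the Hölder conjugate exponent of $r$: so $\frac1{2^*}=\frac12-\frac1N$ if $N\ge3$, $2^*=r/(r-1)\in(1,+\infty)$ if $N=2$, $2^*=+\infty$ if $N=1$. $C_S$ is a constant such that $\|v\|_{L^{2^*}(\Omega)}\le C_S\|Dv\|_{(L^2(\Omega))^N}$ for all $v\in H_0^1(\Omega)$. Test functions. For $\hat\varphi\in H_0^1(\Omega)\cap L^\infty(\Omega)$ and $\hat g\in(L^2(\Omega))^N$, the distribution $\hat\varphi(-\operatorname{div}\hat g)$ is defined by $\langle\hat\varphi(-\operatorname{div}\hat g),\phi\rangle=\int_\Omega\hat g\cdot D(\hat\varphi\phi)$ for $\phi\in\mathcal{D}(\Omega)$. The space $\mathcal{V}(\Omega)$ is the set of $v\in H_0^1(\Omega)\cap L^\infty(\Omega)$ for which there exist a finite set $I$, functions $\hat\varphi_i\in H_0^1(\Omega)\cap L^\infty(\Omega)$, $\hat g_i\in(L^2(\Omega))^N$ ($i\in I$) and $\hat f\in L^1(\Omega)$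 such that $$-\operatorname{div}\,{}^tA(x)Dv=\sum_{i\in I}\hat\varphi_i(-\operatorname{div}\hat g_i)+\hat f\quad\text{in }\mathcal{D}'(\Omega).\qquad( * )$$ Definition of solution. A function $u$ is a solution to the problem $u\ge0$, $-\operatorname{div}A(x)Du=F(x,u)$ in $\Omega$, $u=0$ on $\partial\Omega$ if: (1) $u\in L^2(\Omega)\cap H^1_{\rm loc}(\Omega)$; $u(x)\ge0$ for a.e. $x\in\Omega$; $G_k(u)\in H_0^1(\Omega)$ for all $k>0$; and $\varphi T_k(u)\in H_0^1(\Omega)$ for all $k>0$ and all $\varphi\in H_0^1(\Omega)\cap L^\infty(\Omega)$; (2) for every $v\in\mathcal{V}(\Omega)$ with $v\ge0$, and every $I,\hat\varphi_i,\hat g_i,\hat f$ as in $( * )$, one has $\int_\Omega F(x,u)v<+\infty$ (with the usual convention $0\cdot\infty=0$ in integrands) and $$\int_\Omega{}^tA(x)Dv\cdot DG_k(u)+\sum_{i\in I}\int_\Omega\hat g_i\cdot D(\hat\varphi_iT_k(u))+\int_\Omega\hat f\,T_k(u)=\int_\Omega F(x,u)v\qquad\forall k>0.$$ *)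

theory Defs
  imports "HOL-Analysis.Analysis" "HOL-Probability.Essential_Supremum"
begin

text \<open>
  A function on \<open>\<Omega>\<close> is represented by a total function on the whole space of which only
  the values on \<open>\<Omega>\<close> matter; measurability, integrals and ``almost everywhere'' refer to
  \<^term>\<open>lebesgue_on \<Omega>\<close>.
\<close>

section \<open>Lebesgue spaces\<close>

definition Lp :: "(real^'n) set \<Rightarrow> ennreal \<Rightarrow> (real^'n \<Rightarrow> 'b::{banach,second_countable_topology}) set"
  where "Lp \<Omega> p = {f \<in> borel_measurable (lebesgue_on \<Omega>).
     if p = \<infinity> then esssup (lebesgue_on \<Omega>) (\<lambda>x. ennreal (norm (f x))) < \<infinity>
     else integrable (lebesgue_on \<Omega>) (\<lambda>x. norm (f x) powr enn2real p)}"

text \<open>Only meaningful for members of \<^term>\<open>Lp \<Omega> p\<close>.\<close>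

definition Lp_norm :: "(real^'n) set \<Rightarrow> ennreal \<Rightarrow> (real^'n \<Rightarrow> 'b::{banach,second_countable_topology}) \<Rightarrow> real"
  where "Lp_norm \<Omega> p f =
    (if p = \<infinity> then enn2real (esssup (lebesgue_on \<Omega>) (\<lambda>x. ennreal (norm (f x))))
     else (\<integral>x. norm (f x) powr enn2real p \<partial>lebesgue_on \<Omega>) powr (1 / enn2real p))"

definition locally_integrable :: "(real^'n) set \<Rightarrow> (real^'n \<Rightarrow> 'b::{banach,second_countable_topology}) \<Rightarrow> bool"
  where "locally_integrable \<Omega> f \<longleftrightarrow>
    (\<forall>K. compact K \<and> K \<subseteq> \<Omega> \<longrightarrow> set_integrable lebesgue K f)"

section \<open>Test functions\<close>

fun Ck :: "nat \<Rightarrow> (real^'n \<Rightarrow> real) \<Rightarrow> bool"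
  where
    "Ck 0 f \<longleftrightarrow> continuous_on UNIV f"
  | "Ck (Suc k) f \<longleftrightarrow> (\<forall>x. f differentiable (at x)) \<and> (\<forall>v. Ck k (\<lambda>x. frechet_derivative f (at x) v))"

text \<open>
  The space \<open>\<D>(\<Omega>)\<close>; its elements vanish outside \<open>\<Omega>\<close>, so that smoothness can be required on
  the whole space.
\<close>

definition test_functions :: "(real^'n) set \<Rightarrow> (real^'n \<Rightarrow> real) set"
  where "test_functions \<Omega> =
    {\<phi>. (\<forall>k. Ck k \<phi>) \<and> compact (closure {x. \<phi> x \<noteq> 0}) \<and> closure {x. \<phi> x \<noteq> 0} \<subseteq> \<Omega>}"

definition grad :: "(real^'n \<Rightarrow> real) \<Rightarrow> real^'n \<Rightarrow> real^'n"
  where "grad \<phi> x = (\<chi> i. frechet_derivative \<phi> (at x) (axis i 1))"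

section \<open>Weak gradients and Sobolev spaces\<close>

definition is_weak_gradient :: "(real^'n) set \<Rightarrow> (real^'n \<Rightarrow> real) \<Rightarrow> (real^'n \<Rightarrow> real^'n) \<Rightarrow> bool"
  where "is_weak_gradient \<Omega> w g \<longleftrightarrow>
    locally_integrable \<Omega> w \<and> locally_integrable \<Omega> g \<and>
    (\<forall>\<phi>\<in>test_functions \<Omega>.
      (\<integral>x. w x *\<^sub>R grad \<phi> x \<partial>lebesgue_on \<Omega>) = - (\<integral>x. \<phi> x *\<^sub>R g x \<partial>lebesgue_on \<Omega>))"

text \<open>An arbitrary representative; weak gradients are unique almost everywhere.\<close>

definition wgrad :: "(real^'n) set \<Rightarrow> (real^'n \<Rightarrow> real) \<Rightarrow> real^'n \<Rightarrow> real^'n"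
  where "wgrad \<Omega> w = (SOME g. is_weak_gradient \<Omega> w g)"

definition H1 :: "(real^'n) set \<Rightarrow> (real^'n \<Rightarrow> real) set"
  where "H1 \<Omega> = {w \<in> Lp \<Omega> 2. \<exists>g\<in>Lp \<Omega> 2. is_weak_gradient \<Omega> w g}"

definition H1_loc :: "(real^'n) set \<Rightarrow> (real^'n \<Rightarrow> real) set"
  where "H1_loc \<Omega> = {w. \<forall>\<omega>. open \<omega> \<and> compact (closure \<omega>) \<and> closure \<omega> \<subseteq> \<Omega> \<longrightarrow> w \<in> H1 \<omega>}"

text \<open>The closure of the test functions in \<^term>\<open>H1 \<Omega>\<close>.\<close>

definition H01 :: "(real^'n) set \<Rightarrow> (real^'n \<Rightarrow> real) set"
  where "H01 \<Omega> = {w \<in> H1 \<Omega>. \<exists>\<phi>::nat \<Rightarrow> real^'n \<Rightarrow> real.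
     (\<forall>n. \<phi> n \<in> test_functions \<Omega>) \<and>
     (\<lambda>n. Lp_norm \<Omega> 2 (\<lambda>x. \<phi> n x - w x)) \<longlonglongrightarrow> 0 \<and>
     (\<lambda>n. Lp_norm \<Omega> 2 (\<lambda>x. grad (\<phi> n) x - wgrad \<Omega> w x)) \<longlonglongrightarrow> 0}"

definition H01_norm :: "(real^'n) set \<Rightarrow> (real^'n \<Rightarrow> real) \<Rightarrow> real"
  where "H01_norm \<Omega> w = Lp_norm \<Omega> 2 (wgrad \<Omega> w)"

section \<open>The exponents and the Sobolev constant\<close>

definition admissible_exponent :: "nat \<Rightarrow> real \<Rightarrow> bool"
  where "admissible_exponent N r \<longleftrightarrow>
    (N \<ge> 3 \<longrightarrow> r = 2 * real N / (real N + 2)) \<and> (N = 2 \<longrightarrow> r > 1) \<and> (N = 1 \<longrightarrow> r = 1)"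

text \<open>The Hoelder conjugate of \<open>r \<ge> 1\<close>.\<close>

definition conjugate_exponent :: "real \<Rightarrow> ennreal"
  where "conjugate_exponent r = (if r = 1 then \<infinity> else ennreal (r / (r - 1)))"

definition Sobolev_constant :: "(real^'n) set \<Rightarrow> ennreal \<Rightarrow> real \<Rightarrow> bool"
  where "Sobolev_constant \<Omega> p C \<longleftrightarrow>
    (\<forall>v\<in>H01 \<Omega>. v \<in> Lp \<Omega> p \<and> Lp_norm \<Omega> p v \<le> C * Lp_norm \<Omega> 2 (wgrad \<Omega> v))"

section \<open>Truncations\<close>

definition trunc :: "real \<Rightarrow> real \<Rightarrow> real"
  where "trunc k s = max (- k) (min s k)"

definition trunc_rest :: "real \<Rightarrow> real \<Rightarrow> real"
  where "trunc_rest k s = s - trunc k s"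

section \<open>Distributions and the space \<open>\<V>(\<Omega>)\<close>\<close>

text \<open>
  Distributions enter only through their values on \<^term>\<open>test_functions \<Omega>\<close>. The three functionals
  are \<open>- div G\<close> for a square integrable field \<open>G\<close>, \<open>\<phi>' (- div g)\<close>, and the distribution
  given by an integrable function \<open>f\<close>.
\<close>

definition neg_div :: "(real^'n) set \<Rightarrow> (real^'n \<Rightarrow> real^'n) \<Rightarrow> (real^'n \<Rightarrow> real) \<Rightarrow> real"
  where "neg_div \<Omega> G \<phi> = (\<integral>x. G x \<bullet> grad \<phi> x \<partial>lebesgue_on \<Omega>)"

definition times_neg_div ::
    "(real^'n) set \<Rightarrow> (real^'n \<Rightarrow> real) \<Rightarrow> (real^'n \<Rightarrow> real^'n) \<Rightarrow> (real^'n \<Rightarrow> real) \<Rightarrow> real"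
  where "times_neg_div \<Omega> \<phi>' g \<phi> = (\<integral>x. g x \<bullet> wgrad \<Omega> (\<lambda>y. \<phi>' y * \<phi> y) x \<partial>lebesgue_on \<Omega>)"

definition regular_distribution :: "(real^'n) set \<Rightarrow> (real^'n \<Rightarrow> real) \<Rightarrow> (real^'n \<Rightarrow> real) \<Rightarrow> real"
  where "regular_distribution \<Omega> f \<phi> = (\<integral>x. f x * \<phi> x \<partial>lebesgue_on \<Omega>)"

text \<open>
  Finite index sets are taken to be sets of natural numbers, without loss of generality.
\<close>

definition V_representation ::
    "(real^'n) set \<Rightarrow> (real^'n \<Rightarrow> real^'n^'n) \<Rightarrow> (real^'n \<Rightarrow> real) \<Rightarrow>
     nat set \<Rightarrow> (nat \<Rightarrow> real^'n \<Rightarrow> real) \<Rightarrow> (nat \<Rightarrow> real^'n \<Rightarrow> real^'n) \<Rightarrow> (real^'n \<Rightarrow> real) \<Rightarrow> bool"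
  where "V_representation \<Omega> A v I \<phi>' g f \<longleftrightarrow>
    finite I \<and> (\<forall>i\<in>I. \<phi>' i \<in> H01 \<Omega> \<inter> Lp \<Omega> \<infinity>) \<and> (\<forall>i\<in>I. g i \<in> Lp \<Omega> 2) \<and> f \<in> Lp \<Omega> 1 \<and>
    (\<forall>\<phi>\<in>test_functions \<Omega>.
       neg_div \<Omega> (\<lambda>x. transpose (A x) *v wgrad \<Omega> v x) \<phi> =
       (\<Sum>i\<in>I. times_neg_div \<Omega> (\<phi>' i) (g i) \<phi>) + regular_distribution \<Omega> f \<phi>)"

definition V_space :: "(real^'n) set \<Rightarrow> (real^'n \<Rightarrow> real^'n^'n) \<Rightarrow> (real^'n \<Rightarrow> real) set"
  where "V_space \<Omega> A = {v \<in> H01 \<Omega> \<inter> Lp \<Omega> \<infinity>. \<exists>I \<phi>' g f. V_representation \<Omega> A v I \<phi>' g f}"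

section \<open>The singular problem\<close>

text \<open>Only the values \<open>F x s\<close> with \<open>x \<in> \<Omega>\<close> and \<open>s \<ge> 0\<close> matter.\<close>

definition Caratheodory_function :: "(real^'n) set \<Rightarrow> (real^'n \<Rightarrow> real \<Rightarrow> ennreal) \<Rightarrow> bool"
  where "Caratheodory_function \<Omega> F \<longleftrightarrow>
    (\<forall>s\<ge>0. (\<lambda>x. F x s) \<in> borel_measurable (lebesgue_on \<Omega>)) \<and>
    (AE x in lebesgue_on \<Omega>. continuous_on {0..} (F x))"

definition is_solution ::
    "(real^'n) set \<Rightarrow> (real^'n \<Rightarrow> real^'n^'n) \<Rightarrow> (real^'n \<Rightarrow> real \<Rightarrow> ennreal) \<Rightarrow> (real^'n \<Rightarrow> real) \<Rightarrow> bool"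
  where "is_solution \<Omega> A F u \<longleftrightarrow>
    u \<in> Lp \<Omega> 2 \<inter> H1_loc \<Omega> \<and>
    (AE x in lebesgue_on \<Omega>. u x \<ge> 0) \<and>
    (\<forall>k>0. (\<lambda>x. trunc_rest k (u x)) \<in> H01 \<Omega>) \<and>
    (\<forall>k>0. \<forall>\<phi>\<in>H01 \<Omega> \<inter> Lp \<Omega> \<infinity>. (\<lambda>x. \<phi> x * trunc k (u x)) \<in> H01 \<Omega>) \<and>
    (\<forall>v\<in>V_space \<Omega> A. (AE x in lebesgue_on \<Omega>. v x \<ge> 0) \<longrightarrow>
      (\<forall>I \<phi>' g f. V_representation \<Omega> A v I \<phi>' g f \<longrightarrow>
        (\<integral>\<^sup>+x. F x (u x) * ennreal (v x) \<partial>lebesgue_on \<Omega>) < \<infinity> \<and>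
        (\<forall>k>0.
          (\<integral>x. (transpose (A x) *v wgrad \<Omega> v x) \<bullet> wgrad \<Omega> (\<lambda>y. trunc_rest k (u y)) x \<partial>lebesgue_on \<Omega>)
          + (\<Sum>i\<in>I. \<integral>x. g i x \<bullet> wgrad \<Omega> (\<lambda>y. \<phi>' i y * trunc k (u y)) x \<partial>lebesgue_on \<Omega>)
          + (\<integral>x. f x * trunc k (u x) \<partial>lebesgue_on \<Omega>)
          = enn2real (\<integral>\<^sup>+x. F x (u x) * ennreal (v x) \<partial>lebesgue_on \<Omega>))))"

end

theory Submission
  imports Defs
begin

text \<open>
  Formally the estimate is the energy identity for the test function \<open>G\<^sub>k(u)\<close>. Coercivity bounds
  the left-hand side below by \<open>\<alpha> \<integral>|DG\<^sub>k(u)|\<^sup>2\<close>. On the right, \<open>G\<^sub>k(u)\<close> vanishes unless \<open>u > k\<close>, where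
  \<open>F(x,u) \<le> h/\<Gamma>(u) \<le> h/\<Gamma>(k)\<close> because \<open>\<Gamma>\<close> increases; the Hoelder inequality and the Sobolev constant
  then give \<open>\<alpha> ||DG\<^sub>k(u)||\<^sup>2 \<le> C\<^sub>S ||h|| ||DG\<^sub>k(u)|| / \<Gamma>(k)\<close>.

  The difficulty is that \<open>G\<^sub>k(u)\<close> need not be bounded, so it need not belong to \<open>\<V>(\<Omega>)\<close>. Its
  truncations \<open>\<phi> = T\<^sub>m(G\<^sub>k(u))\<close> do belong to that space, with a very simple representation. Let \<open>\<psi>\<close> be
  \<open>T\<^sub>k\<^sub>/\<^sub>2(G\<^sub>k\<^sub>/\<^sub>2(u))\<close> divided by \<open>k/2\<close>. Then \<open>\<psi> = 1\<close> and \<open>D\<psi> = 0\<close> on \<open>{u > k}\<close>, and \<open>D\<phi> = 0\<close> off that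
  set, so that \<open>- div(\<^sup>tA D\<phi>) = \<psi> (- div(\<^sup>tA D\<phi>))\<close>: one term and no integrable remainder. In the
  equation at level \<open>k\<close> this term contributes \<open>\<integral> \<^sup>tA D\<phi> \<cdot> D(\<psi> T\<^sub>k(u))\<close>, which is zero: on \<open>{u > k}\<close> the
  function \<open>\<psi> T\<^sub>k(u)\<close> attains its maximum \<open>k\<close>, and a weak gradient vanishes almost everywhere where the
  maximum is attained. This is \<open>clamped_rest_energy_le\<close>; together with \<open>source_term_le\<close> it bounds
  \<open>||DT\<^sub>m(G\<^sub>k(u))||\<close> independently of \<open>m\<close>, and \<open>m\<close> tends to infinity.

  The Sobolev space calculus behind this consists of two facts. Weak gradients are unique
  (\<open>du_Bois_Reymond\<close>), which needs a supply of test functions built from \<open>exp(-1/t)\<close>. And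
  \<open>H\<^sub>0\<^sup>1(\<Omega>)\<close> is stable under \<open>w \<mapsto> max w c - max 0 c\<close>, with the gradient \<open>Dw\<close> restricted to
  \<open>{w > c}\<close> (\<open>H01_grad_max\<close>): smooth functions approximating this one map test functions to test
  functions, and \<open>H\<^sub>0\<^sup>1(\<Omega>)\<close> is closed. Truncations, and the vanishing of gradients at extreme
  values, both follow from the second fact.
\<close>

section \<open>Calculus of smooth functions\<close>

lemma Ck_Suc_imp: "Ck (Suc k) f \<Longrightarrow> Ck k f"
proof (induction k arbitrary: f)
  case 0
  then show ?case
    by (auto intro!: continuous_at_imp_continuous_on differentiable_imp_continuous_within)
next
  case (Suc k)
  from Suc.prems have "f differentiable (at x)" "Ck (Suc k) (\<lambda>x. frechet_derivative f (at x) v)" for x v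
    by auto
  with Suc.IH show ?case by (simp del: Ck.simps(2) add: Ck.simps(2)[of k f])
qed

lemma Ck_const: "Ck k (\<lambda>x. c)"
  by (induction k arbitrary: c) auto

lemma Ck_add: "Ck k f \<Longrightarrow> Ck k g \<Longrightarrow> Ck k (\<lambda>x. f x + g x)"
proof (induction k arbitrary: f g)
  case 0 then show ?case by (simp add: continuous_on_add)
next
  case (Suc k)
  have df: "(f has_derivative frechet_derivative f (at x)) (at x)"
   and dg: "(g has_derivative frechet_derivative g (at x)) (at x)" for x
    using Suc.prems by (auto simp: frechet_derivative_works)
  have d: "((\<lambda>x. f x + g x) has_derivative (\<lambda>v. frechet_derivative f (at x) v + frechet_derivative g (at x) v)) (at x)" for x
    by (rule has_derivative_add[OF df dg])
  have "frechet_derivative (\<lambda>x. f x + g x) (at x) = (\<lambda>v. frechet_derivative f (at x) v + frechet_derivative g (at x) v)" for x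
    using frechet_derivative_at[OF d] by simp
  with Suc d show ?case by (auto intro: differentiableI)
qed

lemma Ck_mult: "Ck k f \<Longrightarrow> Ck k g \<Longrightarrow> Ck k (\<lambda>x. f x * g x)"
proof (induction k arbitrary: f g)
  case 0 then show ?case by (simp add: continuous_on_mult)
next
  case (Suc k)
  have df: "(f has_derivative frechet_derivative f (at x)) (at x)"
   and dg: "(g has_derivative frechet_derivative g (at x)) (at x)" for x
    using Suc.prems by (auto simp: frechet_derivative_works)
  have d: "((\<lambda>x. f x * g x) has_derivative (\<lambda>v. f x * frechet_derivative g (at x) v + frechet_derivative f (at x) v * g x)) (at x)" for x
    by (rule has_derivative_mult[OF df dg])
  have e: "frechet_derivative (\<lambda>x. f x * g x) (at x) = (\<lambda>v. f x * frechet_derivative g (at x) v + frechet_derivative f (at x) v * g x)" for x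
    using frechet_derivative_at[OF d] by simp
  have "Ck k f" "Ck k g" using Suc.prems Ck_Suc_imp by blast+
  with Suc have "Ck k (\<lambda>x. f x * frechet_derivative g (at x) v + frechet_derivative f (at x) v * g x)" for v
    by (intro Ck_add Suc.IH) auto
  then show ?case using d by (auto intro: differentiableI simp: e)
qed

lemma Ck_prod:
  assumes "finite I" "\<And>i. i \<in> I \<Longrightarrow> Ck k (f i)"
  shows "Ck k (\<lambda>x. \<Prod>i\<in>I. f i x)"
  using assms by (induction I rule: finite_induct) (auto intro!: Ck_const Ck_mult)

lemma Ck_coordinate:
  fixes i :: "'n::finite"
  shows "Ck k (\<lambda>x. c * (x $ i) + d)"
proof (cases k)
  case 0 then show ?thesis by (auto intro!: continuous_intros)
next
  case (Suc j)
  have d: "((\<lambda>x. c * (x $ i) + d) has_derivative (\<lambda>v. c * (v $ i))) (at x)" for x :: "real^'n"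
    by (auto intro!: derivative_eq_intros bounded_linear.has_derivative[OF bounded_linear_vec_nth])
  have e: "frechet_derivative (\<lambda>x::real^'n. c * (x $ i) + d) (at x) = (\<lambda>v. c * (v $ i))" for x
    using frechet_derivative_at[OF d] by simp
  show ?thesis using Suc d Ck_const by (auto intro: differentiableI simp: e)
qed

lemma frechet_derivative_compose_real:
  assumes "f differentiable (at x)" "(S has_real_derivative s) (at (f x))"
  shows "((\<lambda>x. S (f x)) has_derivative (\<lambda>v. s * frechet_derivative f (at x) v)) (at x)"
  using assms has_derivative_compose[of f "frechet_derivative f (at x)" x UNIV S "(*) s"]
  by (auto simp: frechet_derivative_works has_field_derivative_def)

text \<open>
  Smoothness of a function of one real variable is expressed by the sequence of its successive
  derivatives, so that the induction on the order can move along the sequence.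
\<close>

lemma Ck_compose:
  assumes D: "\<And>j t. (D j has_real_derivative D (Suc j) t) (at t)"
    and f: "\<And>k. Ck k f"
  shows "Ck k (\<lambda>x. D j (f x))"
proof (induction k arbitrary: j)
  case 0
  have "continuous_on UNIV (D j)"
    using D by (meson DERIV_isCont continuous_at_imp_continuous_on)
  moreover have "continuous_on UNIV f" using f[of 0] by simp
  ultimately show ?case by (simp add: continuous_on_compose2[of UNIV "D j"])
next
  case (Suc k)
  have "f differentiable (at x)" for x using f[of "Suc 0"] by simp
  note d = frechet_derivative_compose_real[OF this D, of j]
  have e: "frechet_derivative (\<lambda>x. D j (f x)) (at x) = (\<lambda>v. D (Suc j) (f x) * frechet_derivative f (at x) v)" for x
    using frechet_derivative_at[OF d] by simp
  have "Ck k (\<lambda>x. frechet_derivative f (at x) v)" for v using f[of "Suc k"] by simp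
  then have "Ck k (\<lambda>x. D (Suc j) (f x) * frechet_derivative f (at x) v)" for v
    by (intro Ck_mult Suc.IH)
  then show ?case using d by (auto intro: differentiableI simp: e)
qed

section \<open>Smooth cut-offs and ramps on the line\<close>

text \<open>
  The functions \<open>p(1/t) exp(-1/t)\<close>, extended by \<open>0\<close> to \<open>t \<le> 0\<close>. Carrying the polynomial along makes
  the class closed under differentiation, so that all its members are smooth at once.
\<close>

definition flat :: "real poly \<Rightarrow> real \<Rightarrow> real"
  where "flat p t = (if t \<le> 0 then 0 else poly p (1 / t) * exp (- (1 / t)))"

definition flat_deriv :: "real poly \<Rightarrow> real poly"
  where "flat_deriv p = [:0, 0, 1:] * (p - pderiv p)"

lemma poly_times_exp_tendsto_0: "((\<lambda>y::real. poly p y * exp (- y)) \<longlongrightarrow> 0) at_top"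
proof -
  have "((\<lambda>y. \<Sum>i\<le>degree p. coeff p i * (y ^ i / exp y)) \<longlongrightarrow> (\<Sum>i\<le>degree p. coeff p i * 0)) at_top"
    by (intro tendsto_sum tendsto_mult tendsto_const tendsto_power_div_exp_0)
  moreover have "(\<lambda>y. \<Sum>i\<le>degree p. coeff p i * (y ^ i / exp y)) = (\<lambda>y. poly p y * exp (- y))"
    by (auto simp: poly_altdef exp_minus divide_inverse sum_distrib_right mult.assoc)
  ultimately show ?thesis by simp
qed

lemma flat_tendsto_0: "(flat p \<longlongrightarrow> 0) (at_right 0)"
proof -
  have "((\<lambda>t. poly p (inverse t) * exp (- inverse t)) \<longlongrightarrow> 0) (at_right (0::real))"
    by (rule filterlim_compose[OF poly_times_exp_tendsto_0 filterlim_inverse_at_top_right])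
  then show ?thesis
    by (rule Lim_transform_eventually) (auto simp: eventually_at_filter flat_def divide_inverse)
qed

text \<open>
  Away from \<open>0\<close> this is the product rule. At \<open>0\<close> the difference quotient of \<open>flat p\<close> from the right is
  the function belonging to the polynomial \<open>x p(x)\<close>, and every such function tends to \<open>0\<close>.
\<close>

lemma flat_has_real_derivative: "(flat p has_real_derivative flat (flat_deriv p) t) (at t)"
proof (cases t "0::real" rule: linorder_cases)
  case less
  have "(flat p has_real_derivative 0) (at t)"
    by (rule has_field_derivative_transform_within_open[of "\<lambda>_. 0" _ _ "{..<0}"])
       (use less in \<open>auto simp: flat_def\<close>)
  with less show ?thesis by (simp add: flat_def)
next
  case greater
  have "((\<lambda>t. poly p (1 / t) * exp (- (1 / t))) has_real_derivative
      flat (flat_deriv p) t) (at t)"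
    using greater
    by (auto intro!: derivative_eq_intros DERIV_chain2[OF poly_DERIV] simp: flat_def flat_deriv_def power2_eq_square field_simps)
  then show ?thesis
    by (rule has_field_derivative_transform_within_open[of _ _ _ "{0<..}"])
       (use greater in \<open>auto simp: flat_def\<close>)
next
  case equal
  have r: "((\<lambda>h. flat p h / h) \<longlongrightarrow> 0) (at_right 0)"
  proof (rule Lim_transform_eventually[OF flat_tendsto_0[of "[:0, 1:] * p"]])
    show "\<forall>\<^sub>F h in at_right 0. flat ([:0, 1:] * p) h = flat p h / h"
      by (auto simp: eventually_at_filter flat_def)
  qed
  have l: "((\<lambda>h. flat p h / h) \<longlongrightarrow> 0) (at_left 0)"
    by (rule Lim_transform_eventually[OF tendsto_const[of 0]])
       (auto simp: eventually_at_filter flat_def)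
  from filterlim_split_at[OF l r] have "(flat p has_real_derivative 0) (at 0)"
    by (simp add: DERIV_def flat_def)
  with equal show ?thesis by (simp add: flat_def)
qed

lemma flat_iterated:
  "((\<lambda>t. m ^ j * flat ((flat_deriv ^^ j) p) (m * t + d)) has_real_derivative
     m ^ Suc j * flat ((flat_deriv ^^ Suc j) p) (m * t + d)) (at t)"
  by (auto intro!: derivative_eq_intros DERIV_chain2[OF flat_has_real_derivative])

lemma Ck_flat:
  assumes "\<And>k. Ck k f"
  shows "Ck k (\<lambda>x. flat p (f x))"
  using Ck_compose[of "\<lambda>j t. 1 ^ j * flat ((flat_deriv ^^ j) p) (1 * t + 0)" f k 0, OF flat_iterated assms]
  by simp

text \<open>
  A smooth approximation of \<open>max t c - max 0 c\<close> for large \<open>m\<close>. Up to an additive constant it is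
  \<open>s exp(-1/s)\<close> at \<open>s = m (t - c)\<close>, divided by \<open>m\<close>; the function \<open>s exp(-1/s)\<close> is used because its
  derivative \<open>(1 + 1/s) exp(-1/s)\<close> lies between \<open>0\<close> and \<open>1\<close>
  and tends to \<open>1\<close> for \<open>s \<rightarrow> \<infinity>\<close>. The constant makes it vanish at \<open>0\<close>, so that composition with it
  preserves compact supports.
\<close>

definition ramp :: "real \<Rightarrow> real \<Rightarrow> real \<Rightarrow> real"
  where "ramp c m t = (t - c) * flat 1 (m * (t - c)) - (0 - c) * flat 1 (m * (0 - c))"

text \<open>
  From the first one on, the derivatives of \<^const>\<open>ramp\<close> are rescaled members of the family
  \<^const>\<open>flat\<close>, starting with the polynomial \<open>1 + x\<close>.
\<close>

definition ramp_jet :: "real \<Rightarrow> real \<Rightarrow> nat \<Rightarrow> real \<Rightarrow> real"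
  where "ramp_jet c m j t = (case j of 0 \<Rightarrow> ramp c m t
     | Suc i \<Rightarrow> m ^ i * flat ((flat_deriv ^^ i) [:1, 1:]) (m * t + (- m * c)))"

lemma ramp_jet_DERIV:
  assumes "m > 0"
  shows "(ramp_jet c m j has_real_derivative ramp_jet c m (Suc j) t) (at t)"
proof (cases j)
  case 0
  have "(ramp c m has_real_derivative flat 1 (m * (t - c)) + (t - c) * (m * flat (flat_deriv 1) (m * (t - c)))) (at t)"
    unfolding ramp_def[abs_def]
    by (auto intro!: derivative_eq_intros DERIV_chain2[OF flat_has_real_derivative])
  moreover have "flat 1 s + s * flat (flat_deriv 1) s = flat [:1, 1:] s" for s
    by (auto simp: flat_def flat_deriv_def field_simps)
  from this[of "m * (t - c)"] have "flat 1 (m * (t - c)) + (t - c) * (m * flat (flat_deriv 1) (m * (t - c))) = flat [:1, 1:] (m * t - m * c)"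
    by (simp add: algebra_simps)
  moreover have "ramp_jet c m 0 = ramp c m" by (simp add: ramp_jet_def fun_eq_iff)
  ultimately show ?thesis using 0 by (simp add: ramp_jet_def)
next
  case (Suc i)
  then show ?thesis using flat_iterated[of m i "[:1,1:]" "- m * c" t] by (simp add: ramp_jet_def[abs_def])
qed

lemma flat_ramp_bounds: "0 \<le> flat [:1, 1:] s" "flat [:1, 1:] s \<le> 1"
proof -
  have "(1 + y) * exp (- y) \<le> 1" if "y > 0" for y :: real
  proof -
    have "(1 + y) * exp (- y) \<le> exp y * exp (- y)"
      by (intro mult_right_mono exp_ge_add_one_self) auto
    then show ?thesis by (simp add: exp_minus)
  qed
  from this[of "1/s"] show "0 \<le> flat [:1, 1:] s" "flat [:1, 1:] s \<le> 1" by (auto simp: flat_def)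
qed

lemma flat_1_bounds: "0 \<le> flat 1 s" "flat 1 s \<le> 1"
  by (auto simp: flat_def)

text \<open>
  Stretching the variable turns \<^const>\<open>flat\<close> into the indicator of the open half-line, up to the
  constant coefficient of the polynomial. The value at \<open>t = 0\<close> is exactly \<open>0\<close>, hence the strict
  inequality here and in the gradients computed from it.
\<close>

lemma flat_scaled_tendsto:
  "(\<lambda>n. flat p (real (Suc n) * t)) \<longlonglongrightarrow> (if t > 0 then poly p 0 else 0)"
proof (cases "t > 0")
  case True
  have y: "(\<lambda>n. inverse (real (Suc n)) * inverse t) \<longlonglongrightarrow> 0 * inverse t"
    by (intro tendsto_intros LIMSEQ_inverse_real_of_nat)
  have "(\<lambda>n. poly p (inverse (real (Suc n)) * inverse t) * exp (- (inverse (real (Suc n)) * inverse t))) \<longlonglongrightarrow> poly p (0 * inverse t) * exp (- (0 * inverse t))"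
    by (intro tendsto_intros y)
  moreover have "flat p (real (Suc n) * t) = poly p (inverse (real (Suc n)) * inverse t) * exp (- (inverse (real (Suc n)) * inverse t))" for n
  proof -
    have "real (Suc n) * t > 0" using True by (intro mult_pos_pos) auto
    then show ?thesis
      by (simp add: flat_def divide_inverse not_le[symmetric])
  qed
  ultimately show ?thesis using True by simp
next
  case False
  then have "real (Suc n) * t \<le> 0" for n by (simp add: mult_nonneg_nonpos)
  then show ?thesis using False by (simp add: flat_def)
qed

lemma ramp_jet_1_tendsto: "(\<lambda>n. ramp_jet c (real (Suc n)) 1 t) \<longlonglongrightarrow> indicat_real {c<..} t"
  using flat_scaled_tendsto[of "[:1, 1:]" "t - c"]
  by (simp add: ramp_jet_def algebra_simps indicator_def split: if_splits)

lemma ramp_tendsto: "(\<lambda>n. ramp c (real (Suc n)) t) \<longlonglongrightarrow> max t c - max 0 c"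
proof -
  have "(\<lambda>n. ramp c (real (Suc n)) t) \<longlonglongrightarrow> (t - c) * (if t - c > 0 then poly 1 0 else 0) - (0 - c) * (if 0 - c > 0 then poly 1 0 else 0)"
    unfolding ramp_def by (intro tendsto_intros flat_scaled_tendsto)
  also have "(t - c) * (if t - c > 0 then poly 1 0 else 0) - (0 - c) * (if 0 - c > 0 then poly 1 0 else 0) = max t c - max 0 c"
    by (auto simp: max_def)
  finally show ?thesis .
qed

lemma ramp_zero: "ramp c m 0 = 0" by (simp add: ramp_def)

lemma ramp_jet_1_bounds: "0 \<le> ramp_jet c m 1 t" "ramp_jet c m 1 t \<le> 1"
  by (auto simp: ramp_jet_def flat_ramp_bounds)

section \<open>Test functions\<close>

lemma test_functions_Ck: "\<phi> \<in> test_functions \<Omega> \<Longrightarrow> Ck k \<phi>"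
  by (simp add: test_functions_def)

lemma test_functions_differentiable: "\<phi> \<in> test_functions \<Omega> \<Longrightarrow> \<phi> differentiable (at x)"
  using test_functions_Ck[of \<phi> \<Omega> "Suc 0"] by simp

lemma test_functionsI:
  assumes "\<And>k. Ck k \<phi>" "compact K" "K \<subseteq> \<Omega>" "\<And>x. x \<notin> K \<Longrightarrow> \<phi> x = 0"
  shows "\<phi> \<in> test_functions \<Omega>"
proof -
  have "closure {x. \<phi> x \<noteq> 0} \<subseteq> K"
    using assms by (intro closure_minimal compact_imp_closed) auto
  with assms show ?thesis
    unfolding test_functions_def
    by (auto simp: compact_eq_bounded_closed dest: bounded_subset)
qed

lemma test_functionsE:
  assumes "\<phi> \<in> test_functions \<Omega>"
  obtains K where "compact K" "K \<subseteq> \<Omega>" "\<And>x. x \<notin> K \<Longrightarrow> \<phi> x = 0"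
proof (rule that)
  show "compact (closure {x. \<phi> x \<noteq> 0})" "closure {x. \<phi> x \<noteq> 0} \<subseteq> \<Omega>"
    using assms by (simp_all add: test_functions_def)
  show "\<phi> x = 0" if "x \<notin> closure {x. \<phi> x \<noteq> 0}" for x
    using that closure_subset[of "{x. \<phi> x \<noteq> 0}"] by blast
qed

lemma test_functions_add:
  assumes "\<phi> \<in> test_functions \<Omega>" "\<eta> \<in> test_functions \<Omega>"
  shows "(\<lambda>x. \<phi> x + \<eta> x) \<in> test_functions \<Omega>"
proof -
  obtain K where K: "compact K" "K \<subseteq> \<Omega>" "\<And>x. x \<notin> K \<Longrightarrow> \<phi> x = 0"
    using assms(1) by (rule test_functionsE) blast
  obtain L where L: "compact L" "L \<subseteq> \<Omega>" "\<And>x. x \<notin> L \<Longrightarrow> \<eta> x = 0"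
    using assms(2) by (rule test_functionsE) blast
  show ?thesis
  proof (rule test_functionsI)
    show "Ck k (\<lambda>x. \<phi> x + \<eta> x)" for k
      by (rule Ck_add[OF assms[THEN test_functions_Ck]])
    show "compact (K \<union> L)" using K(1) L(1) by (rule compact_Un)
    show "K \<union> L \<subseteq> \<Omega>" using K(2) L(2) by blast
    show "\<phi> x + \<eta> x = 0" if "x \<notin> K \<union> L" for x
      using K(3)[of x] L(3)[of x] that by simp
  qed
qed

lemma test_functions_mult_smooth:
  assumes "\<phi> \<in> test_functions \<Omega>" "\<And>k. Ck k \<eta>"
  shows "(\<lambda>x. \<phi> x * \<eta> x) \<in> test_functions \<Omega>"
proof -
  obtain K where "compact K" "K \<subseteq> \<Omega>" "\<And>x. x \<notin> K \<Longrightarrow> \<phi> x = 0"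
    using assms(1) by (rule test_functionsE) blast
  then show ?thesis
    by (intro test_functionsI[OF Ck_mult[OF test_functions_Ck[OF assms(1)] assms(2)], of K]) simp_all
qed

text \<open>
  The condition \<open>D 0 0 = 0\<close> keeps the support of the composition inside that of \<open>\<phi>\<close>.
\<close>

lemma test_functions_compose:
  assumes "\<phi> \<in> test_functions \<Omega>" "\<And>j t. (D j has_real_derivative D (Suc j) t) (at t)" "D 0 0 = 0"
  shows "(\<lambda>x. D 0 (\<phi> x)) \<in> test_functions \<Omega>"
proof -
  obtain K where "compact K" "K \<subseteq> \<Omega>" "\<And>x. x \<notin> K \<Longrightarrow> \<phi> x = 0"
    using assms(1) by (rule test_functionsE) blast
  then show ?thesis
    by (intro test_functionsI[OF Ck_compose[of D, OF assms(2) test_functions_Ck[OF assms(1)]], of K]) (simp_all add: assms(3))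
qed

lemma grad_add:
  assumes "f differentiable (at x)" "g differentiable (at x)"
  shows "grad (\<lambda>x. f x + g x) x = grad f x + grad g x"
  using has_derivative_add[OF assms[unfolded frechet_derivative_works], THEN frechet_derivative_at, symmetric]
  by (simp add: grad_def vec_eq_iff)

lemma grad_mult:
  assumes "f differentiable (at x)" "g differentiable (at x)"
  shows "grad (\<lambda>x. f x * g x) x = f x *\<^sub>R grad g x + g x *\<^sub>R grad f x"
  using has_derivative_mult[OF assms[unfolded frechet_derivative_works], THEN frechet_derivative_at, symmetric]
  by (simp add: grad_def vec_eq_iff mult.commute)

lemma grad_compose:
  assumes "f differentiable (at x)" "(S has_real_derivative s) (at (f x))"
  shows "grad (\<lambda>x. S (f x)) x = s *\<^sub>R grad f x"
  using frechet_derivative_compose_real[OF assms, THEN frechet_derivative_at, symmetric]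
  by (simp add: grad_def vec_eq_iff)

lemma test_functions_const_mult:
  "\<phi> \<in> test_functions \<Omega> \<Longrightarrow> (\<lambda>x. c * \<phi> x) \<in> test_functions \<Omega>"
  using test_functions_mult_smooth[of \<phi> \<Omega> "\<lambda>_. c"] by (simp add: Ck_const mult.commute)

lemma continuous_on_grad: "\<phi> \<in> test_functions \<Omega> \<Longrightarrow> continuous_on UNIV (grad \<phi>)"
  using test_functions_Ck[of \<phi> \<Omega> "Suc 0"]
  unfolding grad_def by (auto intro!: continuous_on_vec_lambda)

lemma continuous_on_test_function: "\<phi> \<in> test_functions \<Omega> \<Longrightarrow> continuous_on UNIV \<phi>"
  using test_functions_Ck[of \<phi> \<Omega> 0] by simp

lemma grad_zero_outside:
  assumes "compact K" "\<And>x. x \<notin> K \<Longrightarrow> \<phi> x = 0" "x \<notin> K"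
  shows "grad \<phi> x = 0"
proof -
  have "(\<phi> has_derivative (\<lambda>_. 0)) (at x)"
    by (rule has_derivative_transform_within_open[of "\<lambda>_. 0" _ _ UNIV "-K"])
       (use assms in \<open>auto simp: compact_imp_closed open_Compl\<close>)
  from frechet_derivative_at[OF this, symmetric] show ?thesis
    by (simp add: grad_def vec_eq_iff)
qed

text \<open>
  Smooth functions that increase to the indicator of an open box and vanish off the closed box.
\<close>

definition box_bump :: "real^'n \<Rightarrow> real^'n \<Rightarrow> nat \<Rightarrow> real^'n \<Rightarrow> real"
  where "box_bump a b n x = (\<Prod>i\<in>UNIV. flat 1 (real (Suc n) * (x $ i - a $ i)) * flat 1 (real (Suc n) * (b $ i - x $ i)))"

lemma box_bump_zero_outside:
  fixes a b :: "real^'n"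
  assumes "x \<notin> cbox a b"
  shows "box_bump a b n x = 0"
proof -
  obtain i where "x $ i < a $ i \<or> b $ i < x $ i"
    using assms by (auto simp: mem_box_cart not_le)
  then have "real (Suc n) * (x $ i - a $ i) \<le> 0 \<or> real (Suc n) * (b $ i - x $ i) \<le> 0"
    by (auto intro!: mult_nonneg_nonpos)
  then have "flat 1 (real (Suc n) * (x $ i - a $ i)) * flat 1 (real (Suc n) * (b $ i - x $ i)) = 0"
    unfolding flat_def by auto
  then show ?thesis
    unfolding box_bump_def by (intro prod_zero) auto
qed

lemma box_bump_test_function:
  fixes a b :: "real^'n"
  assumes "cbox a b \<subseteq> \<Omega>"
  shows "box_bump a b n \<in> test_functions \<Omega>"
proof (rule test_functionsI[OF _ compact_cbox assms])
  fix k
  have c: "Ck k (\<lambda>x::real^'n. real (Suc n) * (x $ i) + - real (Suc n) * a $ i)"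
          "Ck k (\<lambda>x::real^'n. - real (Suc n) * (x $ i) + real (Suc n) * b $ i)" for k and i :: 'n
    by (rule Ck_coordinate)+
  have "Ck k (\<lambda>x. \<Prod>i\<in>UNIV. flat 1 (real (Suc n) * (x $ i) + - real (Suc n) * a $ i) * flat 1 (- real (Suc n) * (x $ i) + real (Suc n) * b $ i))"
    by (intro Ck_prod Ck_mult Ck_flat c) auto
  then show "Ck k (box_bump a b n)"
    by (simp add: box_bump_def[abs_def] algebra_simps)
qed (rule box_bump_zero_outside)

lemma box_bump_bounds: "0 \<le> box_bump a b n x" "box_bump a b n x \<le> 1"
  unfolding box_bump_def
  by (auto intro!: prod_nonneg prod_le_1 mult_nonneg_nonneg mult_le_one flat_1_bounds)

lemma box_bump_tendsto: "(\<lambda>n. box_bump a b n x) \<longlonglongrightarrow> indicat_real (box a b) x"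
proof -
  have "(\<lambda>n. box_bump a b n x) \<longlonglongrightarrow> (\<Prod>i\<in>UNIV. (if x $ i - a $ i > 0 then poly 1 0 else 0) * (if b $ i - x $ i > 0 then poly 1 0 else 0))"
    unfolding box_bump_def by (intro tendsto_prod tendsto_mult flat_scaled_tendsto)
  moreover have "(\<Prod>i\<in>UNIV. (if x $ i - a $ i > 0 then poly 1 0 else 0) * (if b $ i - x $ i > 0 then poly 1 0 else 0)) = indicat_real (box a b) x"
    by (auto simp: indicator_def mem_box_cart prod_zero_iff intro!: prod.neutral)
  ultimately show ?thesis by simp
qed

section \<open>Square integrable functions and the Hoelder inequality\<close>

lemma Lp_2_iff: "f \<in> Lp \<Omega> 2 \<longleftrightarrow> f \<in> borel_measurable (lebesgue_on \<Omega>) \<and> integrable (lebesgue_on \<Omega>) (\<lambda>x. (norm (f x))\<^sup>2)"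
  by (simp add: Lp_def)

lemma Lp_norm_2: "Lp_norm \<Omega> 2 f = sqrt (\<integral>x. (norm (f x))\<^sup>2 \<partial>lebesgue_on \<Omega>)"
  by (simp add: Lp_norm_def powr_half_sqrt integral_nonneg_AE)

lemma Lp_2_bound:
  assumes "g \<in> borel_measurable (lebesgue_on \<Omega>)" "AE x in lebesgue_on \<Omega>. norm (g x) \<le> C * norm (f x)" "f \<in> Lp \<Omega> 2"
  shows "g \<in> Lp \<Omega> 2"
proof -
  have "integrable (lebesgue_on \<Omega>) (\<lambda>x. C\<^sup>2 * (norm (f x))\<^sup>2)"
    using assms(3) by (simp add: Lp_2_iff)
  then have "integrable (lebesgue_on \<Omega>) (\<lambda>x. (norm (g x))\<^sup>2)"
  proof (rule Bochner_Integration.integrable_bound)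
    show "AE x in lebesgue_on \<Omega>. norm ((norm (g x))\<^sup>2) \<le> norm (C\<^sup>2 * (norm (f x))\<^sup>2)"
      using assms(2)
    proof eventually_elim
      fix x assume "norm (g x) \<le> C * norm (f x)"
      then have "(norm (g x))\<^sup>2 \<le> (C * norm (f x))\<^sup>2" by (intro power_mono) auto
      then show "norm ((norm (g x))\<^sup>2) \<le> norm (C\<^sup>2 * (norm (f x))\<^sup>2)" by (simp add: power_mult_distrib)
    qed
  qed (use assms(1) in measurable)
  with assms(1) show ?thesis by (simp add: Lp_2_iff)
qed

lemma norm_add_square_le: "(norm (a + b))\<^sup>2 \<le> 2 * (norm a)\<^sup>2 + 2 * (norm (b::'a::real_normed_vector))\<^sup>2"
proof -
  have "(norm (a + b))\<^sup>2 \<le> (norm a + norm b)\<^sup>2" by (intro power_mono norm_triangle_ineq) auto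
  also have "\<dots> \<le> 2 * (norm a)\<^sup>2 + 2 * (norm b)\<^sup>2"
    using sum_squares_bound[of "norm a" "norm b"] by (simp add: power2_sum)
  finally show ?thesis .
qed

lemma Lp_2_add:
  assumes "f \<in> Lp \<Omega> 2" "g \<in> Lp \<Omega> 2"
  shows "(\<lambda>x. f x + g x) \<in> Lp \<Omega> 2"
proof -
  from assms have [measurable]: "f \<in> borel_measurable (lebesgue_on \<Omega>)" "g \<in> borel_measurable (lebesgue_on \<Omega>)"
    by (auto simp: Lp_2_iff)
  have "integrable (lebesgue_on \<Omega>) (\<lambda>x. 2 * (norm (f x))\<^sup>2 + 2 * (norm (g x))\<^sup>2)"
    using assms by (simp add: Lp_2_iff)
  then have "integrable (lebesgue_on \<Omega>) (\<lambda>x. (norm (f x + g x))\<^sup>2)"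
    by (rule Bochner_Integration.integrable_bound) (auto simp: norm_add_square_le)
  then show ?thesis by (simp add: Lp_2_iff)
qed

lemma Lp_2_scaleR: "f \<in> Lp \<Omega> 2 \<Longrightarrow> (\<lambda>x. c *\<^sub>R f x) \<in> Lp \<Omega> 2"
  by (rule Lp_2_bound[where f=f and C="\<bar>c\<bar>"]) (auto simp: Lp_2_iff)

lemma Lp_2_diff: "f \<in> Lp \<Omega> 2 \<Longrightarrow> g \<in> Lp \<Omega> 2 \<Longrightarrow> (\<lambda>x. f x - g x) \<in> Lp \<Omega> 2"
  using Lp_2_add[OF _ Lp_2_scaleR[of g \<Omega> "-1"]] by simp

text \<open>
  Squares of distances satisfy the triangle inequality up to the factor \<open>2\<close>, which suffices for
  convergence and avoids the Minkowski inequality.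
\<close>

definition sq_dist :: "(real^'n) set \<Rightarrow> (real^'n \<Rightarrow> 'b::{banach,second_countable_topology}) \<Rightarrow> (real^'n \<Rightarrow> 'b) \<Rightarrow> real"
  where "sq_dist \<Omega> f g = (\<integral>x. (norm (f x - g x))\<^sup>2 \<partial>lebesgue_on \<Omega>)"

lemma sq_dist_nonneg: "0 \<le> sq_dist \<Omega> f g"
  by (simp add: sq_dist_def)

lemma integrable_sq_dist: "f \<in> Lp \<Omega> 2 \<Longrightarrow> g \<in> Lp \<Omega> 2 \<Longrightarrow> integrable (lebesgue_on \<Omega>) (\<lambda>x. (norm (f x - g x))\<^sup>2)"
  using Lp_2_diff by (auto simp: Lp_2_iff)

lemma sq_dist_triangle:
  assumes "f \<in> Lp \<Omega> 2" "g \<in> Lp \<Omega> 2" "h \<in> Lp \<Omega> 2"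
  shows "sq_dist \<Omega> f h \<le> 2 * sq_dist \<Omega> f g + 2 * sq_dist \<Omega> g h"
proof -
  have "sq_dist \<Omega> f h \<le> (\<integral>x. 2 * (norm (f x - g x))\<^sup>2 + 2 * (norm (g x - h x))\<^sup>2 \<partial>lebesgue_on \<Omega>)"
    unfolding sq_dist_def
  proof (intro integral_mono Bochner_Integration.integrable_add integrable_mult_right integrable_sq_dist assms)
    fix x show "(norm (f x - h x))\<^sup>2 \<le> 2 * (norm (f x - g x))\<^sup>2 + 2 * (norm (g x - h x))\<^sup>2"
      using norm_add_square_le[of "f x - g x" "g x - h x"] by simp
  qed
  also have "\<dots> = 2 * sq_dist \<Omega> f g + 2 * sq_dist \<Omega> g h"
    unfolding sq_dist_def using assms by (simp add: integrable_sq_dist)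
  finally show ?thesis .
qed

lemma Lp_norm_2_sq_dist: "Lp_norm \<Omega> 2 (\<lambda>x. f x - g x) = sqrt (sq_dist \<Omega> f g)"
  by (simp add: Lp_norm_2 sq_dist_def)

lemma Lp_norm_tendsto_0_iff:
  "((\<lambda>n. Lp_norm \<Omega> 2 (\<lambda>x. f n x - g x)) \<longlonglongrightarrow> 0) \<longleftrightarrow> ((\<lambda>n. sq_dist \<Omega> (f n) g) \<longlonglongrightarrow> 0)"
proof
  assume "(\<lambda>n. Lp_norm \<Omega> 2 (\<lambda>x. f n x - g x)) \<longlonglongrightarrow> 0"
  from tendsto_power[OF this, of 2] show "(\<lambda>n. sq_dist \<Omega> (f n) g) \<longlonglongrightarrow> 0"
    by (simp add: Lp_norm_2_sq_dist sq_dist_nonneg)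
next
  assume "(\<lambda>n. sq_dist \<Omega> (f n) g) \<longlonglongrightarrow> 0"
  from tendsto_real_sqrt[OF this] show "(\<lambda>n. Lp_norm \<Omega> 2 (\<lambda>x. f n x - g x)) \<longlonglongrightarrow> 0"
    by (simp add: Lp_norm_2_sq_dist)
qed

lemma integral_eq_0_imp_AE:
  fixes f :: "'a \<Rightarrow> real"
  assumes "integrable M f" "\<And>x. 0 \<le> f x" "integral\<^sup>L M f = 0"
  shows "AE x in M. f x = 0"
  using integral_nonneg_eq_0_iff_AE[OF assms(1)] assms(2,3) by simp

text \<open>
  Integration of the Young inequality for \<open>f\<close> and \<open>g\<close> normalized to unit norm.
\<close>

lemma Hoelder_inequality:
  fixes f g :: "'a \<Rightarrow> real"
  assumes pq: "p > 1" "q > 1" "1 / p + 1 / q = 1"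
    and [measurable]: "f \<in> borel_measurable M" "g \<in> borel_measurable M"
    and nn: "\<And>x. 0 \<le> f x" "\<And>x. 0 \<le> g x"
    and F: "integrable M (\<lambda>x. f x powr p)" and G: "integrable M (\<lambda>x. g x powr q)"
  shows "integrable M (\<lambda>x. f x * g x)"
    and "(\<integral>x. f x * g x \<partial>M) \<le> (\<integral>x. f x powr p \<partial>M) powr (1 / p) * (\<integral>x. g x powr q \<partial>M) powr (1 / q)"
proof -
  show i: "integrable M (\<lambda>x. f x * g x)"
  proof (rule Bochner_Integration.integrable_bound)
    show "integrable M (\<lambda>x. f x powr p / p + g x powr q / q)" using F G by simp
    show "AE x in M. norm (f x * g x) \<le> norm (f x powr p / p + g x powr q / q)"
      using Youngs_inequality[OF pq nn] nn by (auto intro!: AE_I2 order_trans[OF _ abs_ge_self])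
  qed simp
  define a where "a = (\<integral>x. f x powr p \<partial>M)"
  define b where "b = (\<integral>x. g x powr q \<partial>M)"
  have ab: "0 \<le> a" "0 \<le> b" by (auto simp: a_def b_def)
  show "(\<integral>x. f x * g x \<partial>M) \<le> (\<integral>x. f x powr p \<partial>M) powr (1 / p) * (\<integral>x. g x powr q \<partial>M) powr (1 / q)"
  proof (cases "a = 0 \<or> b = 0")
    case True
    then have "(AE x in M. f x powr p = 0) \<or> (AE x in M. g x powr q = 0)"
      using integral_eq_0_imp_AE[OF F] integral_eq_0_imp_AE[OF G] by (auto simp: a_def b_def)
    then have "AE x in M. f x * g x = 0" by (elim disjE eventually_mono) auto
    then have "(\<integral>x. f x * g x \<partial>M) = 0" by (rule integral_eq_zero_AE)
    then show ?thesis by simp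
  next
    case False
    with ab have ab: "0 < a" "0 < b" by auto
    define c where "c = a powr (1 / p)"
    define d where "d = b powr (1 / q)"
    have cd: "0 < c" "0 < d" "c powr p = a" "d powr q = b"
      using ab pq by (auto simp: c_def d_def powr_powr)
    have Y: "f x * g x \<le> c * d * (f x powr p / a / p + g x powr q / b / q)" for x
    proof -
      have "f x / c * (g x / d) \<le> (f x / c) powr p / p + (g x / d) powr q / q"
        using nn cd by (intro Youngs_inequality pq) auto
      also have "\<dots> = f x powr p / a / p + g x powr q / b / q"
        using cd nn by (simp add: powr_divide)
      finally have "c * d * (f x / c * (g x / d)) \<le> c * d * (f x powr p / a / p + g x powr q / b / q)"
        using cd by (intro mult_left_mono) auto
      then show ?thesis using cd by simp
    qed
    have "(\<integral>x. f x * g x \<partial>M) \<le> (\<integral>x. c * d * (f x powr p / a / p + g x powr q / b / q) \<partial>M)"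
      using F G by (intro integral_mono i Y) auto
    also have "\<dots> = c * d * (a / a / p + b / b / q)"
      using F G by (simp add: a_def b_def)
    also have "\<dots> = c * d" using ab pq by simp
    finally show ?thesis by (simp add: c_def d_def a_def b_def)
  qed
qed

lemma Cauchy_Schwarz_Lp_2:
  assumes "f \<in> Lp \<Omega> 2" "g \<in> Lp \<Omega> 2"
  shows "integrable (lebesgue_on \<Omega>) (\<lambda>x. norm (f x) * norm (g x))"
    and "(\<integral>x. norm (f x) * norm (g x) \<partial>lebesgue_on \<Omega>) \<le> Lp_norm \<Omega> 2 f * Lp_norm \<Omega> 2 g"
proof -
  have a: "integrable (lebesgue_on \<Omega>) (\<lambda>x. norm (f x) powr 2)" "integrable (lebesgue_on \<Omega>) (\<lambda>x. norm (g x) powr 2)"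
    "(\<lambda>x. norm (f x)) \<in> borel_measurable (lebesgue_on \<Omega>)" "(\<lambda>x. norm (g x)) \<in> borel_measurable (lebesgue_on \<Omega>)"
    using assms by (auto simp: Lp_2_iff)
  note H = Hoelder_inequality[OF _ _ _ a(3,4) _ _ a(1,2)]
  show "integrable (lebesgue_on \<Omega>) (\<lambda>x. norm (f x) * norm (g x))" using H(1) by simp
  show "(\<integral>x. norm (f x) * norm (g x) \<partial>lebesgue_on \<Omega>) \<le> Lp_norm \<Omega> 2 f * Lp_norm \<Omega> 2 g"
    using H(2) by (simp add: Lp_norm_2 powr_half_sqrt)
qed

lemma Lp_2_product_tendsto_0:
  assumes "\<And>n. f n \<in> Lp \<Omega> 2" "f0 \<in> Lp \<Omega> 2" "g \<in> Lp \<Omega> 2" "(\<lambda>n. sq_dist \<Omega> (f n) f0) \<longlonglongrightarrow> 0"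
  shows "(\<lambda>n. \<integral>x. norm (f n x - f0 x) * norm (g x) \<partial>lebesgue_on \<Omega>) \<longlonglongrightarrow> 0"
proof (rule tendsto_sandwich[OF _ _ tendsto_const])
  show "\<forall>\<^sub>F n in sequentially. 0 \<le> (\<integral>x. norm (f n x - f0 x) * norm (g x) \<partial>lebesgue_on \<Omega>)"
    by simp
  show "\<forall>\<^sub>F n in sequentially. (\<integral>x. norm (f n x - f0 x) * norm (g x) \<partial>lebesgue_on \<Omega>) \<le> Lp_norm \<Omega> 2 (\<lambda>x. f n x - f0 x) * Lp_norm \<Omega> 2 g"
    by (intro always_eventually allI Cauchy_Schwarz_Lp_2 Lp_2_diff assms)
  show "(\<lambda>n. Lp_norm \<Omega> 2 (\<lambda>x. f n x - f0 x) * Lp_norm \<Omega> 2 g) \<longlonglongrightarrow> 0"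
    using assms(4) by (intro tendsto_mult_left_zero) (simp add: Lp_norm_tendsto_0_iff)
qed

lemma Lp_2_imp_AE_subseq:
  assumes "\<And>n. f n \<in> Lp \<Omega> 2" "f0 \<in> Lp \<Omega> 2" "(\<lambda>n. sq_dist \<Omega> (f n) f0) \<longlonglongrightarrow> 0"
  obtains r :: "nat \<Rightarrow> nat" where "strict_mono r" "AE x in lebesgue_on \<Omega>. (\<lambda>n. f (r n) x) \<longlonglongrightarrow> f0 x"
proof -
  obtain r :: "nat \<Rightarrow> nat" where r: "strict_mono r" "AE x in lebesgue_on \<Omega>. (\<lambda>n. (norm (f (r n) x - f0 x))\<^sup>2) \<longlonglongrightarrow> 0"
    using tendsto_L1_AE_subseq[of "lebesgue_on \<Omega>" "\<lambda>n x. (norm (f n x - f0 x))\<^sup>2"] assms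
    by (auto simp: integrable_sq_dist sq_dist_def)
  have "AE x in lebesgue_on \<Omega>. (\<lambda>n. f (r n) x) \<longlonglongrightarrow> f0 x"
    using r(2)
  proof eventually_elim
    fix x assume "(\<lambda>n. (norm (f (r n) x - f0 x))\<^sup>2) \<longlonglongrightarrow> 0"
    from tendsto_real_sqrt[OF this] show "(\<lambda>n. f (r n) x) \<longlonglongrightarrow> f0 x"
      by (simp add: LIM_zero_iff tendsto_norm_zero_iff)
  qed
  with r that show thesis by blast
qed

section \<open>Integrability of functions with compact support\<close>

lemma compact_support_bounded:
  fixes f :: "real^'n \<Rightarrow> 'b::real_normed_vector"
  assumes "continuous_on UNIV f" "compact K" "\<And>x. x \<notin> K \<Longrightarrow> f x = 0"
  obtains C where "C \<ge> 0" "\<And>x. norm (f x) \<le> C"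
proof -
  have "bounded (f ` K)"
    using assms by (intro compact_imp_bounded compact_continuous_image) (auto intro: continuous_on_subset)
  then obtain C where C: "\<And>x. x \<in> K \<Longrightarrow> norm (f x) \<le> C" by (auto simp: bounded_iff)
  have "norm (f x) \<le> max C 0" for x
    using C[of x] assms(3)[of x] by (cases "x \<in> K") auto
  then show thesis using that[of "max C 0"] by auto
qed

lemma continuous_borel_measurable_lebesgue_on:
  fixes f :: "real^'n \<Rightarrow> 'b::{banach,second_countable_topology}"
  assumes "continuous_on UNIV f"
  shows "f \<in> borel_measurable (lebesgue_on \<Omega>)"
  using borel_measurable_continuous_onI[OF assms]
  by (simp add: measurable_completion measurable_restrict_space1)

lemma integrable_compact_support:
  fixes f :: "real^'n \<Rightarrow> 'b::{banach,second_countable_topology}"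
  assumes "\<Omega> \<in> sets lebesgue" "f \<in> borel_measurable (lebesgue_on \<Omega>)" "compact K" "\<And>x. x \<notin> K \<Longrightarrow> f x = 0"
    "\<And>x. norm (f x) \<le> C"
  shows "integrable (lebesgue_on \<Omega>) f"
proof (rule Bochner_Integration.integrable_bound)
  have "K \<in> lmeasurable" using assms(3) by (rule lmeasurable_compact)
  then have "integrable lebesgue (\<lambda>x. indicat_real (\<Omega> \<inter> K) x)"
    using fmeasurable_Int_fmeasurable[OF _ assms(1), of K]
    by (intro integrable_real_indicator) (auto simp: Int_commute fmeasurable_def)
  then show "integrable (lebesgue_on \<Omega>) (\<lambda>x. C * indicat_real K x)"
    using assms(1) by (subst integrable_restrict_space) (auto simp: indicator_inter_arith[abs_def] mult.left_commute)
  show "f \<in> borel_measurable (lebesgue_on \<Omega>)" by fact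
  show "AE x in lebesgue_on \<Omega>. norm (f x) \<le> norm (C * indicat_real K x)"
    using assms(4,5) by (auto intro!: AE_I2 simp: indicator_def order_trans[OF _ abs_ge_self])
qed

lemma test_function_bounded:
  assumes "\<phi> \<in> test_functions \<Omega>"
  obtains C where "C \<ge> 0" "\<And>x. \<bar>\<phi> x\<bar> \<le> C" "\<And>x. norm (grad \<phi> x) \<le> C"
proof -
  obtain K where K: "compact K" "K \<subseteq> \<Omega>" "\<And>x. x \<notin> K \<Longrightarrow> \<phi> x = 0"
    using test_functionsE[OF assms] by blast
  obtain B where B: "B \<ge> 0" "\<And>x. norm (\<phi> x) \<le> B"
    using compact_support_bounded[OF continuous_on_test_function[OF assms] K(1,3)] by blast
  obtain C where C: "C \<ge> 0" "\<And>x. norm (grad \<phi> x) \<le> C"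
    using compact_support_bounded[OF continuous_on_grad[OF assms] K(1) grad_zero_outside[OF K(1,3)]] by blast
  show thesis using that[of "max B C"] B C by (auto simp: le_max_iff_disj)
qed

lemma test_function_Lp_2:
  assumes "\<Omega> \<in> sets lebesgue" "\<phi> \<in> test_functions \<Omega>"
  shows "\<phi> \<in> Lp \<Omega> 2" "grad \<phi> \<in> Lp \<Omega> 2"
proof -
  obtain K where K: "compact K" "K \<subseteq> \<Omega>" "\<And>x. x \<notin> K \<Longrightarrow> \<phi> x = 0"
    using test_functionsE[OF assms(2)] by blast
  have Kg: "grad \<phi> x = 0" if "x \<notin> K" for x
    using grad_zero_outside[OF K(1) _ that] K(3) by blast
  obtain C where C: "C \<ge> 0" "\<And>x. \<bar>\<phi> x\<bar> \<le> C" "\<And>x. norm (grad \<phi> x) \<le> C"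
    using test_function_bounded[OF assms(2)] by blast
  have [measurable]: "\<phi> \<in> borel_measurable (lebesgue_on \<Omega>)" "grad \<phi> \<in> borel_measurable (lebesgue_on \<Omega>)"
    using continuous_on_test_function[OF assms(2)] continuous_on_grad[OF assms(2)]
    by (auto intro: continuous_borel_measurable_lebesgue_on)
  have "integrable (lebesgue_on \<Omega>) (\<lambda>x. (norm (\<phi> x))\<^sup>2)"
  proof (rule integrable_compact_support[OF assms(1) _ K(1)])
    show "norm ((norm (\<phi> x))\<^sup>2) \<le> C\<^sup>2" for x
      using power_mono[OF C(2)[of x], of 2] by simp
    show "(norm (\<phi> x))\<^sup>2 = 0" if "x \<notin> K" for x using K(3)[OF that] by simp
  qed simp
  then show "\<phi> \<in> Lp \<Omega> 2" by (simp add: Lp_2_iff)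
  have "integrable (lebesgue_on \<Omega>) (\<lambda>x. (norm (grad \<phi> x))\<^sup>2)"
  proof (rule integrable_compact_support[OF assms(1) _ K(1)])
    show "norm ((norm (grad \<phi> x))\<^sup>2) \<le> C\<^sup>2" for x
      using power_mono[OF C(3)[of x], of 2] by simp
    show "(norm (grad \<phi> x))\<^sup>2 = 0" if "x \<notin> K" for x using Kg[OF that] by simp
  qed simp
  then show "grad \<phi> \<in> Lp \<Omega> 2" by (simp add: Lp_2_iff)
qed

lemma Lp_2_imp_locally_integrable:
  fixes f :: "real^'n \<Rightarrow> 'b::{banach,second_countable_topology}"
  assumes "\<Omega> \<in> sets lebesgue" "f \<in> Lp \<Omega> 2"
  shows "locally_integrable \<Omega> f"
  unfolding locally_integrable_def set_integrable_def
proof (intro allI impI)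
  fix K :: "(real^'n) set" assume K: "compact K \<and> K \<subseteq> \<Omega>"
  then have [simp, measurable]: "K \<in> sets lebesgue" by (simp add: borel_compact)
  from assms have "(\<lambda>x. indicator \<Omega> x *\<^sub>R f x) \<in> borel_measurable lebesgue"
    by (simp add: Lp_2_iff borel_measurable_restrict_space_iff)
  then have "(\<lambda>x. indicat_real K x *\<^sub>R (indicator \<Omega> x *\<^sub>R f x)) \<in> borel_measurable lebesgue"
    by measurable
  moreover have e: "(\<lambda>x. indicat_real K x *\<^sub>R (indicator \<Omega> x *\<^sub>R f x)) = (\<lambda>x. indicator K x *\<^sub>R f x)"
    using K by (auto simp: indicator_def fun_eq_iff)
  ultimately have m: "(\<lambda>x. indicat_real K x *\<^sub>R f x) \<in> borel_measurable lebesgue" by simp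
  have i: "integrable lebesgue (\<lambda>x. indicat_real K x + indicat_real \<Omega> x * (norm (f x))\<^sup>2)"
    using assms K lmeasurable_compact[of K] by (intro Bochner_Integration.integrable_add)
      (auto simp: Lp_2_iff integrable_restrict_space fmeasurable_def)
  show "integrable lebesgue (\<lambda>x. indicat_real K x *\<^sub>R f x)"
  proof (rule Bochner_Integration.integrable_bound[OF i m AE_I2])
    fix x
    \<comment> \<open>On \<open>K\<close> a square integrable function is dominated by \<open>1\<close> plus its square.\<close>
    have "t \<le> 1 + t\<^sup>2" for t :: real using sum_power2_ge_zero[of "t - 1/2" 0] by (simp add: power2_eq_square algebra_simps)
    then show "norm (indicat_real K x *\<^sub>R f x) \<le> norm (indicat_real K x + indicat_real \<Omega> x * (norm (f x))\<^sup>2)"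
      using K by (auto simp: indicator_def)
  qed
qed

lemma integrable_compact_support_scaleR:
  fixes g :: "real^'n \<Rightarrow> 'b::{banach,second_countable_topology}"
  assumes "\<Omega> \<in> sets lebesgue" "locally_integrable \<Omega> g"
    and "continuous_on UNIV \<phi>" "compact K" "K \<subseteq> \<Omega>" "\<And>x. x \<notin> K \<Longrightarrow> \<phi> x = 0"
  shows "integrable (lebesgue_on \<Omega>) (\<lambda>x. \<phi> x *\<^sub>R g x)"
proof -
  obtain C where C: "C \<ge> 0" "\<And>x. norm (\<phi> x :: real) \<le> C"
    using compact_support_bounded[OF assms(3,4,6)] by blast
  have i: "integrable lebesgue (\<lambda>x. indicat_real K x *\<^sub>R g x)"
    using assms by (simp add: locally_integrable_def set_integrable_def)
  have "\<phi> \<in> borel_measurable lebesgue"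
    using continuous_borel_measurable_lebesgue_on[OF assms(3), of UNIV] by (simp add: lebesgue_on_UNIV_eq)
  have "integrable lebesgue (\<lambda>x. \<phi> x *\<^sub>R (indicat_real K x *\<^sub>R g x))"
  proof (rule Bochner_Integration.integrable_bound[of _ "\<lambda>x. C *\<^sub>R (indicat_real K x *\<^sub>R g x)"])
    show "integrable lebesgue (\<lambda>x. C *\<^sub>R (indicat_real K x *\<^sub>R g x))"
      using integrable_scaleR_right[OF i, of C] .
    show "(\<lambda>x. \<phi> x *\<^sub>R indicat_real K x *\<^sub>R g x) \<in> borel_measurable lebesgue"
      using \<open>\<phi> \<in> borel_measurable lebesgue\<close> borel_measurable_integrable[OF i] by (rule borel_measurable_scaleR)
    show "AE x in lebesgue. norm (\<phi> x *\<^sub>R indicat_real K x *\<^sub>R g x) \<le> norm (C *\<^sub>R (indicat_real K x *\<^sub>R g x))"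
      using C by (intro AE_I2) (auto intro!: mult_right_mono simp: indicator_def)
  qed
  also have "(\<lambda>x. \<phi> x *\<^sub>R (indicat_real K x *\<^sub>R g x)) = (\<lambda>x. indicat_real \<Omega> x *\<^sub>R (\<phi> x *\<^sub>R g x))"
    using assms(5,6) by (auto simp: indicator_def fun_eq_iff)
  finally show ?thesis using assms(1) by (simp add: integrable_restrict_space)
qed

section \<open>Integration by parts\<close>

text \<open>
  Difference quotients of \<open>f\<close> integrate to \<open>0\<close> by translation invariance of the Lebesgue measure. By
  the mean value theorem they are bounded uniformly, and they all vanish off one compact set, so
  the limit may be taken under the integral.
\<close>

lemma integral_directional_derivative_eq_0:
  fixes f :: "real^'n \<Rightarrow> real"
  assumes f: "Ck (Suc 0) f" and K: "compact K" "\<And>x. x \<notin> K \<Longrightarrow> f x = 0"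
  shows "(\<integral>x. frechet_derivative f (at x) v \<partial>lborel) = 0"
proof -
  define t where "t n = 1 / real (Suc n)" for n
  have t: "0 < t n" "t n \<le> 1" for n by (auto simp: t_def)
  have df: "f differentiable (at x)" for x using f by simp
  have cf: "continuous_on UNIV f" using Ck_Suc_imp[OF f] by simp
  have cd: "continuous_on UNIV (\<lambda>x. frechet_derivative f (at x) v)" using f by simp
  have dz: "frechet_derivative f (at x) v = 0" if "x \<notin> K" for x
  proof -
    have "(f has_derivative (\<lambda>_. 0)) (at x)"
      by (rule has_derivative_transform_within_open[of "\<lambda>_. 0" _ _ UNIV "-K"])
         (use K that in \<open>auto simp: compact_imp_closed open_Compl\<close>)
    from frechet_derivative_at[OF this, symmetric] show ?thesis by simp
  qed
  obtain C where C: "C \<ge> 0" "\<And>x. norm (frechet_derivative f (at x) v) \<le> C"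
    using compact_support_bounded[OF cd K(1) dz] by blast
  have line: "((\<lambda>s. f (x + s *\<^sub>R v)) has_real_derivative frechet_derivative f (at (x + s *\<^sub>R v)) v) (at s)" for x s
  proof -
    have "((\<lambda>s. x + s *\<^sub>R v) has_derivative (\<lambda>h. h *\<^sub>R v)) (at s)"
      by (auto intro!: derivative_eq_intros)
    from has_derivative_compose[OF this df[unfolded frechet_derivative_works]]
    have "((\<lambda>s. f (x + s *\<^sub>R v)) has_derivative (\<lambda>h. frechet_derivative f (at (x + s *\<^sub>R v)) (h *\<^sub>R v))) (at s)" .
    moreover have "frechet_derivative f (at (x + s *\<^sub>R v)) (h *\<^sub>R v) = frechet_derivative f (at (x + s *\<^sub>R v)) v * h" for h
      using linear_cmul[OF linear_frechet_derivative[OF df]] by (simp add: mult.commute)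
    ultimately show ?thesis by (simp add: has_field_derivative_def)
  qed
  \<comment> \<open>Off \<open>L\<close>, which collects all points from which some step \<open>s v\<close> with \<open>0 \<le> s \<le> 1\<close> leads into \<open>K\<close>, the difference quotients vanish.\<close>
  define L where "L = (\<lambda>p. fst p - snd p *\<^sub>R v) ` (K \<times> {0..1::real})"
  have L: "compact L"
    unfolding L_def
    by (intro compact_continuous_image compact_Times continuous_intros K(1) compact_Icc)
  define X where "X n x = (f (x + t n *\<^sub>R v) - f x) / t n" for n x
  have [measurable]: "f \<in> borel_measurable borel" "(\<lambda>x. frechet_derivative f (at x) v) \<in> borel_measurable borel"
    using cf cd by (auto intro: borel_measurable_continuous_onI)
  have fi: "integrable lborel f"
  proof -
    obtain B where B: "\<And>x. norm (f x) \<le> B"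
      using compact_support_bounded[OF cf K] by blast
    have "integrable (lebesgue_on UNIV) f"
      by (rule integrable_compact_support[OF _ continuous_borel_measurable_lebesgue_on[OF cf] K B]) simp
    then show ?thesis by (simp add: lebesgue_on_UNIV_eq integrable_completion)
  qed
  have shift: "integrable lborel (\<lambda>x. f (x + a))" "(\<integral>x. f (x + a) \<partial>lborel) = (\<integral>x. f x \<partial>lborel)" for a
    using fi integrable_distr_eq[of "(+) a" lborel borel f] integral_distr[of "(+) a" lborel borel f]
    by (simp_all add: lborel_distr_plus add.commute)
  have "(\<lambda>n. \<integral>x. X n x \<partial>lborel) \<longlonglongrightarrow> (\<integral>x. frechet_derivative f (at x) v \<partial>lborel)"
  proof (rule integral_dominated_convergence[where w="\<lambda>x. C * indicat_real L x"])
    show "(\<lambda>x. frechet_derivative f (at x) v) \<in> borel_measurable lborel" by simp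
    show "X n \<in> borel_measurable lborel" for n unfolding X_def by measurable
    have "integrable lborel (indicat_real L)"
      using L emeasure_compact_finite[OF L] by (intro integrable_real_indicator) (auto simp: borel_compact less_top)
    then show "integrable lborel (\<lambda>x. C * indicat_real L x)" by simp
    show "AE x in lborel. (\<lambda>n. X n x) \<longlonglongrightarrow> frechet_derivative f (at x) v"
    proof (rule AE_I2)
      fix x
      have "((\<lambda>h. (f (x + h *\<^sub>R v) - f x) / h) \<longlongrightarrow> frechet_derivative f (at x) v) (at 0)"
        using line[of x 0] by (simp add: DERIV_def)
      moreover have "filterlim t (at 0) sequentially"
        unfolding t_def filterlim_at using LIMSEQ_inverse_real_of_nat
        by (auto simp: divide_inverse)
      ultimately show "(\<lambda>n. X n x) \<longlonglongrightarrow> frechet_derivative f (at x) v"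
        unfolding X_def by (rule filterlim_compose)
    qed
    show "AE x in lborel. norm (X n x) \<le> C * indicat_real L x" for n
    proof (rule AE_I2)
      fix x
      show "norm (X n x) \<le> C * indicat_real L x"
      proof (cases "x \<in> L")
        case True
        have "\<exists>z>0. z < t n \<and> f (x + t n *\<^sub>R v) - f (x + 0 *\<^sub>R v) = (t n - 0) * frechet_derivative f (at (x + z *\<^sub>R v)) v"
          by (rule MVT2[OF t(1)]) (rule line)
        then obtain z where z: "f (x + t n *\<^sub>R v) - f x = t n * frechet_derivative f (at (x + z *\<^sub>R v)) v"
          by auto
        have "X n x = frechet_derivative f (at (x + z *\<^sub>R v)) v"
          unfolding X_def z using t(1)[of n] by simp
        then show ?thesis using C(2)[of "x + z *\<^sub>R v"] True by simp
      next
        case False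
        have "x \<notin> K" "x + t n *\<^sub>R v \<notin> K"
        proof -
          show "x \<notin> K"
          proof
            assume "x \<in> K"
            then have "(\<lambda>p. fst p - snd p *\<^sub>R v) (x, 0) \<in> L"
              unfolding L_def by (intro imageI) simp
            with False show False by simp
          qed
          show "x + t n *\<^sub>R v \<notin> K"
          proof
            assume "x + t n *\<^sub>R v \<in> K"
            then have "(\<lambda>p. fst p - snd p *\<^sub>R v) (x + t n *\<^sub>R v, t n) \<in> L"
              unfolding L_def using t[of n] by (intro imageI) auto
            with False show False by simp
          qed
        qed
        then show ?thesis using K(2) False by (simp add: X_def)
      qed
    qed
  qed
  moreover have "(\<integral>x. X n x \<partial>lborel) = 0" for n
    unfolding X_def using shift fi by simp
  ultimately show ?thesis by (simp add: LIMSEQ_const_iff)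
qed

lemma integral_grad_eq_0:
  assumes "\<Omega> \<in> sets lebesgue" "\<phi> \<in> test_functions \<Omega>"
  shows "(\<integral>x. grad \<phi> x \<partial>lebesgue_on \<Omega>) = 0" "integrable (lebesgue_on \<Omega>) (grad \<phi>)"
proof -
  obtain K where K: "compact K" "K \<subseteq> \<Omega>" "\<And>x. x \<notin> K \<Longrightarrow> \<phi> x = 0"
    using test_functionsE[OF assms(2)] by blast
  have gz: "grad \<phi> x = 0" if "x \<notin> K" for x
    using grad_zero_outside[OF K(1) _ that] K(3) by blast
  obtain C where "C \<ge> 0" "\<And>x. \<bar>\<phi> x\<bar> \<le> C" and C: "\<And>x. norm (grad \<phi> x) \<le> C"
    using test_function_bounded[OF assms(2)] by blast
  show i: "integrable (lebesgue_on \<Omega>) (grad \<phi>)"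
    by (rule integrable_compact_support[OF assms(1) continuous_borel_measurable_lebesgue_on[OF continuous_on_grad[OF assms(2)]] K(1) gz C])
  have "(\<integral>x. grad \<phi> x \<partial>lebesgue_on \<Omega>) $ i = 0" for i
  proof -
    have c: "continuous_on UNIV (\<lambda>x. grad \<phi> x $ i)" using continuous_on_grad[OF assms(2)] by (intro continuous_intros)
    have "(\<integral>x. grad \<phi> x \<partial>lebesgue_on \<Omega>) $ i = (\<integral>x. grad \<phi> x $ i \<partial>lebesgue_on \<Omega>)"
      using integral_bounded_linear[OF bounded_linear_vec_nth i] by simp
    also have "\<dots> = (\<integral>x. indicat_real \<Omega> x *\<^sub>R (grad \<phi> x $ i) \<partial>lebesgue)"
      using assms(1) by (subst integral_restrict_space) auto
    also have "\<dots> = (\<integral>x. grad \<phi> x $ i \<partial>lebesgue)"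
      using gz subsetD[OF K(2)] by (intro Bochner_Integration.integral_cong) (auto simp: indicator_def dest!: gz[OF contra_subsetD[OF K(2)]])
    also have "\<dots> = (\<integral>x. grad \<phi> x $ i \<partial>lborel)"
      using c by (intro integral_completion) (auto intro: borel_measurable_continuous_onI)
    also have "\<dots> = 0"
      using integral_directional_derivative_eq_0[OF test_functions_Ck[OF assms(2)] K(1,3), of "axis i 1"]
      by (simp add: grad_def)
    finally show ?thesis .
  qed
  then show "(\<integral>x. grad \<phi> x \<partial>lebesgue_on \<Omega>) = 0" by (simp add: vec_eq_iff)
qed

lemma integrable_test_function_mult:
  fixes g :: "real^'n \<Rightarrow> 'b::{banach,second_countable_topology}"
  assumes "\<Omega> \<in> sets lebesgue" "locally_integrable \<Omega> g" "\<phi> \<in> test_functions \<Omega>"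
  shows "integrable (lebesgue_on \<Omega>) (\<lambda>x. \<phi> x *\<^sub>R g x)"
proof -
  obtain K where K: "compact K" "K \<subseteq> \<Omega>" "\<And>x. x \<notin> K \<Longrightarrow> \<phi> x = 0"
    using test_functionsE[OF assms(3)] by blast
  show ?thesis
    by (rule integrable_compact_support_scaleR[OF assms(1,2) continuous_on_test_function[OF assms(3)] K])
qed

lemma integrable_mult_grad:
  fixes w :: "real^'n \<Rightarrow> real"
  assumes "\<Omega> \<in> sets lebesgue" "locally_integrable \<Omega> w" "\<phi> \<in> test_functions \<Omega>"
  shows "integrable (lebesgue_on \<Omega>) (\<lambda>x. w x *\<^sub>R grad \<phi> x)"
proof -
  obtain K where K: "compact K" "K \<subseteq> \<Omega>" "\<And>x. x \<notin> K \<Longrightarrow> \<phi> x = 0"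
    using test_functionsE[OF assms(3)] by blast
  have gz: "grad \<phi> x = 0" if "x \<notin> K" for x
    using grad_zero_outside[OF K(1) _ that] K(3) by blast
  have "integrable (lebesgue_on \<Omega>) (\<lambda>x. (grad \<phi> x $ i) *\<^sub>R w x)" for i
    using integrable_compact_support_scaleR[OF assms(1,2) _ K(1,2), of "\<lambda>x. grad \<phi> x $ i"] gz continuous_on_grad[OF assms(3)]
    by (auto intro!: continuous_intros)
  then have "integrable (lebesgue_on \<Omega>) (\<lambda>x. \<Sum>i\<in>UNIV. (grad \<phi> x $ i * w x) *\<^sub>R axis i (1::real))"
    by (intro Bochner_Integration.integrable_sum integrable_scaleR_left) auto
  moreover have "(\<Sum>i\<in>UNIV. (grad \<phi> x $ i * w x) *\<^sub>R axis i (1::real)) = w x *\<^sub>R grad \<phi> x" for x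
    by (simp add: vec_eq_iff axis_def if_distrib cong: if_cong)
  ultimately show ?thesis by simp
qed

text \<open>
  Integration by parts is the vanishing of the integral of the gradient of a product.
\<close>

lemma test_function_weak_gradient:
  assumes "\<Omega> \<in> sets lebesgue" "\<phi> \<in> test_functions \<Omega>"
  shows "is_weak_gradient \<Omega> \<phi> (grad \<phi>)"
  unfolding is_weak_gradient_def
proof (intro conjI ballI)
  show l: "locally_integrable \<Omega> \<phi>" "locally_integrable \<Omega> (grad \<phi>)"
    using assms by (auto intro: Lp_2_imp_locally_integrable test_function_Lp_2)
  fix \<eta> assume \<eta>: "\<eta> \<in> test_functions \<Omega>"
  have p: "(\<lambda>x. \<phi> x * \<eta> x) \<in> test_functions \<Omega>"
    using assms(2) test_functions_Ck[OF \<eta>] by (rule test_functions_mult_smooth)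
  have "0 = (\<integral>x. \<phi> x *\<^sub>R grad \<eta> x + \<eta> x *\<^sub>R grad \<phi> x \<partial>lebesgue_on \<Omega>)"
    using integral_grad_eq_0(1)[OF assms(1) p]
    by (simp add: grad_mult[OF test_functions_differentiable[OF assms(2)] test_functions_differentiable[OF \<eta>]])
  also have "\<dots> = (\<integral>x. \<phi> x *\<^sub>R grad \<eta> x \<partial>lebesgue_on \<Omega>) + (\<integral>x. \<eta> x *\<^sub>R grad \<phi> x \<partial>lebesgue_on \<Omega>)"
    by (intro Bochner_Integration.integral_add integrable_mult_grad integrable_test_function_mult l \<eta> assms(1))
  finally show "(\<integral>x. \<phi> x *\<^sub>R grad \<eta> x \<partial>lebesgue_on \<Omega>) = - (\<integral>x. \<eta> x *\<^sub>R grad \<phi> x \<partial>lebesgue_on \<Omega>)"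
    by (simp add: eq_neg_iff_add_eq_0)
qed

section \<open>Uniqueness of weak gradients\<close>

text \<open>
  Boxes form an intersection-stable generator of the Borel sets, so a Dynkin system argument
  extends the vanishing to them; Lebesgue sets differ from Borel sets by null sets.
\<close>

lemma integral_eq_0_on_sets_if_on_boxes:
  fixes f :: "'a::euclidean_space \<Rightarrow> 'b::{banach,second_countable_topology}"
  assumes f: "integrable lebesgue f" and z: "integral\<^sup>L lebesgue f = 0"
    and box: "\<And>c d. (LINT x:box c d|lebesgue. f x) = 0" and A: "A \<in> sets lebesgue"
  shows "(LINT x:A|lebesgue. f x) = 0"
proof -
  have si: "set_integrable lebesgue A f" if "A \<in> sets lebesgue" for A
    using f that by (auto simp: set_integrable_def intro: integrable_mult_indicator)
  have b: "(LINT x:A|lebesgue. f x) = 0" if "A \<in> sets borel" for A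
  proof -
    have "Int_stable (range (\<lambda>(a, b). box a b :: 'a set))"
      by (auto simp: Int_stable_def box_Int_box)
    moreover have "range (\<lambda>(a, b). box a b :: 'a set) \<subseteq> Pow UNIV" by auto
    moreover have "A \<in> sigma_sets UNIV (range (\<lambda>(a, b). box a b))"
      using that unfolding borel_eq_box by simp
    ultimately show ?thesis
    proof (induction rule: sigma_sets_induct_disjoint)
      case (basic A) then show ?case using box by auto
    next
      case empty then show ?case by (simp add: set_lebesgue_integral_def)
    next
      case (compl A)
      then have A: "A \<in> sets lebesgue" by (simp add: borel_eq_box)
      then have "(LINT x:A \<union> (UNIV - A)|lebesgue. f x) = (LINT x:A|lebesgue. f x) + (LINT x:(UNIV - A)|lebesgue. f x)"
        by (intro set_integral_Un si) auto
      moreover have "(LINT x:A \<union> (UNIV - A)|lebesgue. f x) = 0"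
        using z by (simp add: set_lebesgue_integral_def)
      ultimately show ?case using compl by simp
    next
      case (union A)
      then have A: "A i \<in> sets lebesgue" for i by (simp add: borel_eq_box subset_eq)
      have "(LINT x:(\<Union>i. A i)|lebesgue. f x) = (\<Sum>i. (LINT x:(A i)|lebesgue. f x))"
        using A union(1) by (intro lebesgue_integral_countable_add si) (auto simp: disjoint_family_on_def)
      then show ?case using union by simp
    qed
  qed
  obtain S N N' where S: "A = S \<union> N" "N \<subseteq> N'" "N' \<in> null_sets lborel" "S \<in> sets lborel"
    using sets_completionE[OF A] by blast
  have "(A - S) \<union> (S - A) \<in> null_sets lebesgue"
  proof (rule null_sets_completion_subset)
    show "A - S \<union> (S - A) \<subseteq> N'" using S(1,2) by blast
    show "N' \<in> null_sets lebesgue" using S(3) by (rule null_sets_completionI)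
  qed
  then have "(LINT x:A|lebesgue. f x) = (LINT x:S|lebesgue. f x)"
    using A S(4) by (intro set_integral_null_delta f) simp_all
  then show ?thesis using b S(4) by simp
qed

lemma sigma_finite_lebesgue: "sigma_finite_measure (lebesgue :: 'a::euclidean_space measure)"
proof
  obtain A :: "'a set set" where "countable A" "A \<subseteq> sets lborel" "\<Union>A = space lborel" "\<forall>a\<in>A. emeasure lborel a \<noteq> \<infinity>"
    using lborel.sigma_finite_countable by auto
  then show "\<exists>A::'a set set. countable A \<and> A \<subseteq> sets lebesgue \<and> \<Union> A = space lebesgue \<and> (\<forall>a\<in>A. emeasure lebesgue a \<noteq> \<infinity>)"
    by (intro exI[of _ A]) auto
qed

text \<open>
  Bumps approximating the indicator of a box show that \<open>g\<close> has integral \<open>0\<close> over every box inside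
  \<open>\<Omega>\<close>, hence vanishes almost everywhere on each box whose closure lies in \<open>\<Omega>\<close>. Countably many such
  boxes cover \<open>\<Omega>\<close>.
\<close>

lemma du_Bois_Reymond:
  fixes g :: "real^'n \<Rightarrow> 'b::{banach,second_countable_topology}"
  assumes "open \<Omega>" and g: "locally_integrable \<Omega> g"
    and z: "\<And>\<eta>. \<eta> \<in> test_functions \<Omega> \<Longrightarrow> (\<integral>x. \<eta> x *\<^sub>R g x \<partial>lebesgue_on \<Omega>) = 0"
  shows "AE x in lebesgue_on \<Omega>. g x = 0"
proof -
  have Om: "\<Omega> \<in> sets lebesgue" using assms(1) by simp
  have box0: "(\<integral>x. indicat_real (box a b) x *\<^sub>R g x \<partial>lebesgue) = 0" if ab: "cbox a b \<subseteq> \<Omega>" for a b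
  proof -
    have i: "integrable lebesgue (\<lambda>x. indicat_real (cbox a b) x *\<^sub>R g x)"
      using g ab by (auto simp: locally_integrable_def set_integrable_def)
    have "(\<lambda>n. \<integral>x. box_bump a b n x *\<^sub>R (indicat_real (cbox a b) x *\<^sub>R g x) \<partial>lebesgue) \<longlonglongrightarrow> (\<integral>x. indicat_real (box a b) x *\<^sub>R (indicat_real (cbox a b) x *\<^sub>R g x) \<partial>lebesgue)"
    proof (rule integral_dominated_convergence[where w="\<lambda>x. norm (indicat_real (cbox a b) x *\<^sub>R g x)"])
      show "integrable lebesgue (\<lambda>x. norm (indicat_real (cbox a b) x *\<^sub>R g x))"
        using i by (rule integrable_norm)
      show "(\<lambda>x. indicat_real (box a b) x *\<^sub>R (indicat_real (cbox a b) x *\<^sub>R g x)) \<in> borel_measurable lebesgue"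
        by (rule borel_measurable_scaleR[OF borel_measurable_indicator borel_measurable_integrable[OF i]]) simp
      have "box_bump a b n \<in> borel_measurable lebesgue" for n
        using continuous_borel_measurable_lebesgue_on[OF continuous_on_test_function[OF box_bump_test_function[OF ab]], of n UNIV]
        by (simp add: lebesgue_on_UNIV_eq)
      then show "(\<lambda>x. box_bump a b n x *\<^sub>R (indicat_real (cbox a b) x *\<^sub>R g x)) \<in> borel_measurable lebesgue" for n
        by (rule borel_measurable_scaleR[OF _ borel_measurable_integrable[OF i]])
      show "AE x in lebesgue. (\<lambda>n. box_bump a b n x *\<^sub>R (indicat_real (cbox a b) x *\<^sub>R g x)) \<longlonglongrightarrow> indicat_real (box a b) x *\<^sub>R (indicat_real (cbox a b) x *\<^sub>R g x)"
        by (intro AE_I2 tendsto_scaleR box_bump_tendsto tendsto_const)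
      show "AE x in lebesgue. norm (box_bump a b n x *\<^sub>R (indicat_real (cbox a b) x *\<^sub>R g x)) \<le> norm (indicat_real (cbox a b) x *\<^sub>R g x)" for n
      proof (rule AE_I2)
        fix x
        have "\<bar>box_bump a b n x\<bar> * norm (indicat_real (cbox a b) x *\<^sub>R g x) \<le> 1 * norm (indicat_real (cbox a b) x *\<^sub>R g x)"
          using box_bump_bounds[of a b n x] by (intro mult_right_mono) auto
        then show "norm (box_bump a b n x *\<^sub>R (indicat_real (cbox a b) x *\<^sub>R g x)) \<le> norm (indicat_real (cbox a b) x *\<^sub>R g x)"
          unfolding norm_scaleR[of "box_bump a b n x"] by (simp only: mult_1)
      qed
    qed
    moreover have "(\<integral>x. box_bump a b n x *\<^sub>R (indicat_real (cbox a b) x *\<^sub>R g x) \<partial>lebesgue) = 0" for n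
    proof -
      have "box_bump a b n x = 0" if "x \<notin> cbox a b" for x
        using box_bump_zero_outside[OF that] .
      then have "(\<integral>x. box_bump a b n x *\<^sub>R (indicat_real (cbox a b) x *\<^sub>R g x) \<partial>lebesgue) = (\<integral>x. indicat_real \<Omega> x *\<^sub>R (box_bump a b n x *\<^sub>R g x) \<partial>lebesgue)"
        using subsetD[OF ab] by (intro Bochner_Integration.integral_cong refl) (auto simp: indicator_def simp del: mem_box_cart)
      also have "\<dots> = (\<integral>x. box_bump a b n x *\<^sub>R g x \<partial>lebesgue_on \<Omega>)"
        using Om by (simp add: integral_restrict_space)
      also have "\<dots> = 0" by (rule z[OF box_bump_test_function[OF ab]])
      finally show ?thesis .
    qed
    moreover have "(\<lambda>x. indicat_real (box a b) x *\<^sub>R (indicat_real (cbox a b) x *\<^sub>R g x)) = (\<lambda>x. indicat_real (box a b) x *\<^sub>R g x)"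
      using box_subset_cbox[of a b] by (auto simp: indicator_def fun_eq_iff)
    ultimately show ?thesis by (simp add: LIMSEQ_const_iff)
  qed
  have AEbox: "AE x in lebesgue. x \<in> box a b \<longrightarrow> g x = 0" if ab: "cbox a b \<subseteq> \<Omega>" for a b
  proof -
    define f where "f x = indicat_real (box a b) x *\<^sub>R g x" for x
    have i: "integrable lebesgue (\<lambda>x. indicat_real (cbox a b) x *\<^sub>R g x)"
      using g ab by (auto simp: locally_integrable_def set_integrable_def)
    have "f = (\<lambda>x. indicat_real (box a b) x *\<^sub>R (indicat_real (cbox a b) x *\<^sub>R g x))"
      using box_subset_cbox[of a b] by (auto simp: indicator_def fun_eq_iff f_def)
    then have fi: "integrable lebesgue f"
      using integrable_mult_indicator[OF _ i, of "box a b"] by simp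
    have box: "(LINT x:box c d|lebesgue. f x) = 0" for c d
    proof -
      obtain a' b' where e: "box a b \<inter> box c d = box a' b'" and s: "cbox a' b' \<subseteq> cbox a b"
        using box_Int_box[of a b c d] Int_interval[of a b c d] by blast
      have "(LINT x:box c d|lebesgue. f x) = (\<integral>x. indicat_real (box a' b') x *\<^sub>R g x \<partial>lebesgue)"
        unfolding set_lebesgue_integral_def f_def e[symmetric]
        by (intro Bochner_Integration.integral_cong) (auto simp: indicator_def)
      also have "\<dots> = 0" using box0 s ab by blast
      finally show ?thesis .
    qed
    have f0: "integral\<^sup>L lebesgue f = 0" using box0[OF ab] by (simp add: f_def[abs_def])
    have "AE x in lebesgue. f x = 0"
      using sigma_finite_measure.density_zero[OF sigma_finite_lebesgue fi] integral_eq_0_on_sets_if_on_boxes[OF fi f0 box] by blast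
    then show ?thesis by eventually_elim (auto simp: f_def)
  qed
  define F where "F = {box a b |a b. cbox a b \<subseteq> \<Omega>}"
  obtain F' where F': "F' \<subseteq> F" "countable F'" "\<Union>F' = \<Union>F"
    using Lindelof[of F] by (auto simp: F_def open_box)
  have "AE x in lebesgue. \<forall>X\<in>F'. x \<in> X \<longrightarrow> g x = 0"
    unfolding AE_ball_countable[OF F'(2)]
  proof
    fix X assume "X \<in> F'"
    then obtain a b where "X = box a b" "cbox a b \<subseteq> \<Omega>" using F'(1) unfolding F_def by blast
    then show "AE x in lebesgue. x \<in> X \<longrightarrow> g x = 0" using AEbox by simp
  qed
  then have "AE x in lebesgue. x \<in> \<Omega> \<longrightarrow> g x = 0"
  proof eventually_elim
    fix x assume X: "\<forall>X\<in>F'. x \<in> X \<longrightarrow> g x = 0"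
    show "x \<in> \<Omega> \<longrightarrow> g x = 0"
    proof
      assume "x \<in> \<Omega>"
      then obtain a b where "x \<in> box a b" "cbox a b \<subseteq> \<Omega>"
        using open_contains_cbox[OF assms(1)] by metis
      then have "box a b \<in> F" unfolding F_def by blast
      with \<open>x \<in> box a b\<close> have "x \<in> \<Union>F" by (rule UnionI[rotated])
      then obtain Y where "Y \<in> F'" "x \<in> Y" unfolding F'(3)[symmetric] by (rule UnionE)
      with X show "g x = 0" by blast
    qed
  qed
  then show ?thesis using Om by (simp add: AE_restrict_space_iff)
qed

text \<open>
  Stated for two functions that agree almost everywhere, since two formulas for one Sobolev function
  may differ on a null set. Comparing their gradients is how gradients are shown to vanish on level
  sets.
\<close>

lemma weak_gradient_unique:
  assumes "open \<Omega>" "is_weak_gradient \<Omega> w g" "is_weak_gradient \<Omega> w' g'" "AE x in lebesgue_on \<Omega>. w x = w' x"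
  shows "AE x in lebesgue_on \<Omega>. g x = g' x"
proof -
  have Om: "\<Omega> \<in> sets lebesgue" using assms(1) by simp
  have l: "locally_integrable \<Omega> w" "locally_integrable \<Omega> w'" "locally_integrable \<Omega> g" "locally_integrable \<Omega> g'"
    using assms by (auto simp: is_weak_gradient_def)
  have "AE x in lebesgue_on \<Omega>. g x - g' x = 0"
  proof (rule du_Bois_Reymond[OF assms(1)])
    show "locally_integrable \<Omega> (\<lambda>x. g x - g' x)"
      using l unfolding locally_integrable_def by (auto intro: set_integral_diff)
    fix \<eta> assume \<eta>: "\<eta> \<in> test_functions \<Omega>"
    have "(\<integral>x. \<eta> x *\<^sub>R (g x - g' x) \<partial>lebesgue_on \<Omega>) = (\<integral>x. \<eta> x *\<^sub>R g x \<partial>lebesgue_on \<Omega>) - (\<integral>x. \<eta> x *\<^sub>R g' x \<partial>lebesgue_on \<Omega>)"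
      unfolding scaleR_diff_right by (intro Bochner_Integration.integral_diff integrable_test_function_mult Om l \<eta>)
    also have "\<dots> = (\<integral>x. w' x *\<^sub>R grad \<eta> x \<partial>lebesgue_on \<Omega>) - (\<integral>x. w x *\<^sub>R grad \<eta> x \<partial>lebesgue_on \<Omega>)"
      using assms(2,3) \<eta> by (simp add: is_weak_gradient_def)
    also have "(\<integral>x. w' x *\<^sub>R grad \<eta> x \<partial>lebesgue_on \<Omega>) = (\<integral>x. w x *\<^sub>R grad \<eta> x \<partial>lebesgue_on \<Omega>)"
      using assms(4) by (intro integral_cong_AE borel_measurable_integrable integrable_mult_grad Om l \<eta>) auto
    finally show "(\<integral>x. \<eta> x *\<^sub>R (g x - g' x) \<partial>lebesgue_on \<Omega>) = 0" by simp
  qed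
  then show ?thesis by simp
qed

section \<open>Functions in the closure of the test functions\<close>

text \<open>
  Completeness of the Lebesgue measure makes \<^const>\<open>wgrad\<close> measurable, although it is determined
  only up to null sets.
\<close>

lemma borel_measurable_lebesgue_on_AE:
  fixes f :: "'a::euclidean_space \<Rightarrow> 'b::euclidean_space"
  assumes "\<Omega> \<in> sets lebesgue" "g \<in> borel_measurable (lebesgue_on \<Omega>)" "AE x in lebesgue_on \<Omega>. f x = g x"
  shows "f \<in> borel_measurable (lebesgue_on \<Omega>)"
proof -
  have "AE x in lebesgue. x \<in> \<Omega> \<longrightarrow> f x = g x"
    using assms(1,3) by (simp add: AE_restrict_space_iff)
  then have "AE x in lebesgue. indicat_real \<Omega> x *\<^sub>R g x = indicat_real \<Omega> x *\<^sub>R f x"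
    by eventually_elim (auto simp: indicator_def)
  moreover have "(\<lambda>x. indicat_real \<Omega> x *\<^sub>R g x) \<in> borel_measurable lebesgue"
    using assms(1,2) by (simp add: borel_measurable_restrict_space_iff)
  ultimately have "(\<lambda>x. indicat_real \<Omega> x *\<^sub>R f x) \<in> borel_measurable lebesgue"
    by (rule borel_measurable_AE[rotated])
  then show ?thesis
    using assms(1) by (simp add: borel_measurable_restrict_space_iff)
qed

lemma sq_dist_tendsto_0I:
  assumes "\<And>n. sq_dist \<Omega> (f n) (g n) \<le> a n" "a \<longlonglongrightarrow> 0"
  shows "(\<lambda>n. sq_dist \<Omega> (f n) (g n)) \<longlonglongrightarrow> 0"
  by (rule tendsto_sandwich[OF _ _ tendsto_const assms(2)])
     (auto intro: always_eventually simp: sq_dist_nonneg assms(1))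

text \<open>
  Membership in \<open>H\<^sub>0\<^sup>1(\<Omega>)\<close> together with an explicit choice \<open>g\<close> of the gradient. The choice made by
  \<^const>\<open>wgrad\<close> is arbitrary, so calculation rules are stated for this relation and carried over to
  \<^const>\<open>H01\<close> and \<^const>\<open>wgrad\<close> by uniqueness.
\<close>

definition H01_grad :: "(real^'n) set \<Rightarrow> (real^'n \<Rightarrow> real) \<Rightarrow> (real^'n \<Rightarrow> real^'n) \<Rightarrow> bool"
  where "H01_grad \<Omega> w g \<longleftrightarrow> w \<in> Lp \<Omega> 2 \<and> g \<in> Lp \<Omega> 2 \<and>
    (\<exists>\<phi>. (\<forall>n. \<phi> n \<in> test_functions \<Omega>) \<and> (\<lambda>n. sq_dist \<Omega> (\<phi> n) w) \<longlonglongrightarrow> 0 \<and> (\<lambda>n. sq_dist \<Omega> (\<lambda>x. grad (\<phi> n) x) g) \<longlonglongrightarrow> 0)"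

lemma H01_gradE:
  assumes "H01_grad \<Omega> w g"
  obtains \<phi> :: "nat \<Rightarrow> real^'n \<Rightarrow> real" where "w \<in> Lp \<Omega> 2" "g \<in> Lp \<Omega> 2" "\<And>n. \<phi> n \<in> test_functions \<Omega>"
    "(\<lambda>n. sq_dist \<Omega> (\<phi> n) w) \<longlonglongrightarrow> 0" "(\<lambda>n. sq_dist \<Omega> (grad (\<phi> n)) g) \<longlonglongrightarrow> 0"
  using assms unfolding H01_grad_def by metis

lemma is_weak_gradient_limit:
  assumes Om: "\<Omega> \<in> sets lebesgue" and w: "w \<in> Lp \<Omega> 2" and g: "g \<in> Lp \<Omega> 2"
    and wn: "\<And>n. W n \<in> Lp \<Omega> 2" and gn: "\<And>n. G n \<in> Lp \<Omega> 2" and wk: "\<And>n. is_weak_gradient \<Omega> (W n) (G n)"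
    and wlim: "(\<lambda>n. sq_dist \<Omega> (W n) w) \<longlonglongrightarrow> 0" and glim: "(\<lambda>n. sq_dist \<Omega> (G n) g) \<longlonglongrightarrow> 0"
  shows "is_weak_gradient \<Omega> w g"
  unfolding is_weak_gradient_def
proof (intro conjI ballI)
  show l: "locally_integrable \<Omega> w" "locally_integrable \<Omega> g"
    using Om w g by (auto intro: Lp_2_imp_locally_integrable)
  have ln: "locally_integrable \<Omega> (W n)" "locally_integrable \<Omega> (G n)" for n
    using Om wn gn by (auto intro: Lp_2_imp_locally_integrable)
  fix \<eta> assume \<eta>: "\<eta> \<in> test_functions \<Omega>"
  note \<eta>2 = test_function_Lp_2[OF Om \<eta>]
  have "(\<lambda>n. \<integral>x. W n x *\<^sub>R grad \<eta> x \<partial>lebesgue_on \<Omega>) \<longlonglongrightarrow> (\<integral>x. w x *\<^sub>R grad \<eta> x \<partial>lebesgue_on \<Omega>)"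
  proof (rule Lim_null_comparison[THEN LIM_zero_cancel, OF always_eventually, OF allI])
    show "(\<lambda>n. \<integral>x. norm (W n x - w x) * norm (grad \<eta> x) \<partial>lebesgue_on \<Omega>) \<longlonglongrightarrow> 0"
      by (rule Lp_2_product_tendsto_0[OF wn w \<eta>2(2) wlim])
    fix n
    have "(\<integral>x. W n x *\<^sub>R grad \<eta> x \<partial>lebesgue_on \<Omega>) - (\<integral>x. w x *\<^sub>R grad \<eta> x \<partial>lebesgue_on \<Omega>)
      = (\<integral>x. (W n x - w x) *\<^sub>R grad \<eta> x \<partial>lebesgue_on \<Omega>)"
      unfolding scaleR_diff_left
      by (intro Bochner_Integration.integral_diff[symmetric] integrable_mult_grad Om l ln \<eta>)
    also have "norm \<dots> \<le> (\<integral>x. norm ((W n x - w x) *\<^sub>R grad \<eta> x) \<partial>lebesgue_on \<Omega>)"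
      by (rule integral_norm_bound)
    finally show "norm ((\<integral>x. W n x *\<^sub>R grad \<eta> x \<partial>lebesgue_on \<Omega>) - (\<integral>x. w x *\<^sub>R grad \<eta> x \<partial>lebesgue_on \<Omega>))
       \<le> (\<integral>x. norm (W n x - w x) * norm (grad \<eta> x) \<partial>lebesgue_on \<Omega>)" by simp
  qed
  moreover have "(\<lambda>n. - (\<integral>x. \<eta> x *\<^sub>R G n x \<partial>lebesgue_on \<Omega>)) \<longlonglongrightarrow> - (\<integral>x. \<eta> x *\<^sub>R g x \<partial>lebesgue_on \<Omega>)"
  proof (rule tendsto_minus[OF Lim_null_comparison[THEN LIM_zero_cancel, OF always_eventually, OF allI]])
    show "(\<lambda>n. \<integral>x. norm (G n x - g x) * norm (\<eta> x) \<partial>lebesgue_on \<Omega>) \<longlonglongrightarrow> 0"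
      by (rule Lp_2_product_tendsto_0[OF gn g \<eta>2(1) glim])
    fix n
    have "(\<integral>x. \<eta> x *\<^sub>R G n x \<partial>lebesgue_on \<Omega>) - (\<integral>x. \<eta> x *\<^sub>R g x \<partial>lebesgue_on \<Omega>)
      = (\<integral>x. \<eta> x *\<^sub>R (G n x - g x) \<partial>lebesgue_on \<Omega>)"
      unfolding scaleR_diff_right
      by (intro Bochner_Integration.integral_diff[symmetric] integrable_test_function_mult Om l ln \<eta>)
    also have "norm \<dots> \<le> (\<integral>x. norm (\<eta> x *\<^sub>R (G n x - g x)) \<partial>lebesgue_on \<Omega>)"
      by (rule integral_norm_bound)
    finally show "norm ((\<integral>x. \<eta> x *\<^sub>R G n x \<partial>lebesgue_on \<Omega>) - (\<integral>x. \<eta> x *\<^sub>R g x \<partial>lebesgue_on \<Omega>))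
       \<le> (\<integral>x. norm (G n x - g x) * norm (\<eta> x) \<partial>lebesgue_on \<Omega>)" by (simp add: mult.commute)
  qed
  moreover have "(\<integral>x. W n x *\<^sub>R grad \<eta> x \<partial>lebesgue_on \<Omega>) = - (\<integral>x. \<eta> x *\<^sub>R G n x \<partial>lebesgue_on \<Omega>)" for n
    using wk \<eta> by (simp add: is_weak_gradient_def)
  ultimately show "(\<integral>x. w x *\<^sub>R grad \<eta> x \<partial>lebesgue_on \<Omega>) = - (\<integral>x. \<eta> x *\<^sub>R g x \<partial>lebesgue_on \<Omega>)"
    using LIMSEQ_unique by simp
qed

lemma H01_grad_imp_weak_gradient:
  assumes "\<Omega> \<in> sets lebesgue" "H01_grad \<Omega> w g"
  shows "is_weak_gradient \<Omega> w g"
proof -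
  obtain \<phi> where \<phi>: "w \<in> Lp \<Omega> 2" "g \<in> Lp \<Omega> 2" "\<And>n. \<phi> n \<in> test_functions \<Omega>"
    "(\<lambda>n. sq_dist \<Omega> (\<phi> n) w) \<longlonglongrightarrow> 0" "(\<lambda>n. sq_dist \<Omega> (grad (\<phi> n)) g) \<longlonglongrightarrow> 0"
    using H01_gradE[OF assms(2)] by blast
  show ?thesis
    by (rule is_weak_gradient_limit[OF assms(1) \<phi>(1,2) test_function_Lp_2[OF assms(1) \<phi>(3)] test_function_weak_gradient[OF assms(1) \<phi>(3)] \<phi>(4,5)])
qed

lemma is_weak_gradient_wgrad: "is_weak_gradient \<Omega> w g \<Longrightarrow> is_weak_gradient \<Omega> w (wgrad \<Omega> w)"
  unfolding wgrad_def by (rule someI[where P="is_weak_gradient \<Omega> w"])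

lemma wgrad_AE:
  assumes "open \<Omega>" "is_weak_gradient \<Omega> w g"
  shows "AE x in lebesgue_on \<Omega>. wgrad \<Omega> w x = g x"
  using assms by (intro weak_gradient_unique[OF assms(1) is_weak_gradient_wgrad]) auto

lemma Lp_2_cong_AE:
  fixes f g :: "real^'n \<Rightarrow> 'b::euclidean_space"
  assumes "\<Omega> \<in> sets lebesgue" "g \<in> Lp \<Omega> 2" "AE x in lebesgue_on \<Omega>. f x = g x"
  shows "f \<in> Lp \<Omega> 2"
proof (rule Lp_2_bound[where C=1])
  show "f \<in> borel_measurable (lebesgue_on \<Omega>)"
    using assms by (intro borel_measurable_lebesgue_on_AE[of \<Omega> g f]) (auto simp: Lp_2_iff)
  show "AE x in lebesgue_on \<Omega>. norm (f x) \<le> 1 * norm (g x)" using assms(3) by eventually_elim simp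
qed fact

lemma sq_dist_cong_AE:
  assumes "f \<in> Lp \<Omega> 2" "g \<in> Lp \<Omega> 2" "g' \<in> Lp \<Omega> 2" "AE x in lebesgue_on \<Omega>. g x = g' x"
  shows "sq_dist \<Omega> f g = sq_dist \<Omega> f g'"
  unfolding sq_dist_def
proof (rule integral_cong_AE)
  show "AE x in lebesgue_on \<Omega>. (norm (f x - g x))\<^sup>2 = (norm (f x - g' x))\<^sup>2"
    using assms(4) by eventually_elim simp
qed (use integrable_sq_dist assms in \<open>auto dest!: borel_measurable_integrable\<close>)

lemma H01_imp_H01_grad:
  assumes "open \<Omega>" "w \<in> H01 \<Omega>"
  shows "H01_grad \<Omega> w (wgrad \<Omega> w)"
proof -
  have Om: "\<Omega> \<in> sets lebesgue" using assms(1) by simp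
  obtain g where g: "w \<in> Lp \<Omega> 2" "g \<in> Lp \<Omega> 2" "is_weak_gradient \<Omega> w g"
    using assms(2) by (auto simp: H01_def H1_def)
  have "wgrad \<Omega> w \<in> Lp \<Omega> 2"
    by (rule Lp_2_cong_AE[OF Om g(2) wgrad_AE[OF assms(1) g(3)]])
  then show ?thesis
    using g assms(2) unfolding H01_def H01_grad_def by (auto simp: Lp_norm_tendsto_0_iff)
qed

lemma H01_grad_imp_H01:
  assumes "open \<Omega>" "H01_grad \<Omega> w g"
  shows "w \<in> H01 \<Omega>" "AE x in lebesgue_on \<Omega>. wgrad \<Omega> w x = g x"
proof -
  have Om: "\<Omega> \<in> sets lebesgue" using assms(1) by simp
  note wk = H01_grad_imp_weak_gradient[OF Om assms(2)]
  show AE: "AE x in lebesgue_on \<Omega>. wgrad \<Omega> w x = g x"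
    by (rule wgrad_AE[OF assms(1) wk])
  obtain \<phi> where \<phi>: "w \<in> Lp \<Omega> 2" "g \<in> Lp \<Omega> 2" "\<And>n. \<phi> n \<in> test_functions \<Omega>"
    "(\<lambda>n. sq_dist \<Omega> (\<phi> n) w) \<longlonglongrightarrow> 0" "(\<lambda>n. sq_dist \<Omega> (grad (\<phi> n)) g) \<longlonglongrightarrow> 0"
    using H01_gradE[OF assms(2)] by blast
  have wg: "wgrad \<Omega> w \<in> Lp \<Omega> 2" by (rule Lp_2_cong_AE[OF Om \<phi>(2) AE])
  have "sq_dist \<Omega> (grad (\<phi> n)) (wgrad \<Omega> w) = sq_dist \<Omega> (grad (\<phi> n)) g" for n
    by (rule sq_dist_cong_AE[OF test_function_Lp_2(2)[OF Om \<phi>(3)] wg \<phi>(2) AE])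
  then have "(\<lambda>n. sq_dist \<Omega> (grad (\<phi> n)) (wgrad \<Omega> w)) \<longlonglongrightarrow> 0" using \<phi>(5) by simp
  then show "w \<in> H01 \<Omega>"
    unfolding H01_def H1_def Lp_norm_tendsto_0_iff using \<phi> wk by blast
qed

text \<open>
  Diagonal sequence: the \<open>n\<close>-th function is approximated by a test function up to \<open>1/(n+1)\<close>.
\<close>

lemma H01_grad_limit:
  assumes Om: "\<Omega> \<in> sets lebesgue" and w: "w \<in> Lp \<Omega> 2" and g: "g \<in> Lp \<Omega> 2"
    and W: "\<And>n. H01_grad \<Omega> (W n) (G n)"
    and wlim: "(\<lambda>n. sq_dist \<Omega> (W n) w) \<longlonglongrightarrow> 0" and glim: "(\<lambda>n. sq_dist \<Omega> (G n) g) \<longlonglongrightarrow> 0"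
  shows "H01_grad \<Omega> w g"
proof -
  have "\<exists>\<eta>. \<eta> \<in> test_functions \<Omega> \<and> sq_dist \<Omega> \<eta> (W n) < inverse (real (Suc n)) \<and> sq_dist \<Omega> (grad \<eta>) (G n) < inverse (real (Suc n))" for n
  proof -
    obtain \<phi> where \<phi>: "W n \<in> Lp \<Omega> 2" "G n \<in> Lp \<Omega> 2" "\<And>m. \<phi> m \<in> test_functions \<Omega>"
      "(\<lambda>m. sq_dist \<Omega> (\<phi> m) (W n)) \<longlonglongrightarrow> 0" "(\<lambda>m. sq_dist \<Omega> (grad (\<phi> m)) (G n)) \<longlonglongrightarrow> 0"
      using H01_gradE[OF W[of n]] by blast
    have "\<forall>\<^sub>F m in sequentially. sq_dist \<Omega> (\<phi> m) (W n) < inverse (real (Suc n)) \<and> sq_dist \<Omega> (grad (\<phi> m)) (G n) < inverse (real (Suc n))"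
      using order_tendstoD(2)[OF \<phi>(4), of "inverse (real (Suc n))"] order_tendstoD(2)[OF \<phi>(5), of "inverse (real (Suc n))"]
      by (simp add: eventually_conj)
    then obtain m where "sq_dist \<Omega> (\<phi> m) (W n) < inverse (real (Suc n)) \<and> sq_dist \<Omega> (grad (\<phi> m)) (G n) < inverse (real (Suc n))"
      by (auto simp: eventually_sequentially)
    with \<phi>(3) show ?thesis by blast
  qed
  then obtain \<eta> where \<eta>: "\<And>n. \<eta> n \<in> test_functions \<Omega>" "\<And>n. sq_dist \<Omega> (\<eta> n) (W n) < inverse (real (Suc n))"
    "\<And>n. sq_dist \<Omega> (grad (\<eta> n)) (G n) < inverse (real (Suc n))" by metis
  have WG: "W n \<in> Lp \<Omega> 2" "G n \<in> Lp \<Omega> 2" for n using W by (auto simp: H01_grad_def)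
  have "(\<lambda>n. 2 * inverse (real (Suc n)) + 2 * sq_dist \<Omega> (W n) w) \<longlonglongrightarrow> 2 * 0 + 2 * 0"
    by (intro tendsto_intros LIMSEQ_inverse_real_of_nat wlim)
  then have "(\<lambda>n. 2 * inverse (real (Suc n)) + 2 * sq_dist \<Omega> (W n) w) \<longlonglongrightarrow> 0" by simp
  then have "(\<lambda>n. sq_dist \<Omega> (\<eta> n) w) \<longlonglongrightarrow> 0"
  proof (rule sq_dist_tendsto_0I[rotated])
    fix n show "sq_dist \<Omega> (\<eta> n) w \<le> 2 * inverse (real (Suc n)) + 2 * sq_dist \<Omega> (W n) w"
      using sq_dist_triangle[OF test_function_Lp_2(1)[OF Om \<eta>(1)[of n]] WG(1)[of n] w] \<eta>(2)[of n] by linarith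
  qed
  moreover have "(\<lambda>n. 2 * inverse (real (Suc n)) + 2 * sq_dist \<Omega> (G n) g) \<longlonglongrightarrow> 2 * 0 + 2 * 0"
    by (intro tendsto_intros LIMSEQ_inverse_real_of_nat glim)
  then have "(\<lambda>n. 2 * inverse (real (Suc n)) + 2 * sq_dist \<Omega> (G n) g) \<longlonglongrightarrow> 0" by simp
  then have "(\<lambda>n. sq_dist \<Omega> (grad (\<eta> n)) g) \<longlonglongrightarrow> 0"
  proof (rule sq_dist_tendsto_0I[rotated])
    fix n show "sq_dist \<Omega> (grad (\<eta> n)) g \<le> 2 * inverse (real (Suc n)) + 2 * sq_dist \<Omega> (G n) g"
      using sq_dist_triangle[OF test_function_Lp_2(2)[OF Om \<eta>(1)[of n]] WG(2)[of n] g] \<eta>(3)[of n] by linarith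
  qed
  ultimately show ?thesis
    unfolding H01_grad_def using w g \<eta>(1) by blast
qed

lemma H01_grad_add:
  fixes \<Omega> :: "(real^'n) set"
  assumes Om: "\<Omega> \<in> sets lebesgue" and "H01_grad \<Omega> v f" "H01_grad \<Omega> w g"
  shows "H01_grad \<Omega> (\<lambda>x. v x + w x) (\<lambda>x. f x + g x)"
proof -
  obtain \<phi> where \<phi>: "v \<in> Lp \<Omega> 2" "f \<in> Lp \<Omega> 2" "\<And>n. \<phi> n \<in> test_functions \<Omega>"
    "(\<lambda>n. sq_dist \<Omega> (\<phi> n) v) \<longlonglongrightarrow> 0" "(\<lambda>n. sq_dist \<Omega> (grad (\<phi> n)) f) \<longlonglongrightarrow> 0"
    using H01_gradE[OF assms(2)] by blast
  obtain \<eta> where \<eta>: "w \<in> Lp \<Omega> 2" "g \<in> Lp \<Omega> 2" "\<And>n. \<eta> n \<in> test_functions \<Omega>"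
    "(\<lambda>n. sq_dist \<Omega> (\<eta> n) w) \<longlonglongrightarrow> 0" "(\<lambda>n. sq_dist \<Omega> (grad (\<eta> n)) g) \<longlonglongrightarrow> 0"
    using H01_gradE[OF assms(3)] by blast
  have sum: "(\<lambda>n. sq_dist \<Omega> (\<lambda>x. F n x + G n x) (\<lambda>x. F0 x + G0 x)) \<longlonglongrightarrow> 0"
    if "\<And>n. F n \<in> Lp \<Omega> 2" "\<And>n. G n \<in> Lp \<Omega> 2" "F0 \<in> Lp \<Omega> 2" "G0 \<in> Lp \<Omega> 2"
      "(\<lambda>n. sq_dist \<Omega> (F n) F0) \<longlonglongrightarrow> 0" "(\<lambda>n. sq_dist \<Omega> (G n) G0) \<longlonglongrightarrow> 0"
    for F G :: "nat \<Rightarrow> real^'n \<Rightarrow> 'c::{banach,second_countable_topology}" and F0 G0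
  proof (rule sq_dist_tendsto_0I)
    fix n
    have "sq_dist \<Omega> (\<lambda>x. F n x + G n x) (\<lambda>x. F0 x + G0 x) \<le> 2 * sq_dist \<Omega> (\<lambda>x. F n x + G n x) (\<lambda>x. F0 x + G n x) + 2 * sq_dist \<Omega> (\<lambda>x. F0 x + G n x) (\<lambda>x. F0 x + G0 x)"
      by (intro sq_dist_triangle Lp_2_add that)
    then show "sq_dist \<Omega> (\<lambda>x. F n x + G n x) (\<lambda>x. F0 x + G0 x) \<le> 2 * sq_dist \<Omega> (F n) F0 + 2 * sq_dist \<Omega> (G n) G0"
      by (simp add: sq_dist_def)
  next
    have "(\<lambda>n. 2 * sq_dist \<Omega> (F n) F0 + 2 * sq_dist \<Omega> (G n) G0) \<longlonglongrightarrow> 2 * 0 + 2 * 0"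
      by (intro tendsto_intros that)
    then show "(\<lambda>n. 2 * sq_dist \<Omega> (F n) F0 + 2 * sq_dist \<Omega> (G n) G0) \<longlonglongrightarrow> 0" by simp
  qed
  have "grad (\<lambda>x. \<phi> n x + \<eta> n x) = (\<lambda>x. grad (\<phi> n) x + grad (\<eta> n) x)" for n
    using grad_add[OF test_functions_differentiable[OF \<phi>(3)] test_functions_differentiable[OF \<eta>(3)]] by (simp add: fun_eq_iff)
  then show ?thesis
    unfolding H01_grad_def
    using \<phi>(1,2) \<eta>(1,2) sum[OF test_function_Lp_2(1)[OF Om \<phi>(3)] test_function_Lp_2(1)[OF Om \<eta>(3)] \<phi>(1) \<eta>(1) \<phi>(4) \<eta>(4)]
      sum[OF test_function_Lp_2(2)[OF Om \<phi>(3)] test_function_Lp_2(2)[OF Om \<eta>(3)] \<phi>(2) \<eta>(2) \<phi>(5) \<eta>(5)]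
    by (intro conjI Lp_2_add exI[of _ "\<lambda>n x. \<phi> n x + \<eta> n x"]) (auto intro: test_functions_add \<phi>(3) \<eta>(3))
qed

lemma H01_grad_scale:
  fixes \<Omega> :: "(real^'n) set"
  assumes "H01_grad \<Omega> w g"
  shows "H01_grad \<Omega> (\<lambda>x. c * w x) (\<lambda>x. c *\<^sub>R g x)"
proof -
  obtain \<phi> where \<phi>: "w \<in> Lp \<Omega> 2" "g \<in> Lp \<Omega> 2" "\<And>n. \<phi> n \<in> test_functions \<Omega>"
    "(\<lambda>n. sq_dist \<Omega> (\<phi> n) w) \<longlonglongrightarrow> 0" "(\<lambda>n. sq_dist \<Omega> (grad (\<phi> n)) g) \<longlonglongrightarrow> 0"
    using H01_gradE[OF assms] by blast
  have s: "sq_dist \<Omega> (\<lambda>x. c *\<^sub>R F x) (\<lambda>x. c *\<^sub>R G x) = c\<^sup>2 * sq_dist \<Omega> F G"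
    for F G :: "real^'n \<Rightarrow> 'c::{banach,second_countable_topology}"
    unfolding sq_dist_def scaleR_diff_right[symmetric] norm_scaleR power_mult_distrib by simp
  have g: "grad (\<lambda>x. c * \<phi> n x) = (\<lambda>x. c *\<^sub>R grad (\<phi> n) x)" for n
  proof
    fix x
    have "((\<lambda>t. c * t) has_real_derivative c) (at (\<phi> n x))" by (auto intro!: derivative_eq_intros)
    from grad_compose[OF test_functions_differentiable[OF \<phi>(3)] this] show "grad (\<lambda>x. c * \<phi> n x) x = c *\<^sub>R grad (\<phi> n) x" .
  qed
  have "(\<lambda>n. sq_dist \<Omega> (\<lambda>x. c * \<phi> n x) (\<lambda>x. c * w x)) \<longlonglongrightarrow> 0"
    using tendsto_mult_right_zero[OF \<phi>(4), of "c\<^sup>2"] s[of "\<phi> _" w] by simp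
  moreover have "(\<lambda>n. sq_dist \<Omega> (grad (\<lambda>x. c * \<phi> n x)) (\<lambda>x. c *\<^sub>R g x)) \<longlonglongrightarrow> 0"
    using tendsto_mult_right_zero[OF \<phi>(5), of "c\<^sup>2"] by (simp add: s g)
  ultimately show ?thesis
    unfolding H01_grad_def
    using Lp_2_scaleR[OF \<phi>(1), of c] Lp_2_scaleR[OF \<phi>(2), of c]
    by (intro conjI exI[of _ "\<lambda>n x. c * \<phi> n x"]) (auto intro: test_functions_const_mult \<phi>(3))
qed

section \<open>Chain rule\<close>

text \<open>
  The compositions of test functions \<open>\<phi>\<^sub>n \<rightarrow> w\<close> with the outer function \<open>S = D 0\<close> are again test
  functions, and \<open>S\<close> is a contraction. For the gradients,
  \<open>S'(\<phi>\<^sub>n) D\<phi>\<^sub>n - S'(w) g = S'(\<phi>\<^sub>n) (D\<phi>\<^sub>n - g) + (S'(\<phi>\<^sub>n) - S'(w)) g\<close>; the last term is treated by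
  dominated convergence after passing to a subsequence that converges almost everywhere.
\<close>

lemma H01_grad_chain:
  fixes D :: "nat \<Rightarrow> real \<Rightarrow> real" and \<Omega> :: "(real^'n) set"
  assumes Om: "\<Omega> \<in> sets lebesgue" and w: "H01_grad \<Omega> w g"
    and D: "\<And>j t. (D j has_real_derivative D (Suc j) t) (at t)" "D 0 0 = 0"
    and bound: "\<And>t. \<bar>D 1 t\<bar> \<le> 1"
  shows "H01_grad \<Omega> (\<lambda>x. D 0 (w x)) (\<lambda>x. D 1 (w x) *\<^sub>R g x)"
proof -
  obtain \<phi>0 where \<phi>0: "w \<in> Lp \<Omega> 2" "g \<in> Lp \<Omega> 2" "\<And>n. \<phi>0 n \<in> test_functions \<Omega>"
    "(\<lambda>n. sq_dist \<Omega> (\<phi>0 n) w) \<longlonglongrightarrow> 0" "(\<lambda>n. sq_dist \<Omega> (grad (\<phi>0 n)) g) \<longlonglongrightarrow> 0"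
    using H01_gradE[OF w] by blast
  obtain r where r: "strict_mono r" "AE x in lebesgue_on \<Omega>. (\<lambda>n. \<phi>0 (r n) x) \<longlonglongrightarrow> w x"
    using Lp_2_imp_AE_subseq[OF test_function_Lp_2(1)[OF Om \<phi>0(3)] \<phi>0(1,4)] by blast
  define \<phi> where "\<phi> n = \<phi>0 (r n)" for n
  have \<phi>: "\<And>n. \<phi> n \<in> test_functions \<Omega>" "(\<lambda>n. sq_dist \<Omega> (\<phi> n) w) \<longlonglongrightarrow> 0" "(\<lambda>n. sq_dist \<Omega> (grad (\<phi> n)) g) \<longlonglongrightarrow> 0"
    "AE x in lebesgue_on \<Omega>. (\<lambda>n. \<phi> n x) \<longlonglongrightarrow> w x"
    using \<phi>0(3) r(2) LIMSEQ_subseq_LIMSEQ[OF \<phi>0(4) r(1)] LIMSEQ_subseq_LIMSEQ[OF \<phi>0(5) r(1)]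
    by (auto simp: \<phi>_def o_def)
  have lip: "\<bar>D 0 s - D 0 t\<bar> \<le> \<bar>s - t\<bar>" for s t
    using field_differentiable_bound[of UNIV "D 0" "D 1" 1 s t] D(1)[of 0] bound by simp
  have [measurable]: "D j \<in> borel_measurable borel" for j
    using D(1) by (intro borel_measurable_continuous_onI) (meson DERIV_isCont continuous_at_imp_continuous_on)
  have [measurable]: "w \<in> borel_measurable (lebesgue_on \<Omega>)" "g \<in> borel_measurable (lebesgue_on \<Omega>)"
    using \<phi>0 by (auto simp: Lp_2_iff)
  have \<phi>2: "\<phi> n \<in> Lp \<Omega> 2" "grad (\<phi> n) \<in> Lp \<Omega> 2" for n
    by (rule test_function_Lp_2[OF Om \<phi>(1)])+
  then have [measurable]: "\<phi> n \<in> borel_measurable (lebesgue_on \<Omega>)" "grad (\<phi> n) \<in> borel_measurable (lebesgue_on \<Omega>)" for n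
    by (auto simp: Lp_2_iff)
  have Dw: "(\<lambda>x. D 0 (w x)) \<in> Lp \<Omega> 2"
    using lip[of _ 0] D(2) by (intro Lp_2_bound[OF _ _ \<phi>0(1), where C=1]) auto
  have mul: "(\<lambda>x. D 1 (f x) *\<^sub>R h x) \<in> Lp \<Omega> 2" if "f \<in> borel_measurable (lebesgue_on \<Omega>)" "h \<in> Lp \<Omega> 2" for f and h :: "real^'n \<Rightarrow> real^'n"
    using bound that by (intro Lp_2_bound[OF _ _ that(2), where C=1]) (auto simp: Lp_2_iff mult_left_le_one_le)
  have "(\<lambda>n. sq_dist \<Omega> (\<lambda>x. D 0 (\<phi> n x)) (\<lambda>x. D 0 (w x))) \<longlonglongrightarrow> 0"
  proof (rule sq_dist_tendsto_0I[OF _ \<phi>(2)])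
    fix n
    have "(\<lambda>x. D 0 (\<phi> n x)) \<in> Lp \<Omega> 2"
      by (rule test_function_Lp_2(1)[OF Om test_functions_compose[of "\<phi> n" \<Omega> D, OF \<phi>(1) D]])
    then show "sq_dist \<Omega> (\<lambda>x. D 0 (\<phi> n x)) (\<lambda>x. D 0 (w x)) \<le> sq_dist \<Omega> (\<phi> n) w"
      unfolding sq_dist_def using Dw \<phi>2(1) \<phi>0(1) power_mono[OF lip abs_ge_zero, of _ _ 2]
      by (intro integral_mono integrable_sq_dist) auto
  qed
  moreover have "(\<lambda>n. sq_dist \<Omega> (\<lambda>x. D 1 (\<phi> n x) *\<^sub>R grad (\<phi> n) x) (\<lambda>x. D 1 (w x) *\<^sub>R g x)) \<longlonglongrightarrow> 0"
  proof -
    have "(\<lambda>n. sq_dist \<Omega> (\<lambda>x. D 1 (\<phi> n x) *\<^sub>R g x) (\<lambda>x. D 1 (w x) *\<^sub>R g x)) \<longlonglongrightarrow> (\<integral>x. 0 \<partial>lebesgue_on \<Omega>)"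
      unfolding sq_dist_def
    proof (rule integral_dominated_convergence[where w="\<lambda>x. 4 * (norm (g x))\<^sup>2"])
      show "integrable (lebesgue_on \<Omega>) (\<lambda>x. 4 * (norm (g x))\<^sup>2)" using \<phi>0(2) by (simp add: Lp_2_iff)
      show "AE x in lebesgue_on \<Omega>. norm ((norm (D 1 (\<phi> n x) *\<^sub>R g x - D 1 (w x) *\<^sub>R g x))\<^sup>2) \<le> 4 * (norm (g x))\<^sup>2" for n
      proof (rule AE_I2)
        fix x
        have "\<bar>D 1 (\<phi> n x) - D 1 (w x)\<bar> \<le> 2" using bound[of "\<phi> n x"] bound[of "w x"] by linarith
        then have "(\<bar>D 1 (\<phi> n x) - D 1 (w x)\<bar> * norm (g x))\<^sup>2 \<le> (2 * norm (g x))\<^sup>2"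
          by (intro power_mono mult_right_mono) auto
        then show "norm ((norm (D 1 (\<phi> n x) *\<^sub>R g x - D 1 (w x) *\<^sub>R g x))\<^sup>2) \<le> 4 * (norm (g x))\<^sup>2"
          unfolding scaleR_diff_left[symmetric] norm_scaleR by (simp add: power_mult_distrib)
      qed
      show "AE x in lebesgue_on \<Omega>. (\<lambda>n. (norm (D 1 (\<phi> n x) *\<^sub>R g x - D 1 (w x) *\<^sub>R g x))\<^sup>2) \<longlonglongrightarrow> 0"
        using \<phi>(4)
      proof eventually_elim
        fix x assume "(\<lambda>n. \<phi> n x) \<longlonglongrightarrow> w x"
        from isCont_tendsto_compose[OF DERIV_isCont[OF D(1)] this, of 1]
        have "(\<lambda>n. (norm (D 1 (\<phi> n x) *\<^sub>R g x - D 1 (w x) *\<^sub>R g x))\<^sup>2) \<longlonglongrightarrow> (norm (D 1 (w x) *\<^sub>R g x - D 1 (w x) *\<^sub>R g x))\<^sup>2"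
          by (intro tendsto_intros) simp
        then show "(\<lambda>n. (norm (D 1 (\<phi> n x) *\<^sub>R g x - D 1 (w x) *\<^sub>R g x))\<^sup>2) \<longlonglongrightarrow> 0" by simp
      qed
    qed measurable
    then have "(\<lambda>n. 2 * sq_dist \<Omega> (grad (\<phi> n)) g + 2 * sq_dist \<Omega> (\<lambda>x. D 1 (\<phi> n x) *\<^sub>R g x) (\<lambda>x. D 1 (w x) *\<^sub>R g x)) \<longlonglongrightarrow> 2 * 0 + 2 * 0"
      by (intro tendsto_intros \<phi>) simp
    then have "(\<lambda>n. 2 * sq_dist \<Omega> (grad (\<phi> n)) g + 2 * sq_dist \<Omega> (\<lambda>x. D 1 (\<phi> n x) *\<^sub>R g x) (\<lambda>x. D 1 (w x) *\<^sub>R g x)) \<longlonglongrightarrow> 0"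
      by simp
    then show ?thesis
    proof (rule sq_dist_tendsto_0I[rotated])
      fix n
      have "sq_dist \<Omega> (\<lambda>x. D 1 (\<phi> n x) *\<^sub>R grad (\<phi> n) x) (\<lambda>x. D 1 (\<phi> n x) *\<^sub>R g x) \<le> sq_dist \<Omega> (grad (\<phi> n)) g"
        unfolding sq_dist_def
      proof (intro integral_mono integrable_sq_dist mul \<phi>2 \<phi>0)
        fix x
        have "(\<bar>D 1 (\<phi> n x)\<bar> * norm (grad (\<phi> n) x - g x))\<^sup>2 \<le> (1 * norm (grad (\<phi> n) x - g x))\<^sup>2"
          using bound by (intro power_mono mult_right_mono) auto
        then show "(norm (D 1 (\<phi> n x) *\<^sub>R grad (\<phi> n) x - D 1 (\<phi> n x) *\<^sub>R g x))\<^sup>2 \<le> (norm (grad (\<phi> n) x - g x))\<^sup>2"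
          unfolding scaleR_diff_right[symmetric] norm_scaleR by simp
      qed simp_all
      moreover have "sq_dist \<Omega> (\<lambda>x. D 1 (\<phi> n x) *\<^sub>R grad (\<phi> n) x) (\<lambda>x. D 1 (w x) *\<^sub>R g x)
        \<le> 2 * sq_dist \<Omega> (\<lambda>x. D 1 (\<phi> n x) *\<^sub>R grad (\<phi> n) x) (\<lambda>x. D 1 (\<phi> n x) *\<^sub>R g x) + 2 * sq_dist \<Omega> (\<lambda>x. D 1 (\<phi> n x) *\<^sub>R g x) (\<lambda>x. D 1 (w x) *\<^sub>R g x)"
        by (intro sq_dist_triangle mul \<phi>2 \<phi>0) simp_all
      ultimately show "sq_dist \<Omega> (\<lambda>x. D 1 (\<phi> n x) *\<^sub>R grad (\<phi> n) x) (\<lambda>x. D 1 (w x) *\<^sub>R g x)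
        \<le> 2 * sq_dist \<Omega> (grad (\<phi> n)) g + 2 * sq_dist \<Omega> (\<lambda>x. D 1 (\<phi> n x) *\<^sub>R g x) (\<lambda>x. D 1 (w x) *\<^sub>R g x)" by linarith
    qed
  qed
  moreover have "grad (\<lambda>x. D 0 (\<phi> n x)) = (\<lambda>x. D 1 (\<phi> n x) *\<^sub>R grad (\<phi> n) x)" for n
  proof
    fix x show "grad (\<lambda>x. D 0 (\<phi> n x)) x = D 1 (\<phi> n x) *\<^sub>R grad (\<phi> n) x"
      using grad_compose[OF test_functions_differentiable[OF \<phi>(1)] D(1)[of 0]] by simp
  qed
  ultimately show ?thesis
    unfolding H01_grad_def using Dw mul[OF _ \<phi>0(2), of w] test_functions_compose[of "\<phi> _" \<Omega> D, OF \<phi>(1) D]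
    by (intro conjI exI[of _ "\<lambda>n x. D 0 (\<phi> n x)"]) auto
qed

text \<open>
  This function of \<open>w\<close> is not smooth, so the ramps are applied to the fixed function \<open>w\<close> and only
  then refined. Refining them along the approximating test functions instead would leave the
  gradient undetermined on the level set \<open>{w = c}\<close>.
\<close>

lemma H01_grad_max:
  assumes Om: "\<Omega> \<in> sets lebesgue" and w: "H01_grad \<Omega> w g"
  shows "H01_grad \<Omega> (\<lambda>x. max (w x) c - max 0 c) (\<lambda>x. indicat_real {c<..} (w x) *\<^sub>R g x)"
proof (rule H01_grad_limit[OF Om])
  define R where "R n = ramp_jet c (real (Suc n))" for n
  have R: "(R n j has_real_derivative R n (Suc j) t) (at t)" "R n 0 0 = 0" "0 \<le> R n 1 t" "R n 1 t \<le> 1" for n j t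
    using ramp_jet_DERIV[of "real (Suc n)" c j t] ramp_jet_1_bounds[of c "real (Suc n)" t]
    unfolding R_def by (simp_all add: ramp_jet_def ramp_zero del: of_nat_Suc)
  have R0: "R n 0 t = ramp c (real (Suc n)) t" for n t by (simp add: R_def ramp_jet_def)
  have lip: "\<bar>R n 0 t\<bar> \<le> \<bar>t\<bar>" for n t
    using field_differentiable_bound[of UNIV "R n 0" "R n 1" 1 t 0] R(1)[of n 0] R(2,3,4) by simp
  have w2 [measurable]: "w \<in> borel_measurable (lebesgue_on \<Omega>)" "g \<in> borel_measurable (lebesgue_on \<Omega>)" and wg: "w \<in> Lp \<Omega> 2" "g \<in> Lp \<Omega> 2"
    using w by (auto simp: H01_grad_def Lp_2_iff)
  show m: "(\<lambda>x. max (w x) c - max 0 c) \<in> Lp \<Omega> 2"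
    by (rule Lp_2_bound[OF _ _ wg(1), where C=1]) auto
  show gm: "(\<lambda>x. indicat_real {c<..} (w x) *\<^sub>R g x) \<in> Lp \<Omega> 2"
    by (rule Lp_2_bound[OF _ _ wg(2), where C=1]) (auto simp: indicator_def)
  show H: "H01_grad \<Omega> (\<lambda>x. R n 0 (w x)) (\<lambda>x. R n 1 (w x) *\<^sub>R g x)" for n
    using R by (intro H01_grad_chain[OF Om w]) auto
  then have L: "(\<lambda>x. R n 0 (w x)) \<in> Lp \<Omega> 2" "(\<lambda>x. R n 1 (w x) *\<^sub>R g x) \<in> Lp \<Omega> 2" for n
    by (auto simp: H01_grad_def)
  have "(\<lambda>n. sq_dist \<Omega> (\<lambda>x. R n 0 (w x)) (\<lambda>x. max (w x) c - max 0 c)) \<longlonglongrightarrow> (\<integral>x. 0 \<partial>lebesgue_on \<Omega>)"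
    unfolding sq_dist_def
  proof (rule integral_dominated_convergence[where w="\<lambda>x. 4 * (norm (w x))\<^sup>2"])
    show "integrable (lebesgue_on \<Omega>) (\<lambda>x. 4 * (norm (w x))\<^sup>2)" using wg by (simp add: Lp_2_iff)
    show "(\<lambda>x. (norm (R n 0 (w x) - (max (w x) c - max 0 c)))\<^sup>2) \<in> borel_measurable (lebesgue_on \<Omega>)" for n
      using borel_measurable_integrable[OF integrable_sq_dist[OF L(1) m]] .
    show "AE x in lebesgue_on \<Omega>. norm ((norm (R n 0 (w x) - (max (w x) c - max 0 c)))\<^sup>2) \<le> 4 * (norm (w x))\<^sup>2" for n
    proof (rule AE_I2)
      fix x
      have "\<bar>R n 0 (w x) - (max (w x) c - max 0 c)\<bar> \<le> 2 * \<bar>w x\<bar>"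
        using lip[of n "w x"] by linarith
      from power_mono[OF this abs_ge_zero, of 2] show "norm ((norm (R n 0 (w x) - (max (w x) c - max 0 c)))\<^sup>2) \<le> 4 * (norm (w x))\<^sup>2"
        by (simp add: power_mult_distrib)
    qed
    show "AE x in lebesgue_on \<Omega>. (\<lambda>n. (norm (R n 0 (w x) - (max (w x) c - max 0 c)))\<^sup>2) \<longlonglongrightarrow> 0"
    proof (rule AE_I2)
      fix x
      have "(\<lambda>n. (norm (R n 0 (w x) - (max (w x) c - max 0 c)))\<^sup>2) \<longlonglongrightarrow> (norm ((max (w x) c - max 0 c) - (max (w x) c - max 0 c)))\<^sup>2"
        unfolding R0 by (intro tendsto_intros ramp_tendsto)
      then show "(\<lambda>n. (norm (R n 0 (w x) - (max (w x) c - max 0 c)))\<^sup>2) \<longlonglongrightarrow> 0" by simp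
    qed
  qed simp
  then show "(\<lambda>n. sq_dist \<Omega> (\<lambda>x. R n 0 (w x)) (\<lambda>x. max (w x) c - max 0 c)) \<longlonglongrightarrow> 0" by simp
  have "(\<lambda>n. sq_dist \<Omega> (\<lambda>x. R n 1 (w x) *\<^sub>R g x) (\<lambda>x. indicat_real {c<..} (w x) *\<^sub>R g x)) \<longlonglongrightarrow> (\<integral>x. 0 \<partial>lebesgue_on \<Omega>)"
    unfolding sq_dist_def
  proof (rule integral_dominated_convergence[where w="\<lambda>x. 4 * (norm (g x))\<^sup>2"])
    show "integrable (lebesgue_on \<Omega>) (\<lambda>x. 4 * (norm (g x))\<^sup>2)" using wg by (simp add: Lp_2_iff)
    show "(\<lambda>x. (norm (R n 1 (w x) *\<^sub>R g x - indicat_real {c<..} (w x) *\<^sub>R g x))\<^sup>2) \<in> borel_measurable (lebesgue_on \<Omega>)" for n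
      using borel_measurable_integrable[OF integrable_sq_dist[OF L(2) gm]] .
    show "AE x in lebesgue_on \<Omega>. norm ((norm (R n 1 (w x) *\<^sub>R g x - indicat_real {c<..} (w x) *\<^sub>R g x))\<^sup>2) \<le> 4 * (norm (g x))\<^sup>2" for n
    proof (rule AE_I2)
      fix x
      have "\<bar>R n 1 (w x) - indicat_real {c<..} (w x)\<bar> \<le> 2"
        using R(3,4)[of n "w x"] by (auto simp: indicator_def)
      then have "(\<bar>R n 1 (w x) - indicat_real {c<..} (w x)\<bar> * norm (g x))\<^sup>2 \<le> (2 * norm (g x))\<^sup>2"
        by (intro power_mono mult_right_mono) auto
      then show "norm ((norm (R n 1 (w x) *\<^sub>R g x - indicat_real {c<..} (w x) *\<^sub>R g x))\<^sup>2) \<le> 4 * (norm (g x))\<^sup>2"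
        unfolding scaleR_diff_left[symmetric] norm_scaleR by (simp add: power_mult_distrib)
    qed
    show "AE x in lebesgue_on \<Omega>. (\<lambda>n. (norm (R n 1 (w x) *\<^sub>R g x - indicat_real {c<..} (w x) *\<^sub>R g x))\<^sup>2) \<longlonglongrightarrow> 0"
    proof (rule AE_I2)
      fix x
      have "(\<lambda>n. (norm (R n 1 (w x) *\<^sub>R g x - indicat_real {c<..} (w x) *\<^sub>R g x))\<^sup>2) \<longlonglongrightarrow> (norm (indicat_real {c<..} (w x) *\<^sub>R g x - indicat_real {c<..} (w x) *\<^sub>R g x))\<^sup>2"
        unfolding R_def by (intro tendsto_intros ramp_jet_1_tendsto)
      then show "(\<lambda>n. (norm (R n 1 (w x) *\<^sub>R g x - indicat_real {c<..} (w x) *\<^sub>R g x))\<^sup>2) \<longlonglongrightarrow> 0" by simp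
    qed
  qed simp
  then show "(\<lambda>n. sq_dist \<Omega> (\<lambda>x. R n 1 (w x) *\<^sub>R g x) (\<lambda>x. indicat_real {c<..} (w x) *\<^sub>R g x)) \<longlonglongrightarrow> 0" by simp
qed

lemma integrable_imp_locally_integrable:
  fixes f :: "real^'n \<Rightarrow> 'b::{banach,second_countable_topology}"
  assumes "\<Omega> \<in> sets lebesgue" "integrable (lebesgue_on \<Omega>) f"
  shows "locally_integrable \<Omega> f"
  unfolding locally_integrable_def
proof (intro allI impI)
  fix K assume K: "compact K \<and> K \<subseteq> \<Omega>"
  have "set_integrable lebesgue \<Omega> f"
    using assms by (simp add: set_integrable_def integrable_restrict_space)
  moreover have "K \<in> sets lebesgue" using K by (simp add: borel_compact)
  ultimately show "set_integrable lebesgue K f" using K by (blast intro: set_integrable_subset)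
qed

section \<open>Products with test functions\<close>

lemma is_weak_gradient_mult_test_function:
  assumes Om: "\<Omega> \<in> sets lebesgue" and w: "is_weak_gradient \<Omega> w g" and \<eta>: "\<eta> \<in> test_functions \<Omega>"
  shows "is_weak_gradient \<Omega> (\<lambda>x. w x * \<eta> x) (\<lambda>x. w x *\<^sub>R grad \<eta> x + \<eta> x *\<^sub>R g x)"
  unfolding is_weak_gradient_def
proof (intro conjI ballI)
  have l: "locally_integrable \<Omega> w" "locally_integrable \<Omega> g" using w by (auto simp: is_weak_gradient_def)
  have i: "integrable (lebesgue_on \<Omega>) (\<lambda>x. \<eta> x *\<^sub>R w x)" "integrable (lebesgue_on \<Omega>) (\<lambda>x. \<eta> x *\<^sub>R g x)"
     "integrable (lebesgue_on \<Omega>) (\<lambda>x. w x *\<^sub>R grad \<eta> x)"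
    by (intro integrable_test_function_mult integrable_mult_grad Om l \<eta>)+
  show l1: "locally_integrable \<Omega> (\<lambda>x. w x * \<eta> x)"
    using integrable_imp_locally_integrable[OF Om i(1)] by (simp add: mult.commute)
  have l3: "locally_integrable \<Omega> (\<lambda>x. w x *\<^sub>R grad \<eta> x)" "locally_integrable \<Omega> (\<lambda>x. \<eta> x *\<^sub>R g x)"
    using integrable_imp_locally_integrable[OF Om] i by auto
  show l2: "locally_integrable \<Omega> (\<lambda>x. w x *\<^sub>R grad \<eta> x + \<eta> x *\<^sub>R g x)"
    by (intro integrable_imp_locally_integrable[OF Om] Bochner_Integration.integrable_add i)
  fix \<zeta> assume \<zeta>: "\<zeta> \<in> test_functions \<Omega>"
  have p: "(\<lambda>x. \<eta> x * \<zeta> x) \<in> test_functions \<Omega>"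
    using \<eta> test_functions_Ck[OF \<zeta>] by (rule test_functions_mult_smooth)
  have i2: "integrable (lebesgue_on \<Omega>) (\<lambda>x. (w x * \<eta> x) *\<^sub>R grad \<zeta> x)"
    "integrable (lebesgue_on \<Omega>) (\<lambda>x. \<zeta> x *\<^sub>R (w x *\<^sub>R grad \<eta> x))"
    "integrable (lebesgue_on \<Omega>) (\<lambda>x. \<zeta> x *\<^sub>R (\<eta> x *\<^sub>R g x))"
    by (intro integrable_test_function_mult integrable_mult_grad Om l1 l3 \<zeta>)+
  have "(\<integral>x. w x *\<^sub>R grad (\<lambda>x. \<eta> x * \<zeta> x) x \<partial>lebesgue_on \<Omega>) = - (\<integral>x. (\<eta> x * \<zeta> x) *\<^sub>R g x \<partial>lebesgue_on \<Omega>)"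
    using w p by (simp add: is_weak_gradient_def)
  also have "(\<lambda>x. w x *\<^sub>R grad (\<lambda>x. \<eta> x * \<zeta> x) x) = (\<lambda>x. (w x * \<eta> x) *\<^sub>R grad \<zeta> x + \<zeta> x *\<^sub>R (w x *\<^sub>R grad \<eta> x))"
    by (simp add: grad_mult[OF test_functions_differentiable[OF \<eta>] test_functions_differentiable[OF \<zeta>]] fun_eq_iff algebra_simps)
  also have "(\<lambda>x. (\<eta> x * \<zeta> x) *\<^sub>R g x) = (\<lambda>x. \<zeta> x *\<^sub>R (\<eta> x *\<^sub>R g x))" by (simp add: mult.commute)
  finally have "(\<integral>x. (w x * \<eta> x) *\<^sub>R grad \<zeta> x \<partial>lebesgue_on \<Omega>) + (\<integral>x. \<zeta> x *\<^sub>R (w x *\<^sub>R grad \<eta> x) \<partial>lebesgue_on \<Omega>) + (\<integral>x. \<zeta> x *\<^sub>R (\<eta> x *\<^sub>R g x) \<partial>lebesgue_on \<Omega>) = 0"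
    unfolding Bochner_Integration.integral_add[OF i2(1,2)] eq_neg_iff_add_eq_0 .
  then show "(\<integral>x. (w x * \<eta> x) *\<^sub>R grad \<zeta> x \<partial>lebesgue_on \<Omega>) = - (\<integral>x. \<zeta> x *\<^sub>R (w x *\<^sub>R grad \<eta> x + \<eta> x *\<^sub>R g x) \<partial>lebesgue_on \<Omega>)"
    unfolding scaleR_add_right[of "\<zeta> _"] Bochner_Integration.integral_add[OF i2(2,3)] eq_neg_iff_add_eq_0
    by (simp only: add.assoc)
qed

section \<open>Truncations and gradients at extreme values\<close>

lemma H01_grad_cong:
  assumes "H01_grad \<Omega> w g" "\<And>x. w x = w' x" "\<And>x. g x = g' x"
  shows "H01_grad \<Omega> w' g'"
proof -
  have "w = w'" "g = g'" using assms by auto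
  with assms(1) show ?thesis by simp
qed

lemma H01_grad_clamp:
  assumes Om: "\<Omega> \<in> sets lebesgue" and w: "H01_grad \<Omega> w g" and m: "0 \<le> m"
  shows "H01_grad \<Omega> (\<lambda>x. max 0 (min (w x) m)) (\<lambda>x. indicat_real {0<..m} (w x) *\<^sub>R g x)"
proof (rule H01_grad_cong)
  show "H01_grad \<Omega> (\<lambda>x. (max (w x) 0 - max 0 0) + (-1) * (max (w x) m - max 0 m))
     (\<lambda>x. indicat_real {0<..} (w x) *\<^sub>R g x + (-1) *\<^sub>R (indicat_real {m<..} (w x) *\<^sub>R g x))"
    by (intro H01_grad_add H01_grad_scale H01_grad_max Om w)
  show "(max (w x) 0 - max 0 0) + (-1) * (max (w x) m - max 0 m) = max 0 (min (w x) m)" for x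
    using m by (auto simp: max_def min_def)
  show "indicat_real {0<..} (w x) *\<^sub>R g x + (-1) *\<^sub>R (indicat_real {m<..} (w x) *\<^sub>R g x) = indicat_real {0<..m} (w x) *\<^sub>R g x" for x
    using m by (auto simp: indicator_def)
qed

text \<open>
  Where \<open>w \<ge> c\<close> almost everywhere, \<open>w\<close> and \<open>max w c\<close> are the same function, yet the gradient of the
  latter vanishes on \<open>{w = c}\<close>. The sign of \<open>c\<close> makes \<open>max 0 c = 0\<close>.
\<close>

lemma gradient_eq_0_at_minimum:
  assumes op: "open \<Omega>" and w: "H01_grad \<Omega> w g" and "c \<le> 0" and nn: "AE x in lebesgue_on \<Omega>. c \<le> w x"
  shows "AE x in lebesgue_on \<Omega>. w x = c \<longrightarrow> g x = 0"
proof -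
  have Om: "\<Omega> \<in> sets lebesgue" using op by simp
  have "AE x in lebesgue_on \<Omega>. w x = max (w x) c - max 0 c"
    using nn by eventually_elim (use \<open>c \<le> 0\<close> in auto)
  from weak_gradient_unique[OF op H01_grad_imp_weak_gradient[OF Om w] H01_grad_imp_weak_gradient[OF Om H01_grad_max[OF Om w]] this]
  show ?thesis by eventually_elim auto
qed

lemma gradient_eq_0_at_maximum:
  assumes "open \<Omega>" "H01_grad \<Omega> w g" "0 \<le> c" "AE x in lebesgue_on \<Omega>. w x \<le> c"
  shows "AE x in lebesgue_on \<Omega>. w x = c \<longrightarrow> g x = 0"
  using gradient_eq_0_at_minimum[OF assms(1) H01_grad_scale[OF assms(2), of "-1"], of "-c"] assms(3,4)
  by simp

section \<open>Conjugate exponents and the sign of the Sobolev constant\<close>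

lemma Lp_infinity_AE_bound:
  assumes "f \<in> Lp \<Omega> \<infinity>"
  shows "AE x in lebesgue_on \<Omega>. norm (f x) \<le> Lp_norm \<Omega> \<infinity> f"
proof -
  let ?e = "esssup (lebesgue_on \<Omega>) (\<lambda>x. ennreal (norm (f x)))"
  have "?e < \<infinity>" using assms by (simp add: Lp_def)
  then have e: "ennreal (Lp_norm \<Omega> \<infinity> f) = ?e" by (simp add: Lp_norm_def)
  have "AE x in lebesgue_on \<Omega>. ennreal (norm (f x)) \<le> ?e" by (rule esssup_AE)
  then show ?thesis unfolding e[symmetric]
    by eventually_elim (simp add: Lp_norm_def ennreal_le_iff)
qed

lemma bounded_imp_Lp_infinity:
  assumes "f \<in> borel_measurable (lebesgue_on \<Omega>)" "\<And>x. norm (f x) \<le> C"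
  shows "f \<in> Lp \<Omega> \<infinity>"
proof -
  have "esssup (lebesgue_on \<Omega>) (\<lambda>x. ennreal (norm (f x))) \<le> ennreal C"
    using assms by (intro esssup_I) (auto intro!: ennreal_leI)
  also have "\<dots> < \<infinity>" by simp
  finally show ?thesis using assms(1) by (simp add: Lp_def)
qed

lemma Lp_norm_nonneg: "0 \<le> Lp_norm \<Omega> p f"
  by (simp add: Lp_norm_def)

lemma Hoelder_Lp:
  fixes f v :: "real^'n \<Rightarrow> real"
  assumes "r = 1 \<or> r > 1" and f: "f \<in> Lp \<Omega> (ennreal r)" and v: "v \<in> Lp \<Omega> (conjugate_exponent r)"
  shows "integrable (lebesgue_on \<Omega>) (\<lambda>x. \<bar>f x\<bar> * \<bar>v x\<bar>)"
    and "(\<integral>x. \<bar>f x\<bar> * \<bar>v x\<bar> \<partial>lebesgue_on \<Omega>) \<le> Lp_norm \<Omega> (ennreal r) f * Lp_norm \<Omega> (conjugate_exponent r) v"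
proof -
  have fm: "f \<in> borel_measurable (lebesgue_on \<Omega>)" and fi: "integrable (lebesgue_on \<Omega>) (\<lambda>x. \<bar>f x\<bar> powr r)"
    using f assms(1) by (auto simp: Lp_def)
  have vm: "v \<in> borel_measurable (lebesgue_on \<Omega>)" using v by (auto simp: Lp_def)
  note [measurable] = fm vm
  have "integrable (lebesgue_on \<Omega>) (\<lambda>x. \<bar>f x\<bar> * \<bar>v x\<bar>) \<and> (\<integral>x. \<bar>f x\<bar> * \<bar>v x\<bar> \<partial>lebesgue_on \<Omega>) \<le> Lp_norm \<Omega> (ennreal r) f * Lp_norm \<Omega> (conjugate_exponent r) v"
    using assms(1)
  proof
    assume r: "r = 1"
    define B where "B = Lp_norm \<Omega> \<infinity> v"
    have fi: "integrable (lebesgue_on \<Omega>) (\<lambda>x. \<bar>f x\<bar>)" using fi r by simp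
    have "v \<in> Lp \<Omega> \<infinity>" using v r by (simp add: conjugate_exponent_def)
    then have B: "AE x in lebesgue_on \<Omega>. \<bar>v x\<bar> \<le> B" using Lp_infinity_AE_bound by (fastforce simp: B_def)
    have le: "AE x in lebesgue_on \<Omega>. \<bar>f x\<bar> * \<bar>v x\<bar> \<le> \<bar>f x\<bar> * B"
      using B by eventually_elim (auto intro: mult_left_mono)
    have i: "integrable (lebesgue_on \<Omega>) (\<lambda>x. \<bar>f x\<bar> * \<bar>v x\<bar>)"
    proof (rule Bochner_Integration.integrable_bound)
      show "integrable (lebesgue_on \<Omega>) (\<lambda>x. \<bar>f x\<bar> * B)" using fi by simp
      show "AE x in lebesgue_on \<Omega>. norm (\<bar>f x\<bar> * \<bar>v x\<bar>) \<le> norm (\<bar>f x\<bar> * B)"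
        using le by eventually_elim (auto simp: abs_mult intro: order_trans[OF _ mult_left_mono[OF abs_ge_self]])
    qed simp
    have "(\<integral>x. \<bar>f x\<bar> * \<bar>v x\<bar> \<partial>lebesgue_on \<Omega>) \<le> (\<integral>x. \<bar>f x\<bar> * B \<partial>lebesgue_on \<Omega>)"
      using fi by (intro integral_mono_AE i le) simp
    also have "\<dots> = Lp_norm \<Omega> (ennreal r) f * Lp_norm \<Omega> (conjugate_exponent r) v"
      using r by (simp add: Lp_norm_def[of _ "1"] conjugate_exponent_def B_def)
    finally show ?thesis using i by blast
  next
    assume r: "r > 1"
    define q where "q = r / (r - 1)"
    have q: "q > 1" "1 / r + 1 / q = 1" using r by (auto simp: q_def field_simps)
    have c: "conjugate_exponent r = ennreal q" using r by (simp add: conjugate_exponent_def q_def)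
    have vi: "integrable (lebesgue_on \<Omega>) (\<lambda>x. \<bar>v x\<bar> powr q)"
      using v q by (simp add: c Lp_def)
    note H = Hoelder_inequality[OF r q, of "\<lambda>x. \<bar>f x\<bar>" "lebesgue_on \<Omega>" "\<lambda>x. \<bar>v x\<bar>"]
    show ?thesis using H fi vi r q by (simp add: c Lp_norm_def)
  qed
  then show "integrable (lebesgue_on \<Omega>) (\<lambda>x. \<bar>f x\<bar> * \<bar>v x\<bar>)"
    and "(\<integral>x. \<bar>f x\<bar> * \<bar>v x\<bar> \<partial>lebesgue_on \<Omega>) \<le> Lp_norm \<Omega> (ennreal r) f * Lp_norm \<Omega> (conjugate_exponent r) v"
    by blast+
qed

lemma Lp_norm_eq_0_imp_AE:
  fixes v :: "real^'n \<Rightarrow> real"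
  assumes "r = 1 \<or> r > 1" "v \<in> Lp \<Omega> (conjugate_exponent r)" "Lp_norm \<Omega> (conjugate_exponent r) v = 0"
  shows "AE x in lebesgue_on \<Omega>. v x = 0"
  using assms(1)
proof
  assume "r = 1"
  then have "AE x in lebesgue_on \<Omega>. norm (v x) \<le> 0"
    using Lp_infinity_AE_bound[of v \<Omega>] assms(2,3) by (simp add: conjugate_exponent_def)
  then show ?thesis by eventually_elim simp
next
  assume r: "r > 1"
  define q where "q = r / (r - 1)"
  have q: "q > 0" using r by (auto simp: q_def field_simps)
  have c: "conjugate_exponent r = ennreal q" using r by (simp add: conjugate_exponent_def q_def)
  have "integrable (lebesgue_on \<Omega>) (\<lambda>x. \<bar>v x\<bar> powr q)" "(\<integral>x. \<bar>v x\<bar> powr q \<partial>lebesgue_on \<Omega>) = 0"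
    using assms(2,3) q by (auto simp: c Lp_def Lp_norm_def)
  from integral_eq_0_imp_AE[OF this(1) _ this(2)] show ?thesis by (simp add: powr_eq_0_iff)
qed

text \<open>
  The definition admits negative constants. These force every test function to vanish almost
  everywhere, and \<open>\<Omega>\<close> is then a null set, because the constant function \<open>1\<close> is orthogonal to all
  test functions.
\<close>

lemma Sobolev_constant_nonneg_or_null:
  fixes \<Omega> :: "(real^'n) set"
  assumes op: "open \<Omega>" and r: "r = 1 \<or> r > 1" and S: "Sobolev_constant \<Omega> (conjugate_exponent r) C"
  shows "C \<ge> 0 \<or> (AE x in lebesgue_on \<Omega>. False)"
proof (rule disjCI)
  assume "\<not> (AE x in lebesgue_on \<Omega>. False)"
  show "C \<ge> 0"
  proof (rule ccontr)
    assume C: "\<not> C \<ge> 0"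
    have Om: "\<Omega> \<in> sets lebesgue" using op by simp
    have "AE x in lebesgue_on \<Omega>. (1::real) = 0"
    proof (rule du_Bois_Reymond[OF op])
      show "locally_integrable \<Omega> (\<lambda>x. 1::real)"
        unfolding locally_integrable_def set_integrable_def
        using lmeasurable_compact by (auto simp: lmeasurable_iff_integrable)
      fix \<eta> assume \<eta>: "\<eta> \<in> test_functions \<Omega>"
      have "H01_grad \<Omega> \<eta> (grad \<eta>)"
        unfolding H01_grad_def using test_function_Lp_2[OF Om \<eta>] \<eta>
        by (auto intro!: exI[of _ "\<lambda>_. \<eta>"] simp: sq_dist_def)
      then have "\<eta> \<in> H01 \<Omega>" using H01_grad_imp_H01(1)[OF op] by blast
      then have "\<eta> \<in> Lp \<Omega> (conjugate_exponent r)" "Lp_norm \<Omega> (conjugate_exponent r) \<eta> \<le> C * Lp_norm \<Omega> 2 (wgrad \<Omega> \<eta>)"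
        using S by (auto simp: Sobolev_constant_def)
      moreover have "C * Lp_norm \<Omega> 2 (wgrad \<Omega> \<eta>) \<le> 0" using C by (intro mult_nonpos_nonneg Lp_norm_nonneg) simp
      ultimately have "AE x in lebesgue_on \<Omega>. \<eta> x = 0"
        using Lp_norm_nonneg[of \<Omega> "conjugate_exponent r" \<eta>] by (intro Lp_norm_eq_0_imp_AE[OF r]) auto
      then have "AE x in lebesgue_on \<Omega>. \<eta> x *\<^sub>R (1::real) = 0" by simp
      then show "(\<integral>x. \<eta> x *\<^sub>R (1::real) \<partial>lebesgue_on \<Omega>) = 0" by (rule integral_eq_zero_AE)
    qed
    with \<open>\<not> (AE x in lebesgue_on \<Omega>. False)\<close> show False by simp
  qed
qed

section \<open>Bounded matrix fields\<close>

lemma norm_matrix_vector_mult_le: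
  fixes A :: "real^'n^'n"
  shows "norm (A *v y) \<le> (\<Sum>i\<in>UNIV. \<Sum>j\<in>UNIV. \<bar>A $ i $ j\<bar>) * norm y"
proof -
  have "norm (A *v y) \<le> (\<Sum>i\<in>UNIV. \<bar>(A *v y) $ i\<bar>)" by (rule norm_le_l1_cart)
  also have "\<dots> \<le> (\<Sum>i\<in>UNIV. \<Sum>j\<in>UNIV. \<bar>A $ i $ j\<bar> * norm y)"
  proof (rule sum_mono)
    fix i
    have "\<bar>(A *v y) $ i\<bar> \<le> (\<Sum>j\<in>UNIV. \<bar>A $ i $ j * y $ j\<bar>)"
      unfolding matrix_vector_mult_def by simp
    also have "\<dots> \<le> (\<Sum>j\<in>UNIV. \<bar>A $ i $ j\<bar> * norm y)"
      by (intro sum_mono) (auto simp: abs_mult intro!: mult_left_mono component_le_norm_cart)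
    finally show "\<bar>(A *v y) $ i\<bar> \<le> (\<Sum>j\<in>UNIV. \<bar>A $ i $ j\<bar> * norm y)" .
  qed
  finally show ?thesis by (simp add: sum_distrib_right)
qed

lemma Lp_2_matrix_vector_mult:
  fixes A :: "real^'n \<Rightarrow> real^'n^'n"
  assumes A: "\<And>i j. (\<lambda>x. A x $ i $ j) \<in> Lp \<Omega> \<infinity>" and g: "g \<in> Lp \<Omega> 2"
  shows "(\<lambda>x. A x *v g x) \<in> Lp \<Omega> 2"
proof (rule Lp_2_bound[OF _ _ g])
  have [measurable]: "(\<lambda>x. A x $ i $ j) \<in> borel_measurable (lebesgue_on \<Omega>)" for i j
    using A[of i j] by (simp add: Lp_def)
  have [measurable]: "g \<in> borel_measurable (lebesgue_on \<Omega>)" using g by (simp add: Lp_2_iff)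
  have [measurable]: "(\<lambda>x. g x $ j) \<in> borel_measurable (lebesgue_on \<Omega>)" for j
    unfolding cart_eq_inner_axis by measurable
  have "(\<lambda>x. \<Sum>i\<in>UNIV. (\<Sum>j\<in>UNIV. A x $ i $ j * g x $ j) *\<^sub>R axis i (1::real)) \<in> borel_measurable (lebesgue_on \<Omega>)"
    by measurable
  also have "(\<lambda>x. \<Sum>i\<in>UNIV. (\<Sum>j\<in>UNIV. A x $ i $ j * g x $ j) *\<^sub>R axis i (1::real)) = (\<lambda>x. A x *v g x)"
    by (simp add: vec_eq_iff axis_def if_distrib fun_eq_iff matrix_vector_mult_def cong: if_cong)
  finally show "(\<lambda>x. A x *v g x) \<in> borel_measurable (lebesgue_on \<Omega>)" .
  define C where "C = (\<Sum>i\<in>UNIV. \<Sum>j\<in>UNIV. Lp_norm \<Omega> \<infinity> (\<lambda>x. A x $ i $ j))"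
  have "AE x in lebesgue_on \<Omega>. \<forall>i j. \<bar>A x $ i $ j\<bar> \<le> Lp_norm \<Omega> \<infinity> (\<lambda>x. A x $ i $ j)"
    unfolding AE_all_countable using Lp_infinity_AE_bound[OF A] by auto
  then show "AE x in lebesgue_on \<Omega>. norm (A x *v g x) \<le> C * norm (g x)"
  proof eventually_elim
    fix x assume "\<forall>i j. \<bar>A x $ i $ j\<bar> \<le> Lp_norm \<Omega> \<infinity> (\<lambda>x. A x $ i $ j)"
    then have "(\<Sum>i\<in>UNIV. \<Sum>j\<in>UNIV. \<bar>A x $ i $ j\<bar>) * norm (g x) \<le> C * norm (g x)"
      unfolding C_def by (intro mult_right_mono sum_mono) auto
    with norm_matrix_vector_mult_le show "norm (A x *v g x) \<le> C * norm (g x)" by (rule order_trans)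
  qed
qed

lemma inner_Lp_2_integrable:
  fixes f g :: "real^'n \<Rightarrow> real^'m"
  assumes "f \<in> Lp \<Omega> 2" "g \<in> Lp \<Omega> 2"
  shows "integrable (lebesgue_on \<Omega>) (\<lambda>x. f x \<bullet> g x)"
proof (rule Bochner_Integration.integrable_bound[OF Cauchy_Schwarz_Lp_2(1)[OF assms]])
  show "(\<lambda>x. f x \<bullet> g x) \<in> borel_measurable (lebesgue_on \<Omega>)" using assms by (auto simp: Lp_2_iff)
  show "AE x in lebesgue_on \<Omega>. norm (f x \<bullet> g x) \<le> norm (norm (f x) * norm (g x))"
    by (simp add: Cauchy_Schwarz_ineq2)
qed

section \<open>The energy estimate\<close>

lemma less_if_derivative_pos:
  fixes \<Gamma> \<Gamma>' :: "real \<Rightarrow> real"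
  assumes d: "\<And>s. s \<ge> 0 \<Longrightarrow> (\<Gamma> has_real_derivative \<Gamma>' s) (at s within {0..})"
    and p: "\<And>s. s > 0 \<Longrightarrow> \<Gamma>' s > 0" and "0 \<le> a" "a < b"
  shows "\<Gamma> a < \<Gamma> b"
proof (rule DERIV_pos_imp_increasing_open[OF \<open>a < b\<close>])
  fix x assume x: "a < x" "x < b"
  then have "at x within {0..} = at x" using \<open>0 \<le> a\<close> by (intro at_within_interior) auto
  with d[of x] p[of x] x \<open>0 \<le> a\<close> show "\<exists>y. DERIV \<Gamma> x :> y \<and> y > 0" by auto
next
  have "continuous_on {0..} \<Gamma>"
    using d by (auto simp: continuous_on_eq_continuous_within intro: DERIV_continuous)
  then show "continuous_on {a..b} \<Gamma>" by (rule continuous_on_subset) (use \<open>0 \<le> a\<close> in auto)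
qed

text \<open>
  Coercivity applied to the equation tested with \<open>\<phi> = T\<^sub>m(G\<^sub>k(u))\<close>, where \<open>\<psi>\<close> makes \<open>\<phi>\<close> an admissible
  test function: \<open>\<psi> = 1\<close> wherever \<open>D\<phi>\<close> does not vanish. The maximum with \<open>0\<close> in place of the lower
  truncation at \<open>-m\<close> keeps \<open>\<phi>\<close> nonnegative everywhere.
\<close>

lemma clamped_rest_energy_le:
  fixes \<Omega> :: "(real^'n) set" and A :: "real^'n \<Rightarrow> real^'n^'n"
    and F :: "real^'n \<Rightarrow> real \<Rightarrow> ennreal" and u :: "real^'n \<Rightarrow> real"
  assumes op: "open \<Omega>"
    and A: "\<And>i j. (\<lambda>x. A x $ i $ j) \<in> Lp \<Omega> \<infinity>"
    and coercive: "AE x in lebesgue_on \<Omega>. \<forall>\<xi>. (A x *v \<xi>) \<bullet> \<xi> \<ge> \<alpha> * (norm \<xi>)\<^sup>2"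
    and sol: "is_solution \<Omega> A F u"
    and k: "k > 0" and m: "m > 0"
  shows "\<alpha> * (\<integral>x. (norm (indicat_real {0<..m} (trunc_rest k (u x)) *\<^sub>R wgrad \<Omega> (\<lambda>x. trunc_rest k (u x)) x))\<^sup>2 \<partial>lebesgue_on \<Omega>)
    \<le> enn2real (\<integral>\<^sup>+x. F x (u x) * ennreal (max 0 (min (trunc_rest k (u x)) m)) \<partial>lebesgue_on \<Omega>)"
proof -
  have Om: "\<Omega> \<in> sets lebesgue" using op by simp
  define w where "w x = trunc_rest k (u x)" for x
  define w0 where "w0 x = trunc_rest (k / 2) (u x)" for x
  define \<phi> where "\<phi> x = max 0 (min (w x) m)" for x
  \<comment> \<open>The level \<open>k/2\<close> is one choice in \<open>(0,k)\<close>; any other, with the matching normalization, has the same effect.\<close>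
  define \<psi> where "\<psi> x = 2 / k * max 0 (min (w0 x) (k / 2))" for x
  define g\<phi> where "g\<phi> x = indicat_real {0<..m} (w x) *\<^sub>R wgrad \<Omega> w x" for x
  define g\<psi> where "g\<psi> x = (2 / k) *\<^sub>R (indicat_real {0<..k / 2} (w0 x) *\<^sub>R wgrad \<Omega> w0 x)" for x
  have w: "H01_grad \<Omega> w (wgrad \<Omega> w)" "H01_grad \<Omega> w0 (wgrad \<Omega> w0)"
    using sol k by (auto intro!: H01_imp_H01_grad[OF op] simp: is_solution_def w_def[abs_def] w0_def[abs_def])
  have \<phi>: "H01_grad \<Omega> \<phi> g\<phi>"
    unfolding \<phi>_def g\<phi>_def using H01_grad_clamp[OF Om w(1), of m] m by simp
  have \<psi>: "H01_grad \<Omega> \<psi> g\<psi>"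
    unfolding \<psi>_def g\<psi>_def using H01_grad_scale[OF H01_grad_clamp[OF Om w(2), of "k / 2"], of "2 / k"] k by simp
  note \<phi>H = H01_grad_imp_H01[OF op \<phi>] and \<psi>H = H01_grad_imp_H01[OF op \<psi>]
  have L2: "w \<in> Lp \<Omega> 2" "wgrad \<Omega> w \<in> Lp \<Omega> 2" "\<phi> \<in> Lp \<Omega> 2" "g\<phi> \<in> Lp \<Omega> 2" "\<psi> \<in> Lp \<Omega> 2" "g\<psi> \<in> Lp \<Omega> 2"
    using w(1) \<phi> \<psi> by (auto simp: H01_grad_def)
  have \<psi>01: "0 \<le> \<psi> x" "\<psi> x \<le> 1" for x
    using k by (auto simp: \<psi>_def field_simps)
  have active: "\<psi> x = 1 \<and> g\<psi> x = 0 \<and> \<psi> x * trunc k (u x) = k" if "w x > 0" for x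
  proof -
    have "u x > k" using that k by (auto simp: w_def trunc_rest_def trunc_def max_def min_def split: if_splits)
    then have "w0 x = u x - k / 2" "trunc k (u x) = k"
      using k by (auto simp: w0_def trunc_rest_def trunc_def)
    with \<open>u x > k\<close> k show ?thesis by (simp add: \<psi>_def g\<psi>_def field_simps)
  qed
  have inactive: "g\<phi> x = 0" if "\<not> w x > 0" for x using that by (simp add: g\<phi>_def)
  have \<phi>I: "\<phi> \<in> Lp \<Omega> \<infinity>"
    using L2(3) m by (intro bounded_imp_Lp_infinity[where C=m]) (auto simp: Lp_2_iff \<phi>_def)
  have \<psi>I: "\<psi> \<in> Lp \<Omega> \<infinity>"
    using L2(5) \<psi>01 by (intro bounded_imp_Lp_infinity[where C=1]) (auto simp: Lp_2_iff)
  define G where "G x = transpose (A x) *v wgrad \<Omega> \<phi> x" for x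
  have G2: "G \<in> Lp \<Omega> 2"
    unfolding G_def
  proof (rule Lp_2_matrix_vector_mult)
    show "(\<lambda>x. transpose (A x) $ i $ j) \<in> Lp \<Omega> \<infinity>" for i j using A[of j i] by (simp add: transpose_def)
    show "wgrad \<Omega> \<phi> \<in> Lp \<Omega> 2" by (rule Lp_2_cong_AE[OF Om L2(4) \<phi>H(2)])
  qed
  have G0: "AE x in lebesgue_on \<Omega>. \<not> w x > 0 \<longrightarrow> G x = 0"
    using \<phi>H(2) by eventually_elim (simp add: G_def inactive)
  have rep: "V_representation \<Omega> A \<phi> {0} (\<lambda>_. \<psi>) (\<lambda>_. G) (\<lambda>_. 0)"
    unfolding V_representation_def
  proof (intro conjI ballI)
    show "\<psi> \<in> H01 \<Omega> \<inter> Lp \<Omega> \<infinity>" using \<psi>H \<psi>I by simp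
    show "G \<in> Lp \<Omega> 2" by (rule G2)
    show "(\<lambda>_. 0) \<in> Lp \<Omega> 1" by (simp add: Lp_def)
    fix \<eta> assume \<eta>: "\<eta> \<in> test_functions \<Omega>"
    note wk = is_weak_gradient_mult_test_function[OF Om H01_grad_imp_weak_gradient[OF Om \<psi>] \<eta>]
    note wgAE = wgrad_AE[OF op wk]
    have [measurable]: "G \<in> borel_measurable (lebesgue_on \<Omega>)" "g\<psi> \<in> borel_measurable (lebesgue_on \<Omega>)"
      "\<psi> \<in> borel_measurable (lebesgue_on \<Omega>)" "\<eta> \<in> borel_measurable (lebesgue_on \<Omega>)" "grad \<eta> \<in> borel_measurable (lebesgue_on \<Omega>)"
      using G2 L2 test_function_Lp_2[OF Om \<eta>] by (auto simp: Lp_2_iff)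
    have [measurable]: "wgrad \<Omega> (\<lambda>y. \<psi> y * \<eta> y) \<in> borel_measurable (lebesgue_on \<Omega>)"
      by (rule borel_measurable_lebesgue_on_AE[OF Om _ wgAE]) measurable
    have "(\<integral>x. G x \<bullet> grad \<eta> x \<partial>lebesgue_on \<Omega>) = (\<integral>x. G x \<bullet> wgrad \<Omega> (\<lambda>y. \<psi> y * \<eta> y) x \<partial>lebesgue_on \<Omega>)"
    proof (rule integral_cong_AE)
      show "AE x in lebesgue_on \<Omega>. G x \<bullet> grad \<eta> x = G x \<bullet> wgrad \<Omega> (\<lambda>y. \<psi> y * \<eta> y) x"
        using G0 wgAE
      proof eventually_elim
        fix x assume "\<not> w x > 0 \<longrightarrow> G x = 0" and e: "wgrad \<Omega> (\<lambda>y. \<psi> y * \<eta> y) x = \<psi> x *\<^sub>R grad \<eta> x + \<eta> x *\<^sub>R g\<psi> x"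
        then show "G x \<bullet> grad \<eta> x = G x \<bullet> wgrad \<Omega> (\<lambda>y. \<psi> y * \<eta> y) x"
          unfolding e using active[of x] by (cases "w x > 0") auto
      qed
    qed measurable
    then show "neg_div \<Omega> (\<lambda>x. transpose (A x) *v wgrad \<Omega> \<phi> x) \<eta> = (\<Sum>i\<in>{0}. times_neg_div \<Omega> \<psi> G \<eta>) + regular_distribution \<Omega> (\<lambda>_. 0) \<eta>"
      by (simp add: neg_div_def times_neg_div_def regular_distribution_def G_def)
  qed simp_all
  have V: "\<phi> \<in> V_space \<Omega> A" using rep \<phi>H \<phi>I by (auto simp: V_space_def)
  have \<phi>0: "AE x in lebesgue_on \<Omega>. \<phi> x \<ge> 0" by (simp add: \<phi>_def)
  \<comment> \<open>Only the value \<open>k\<close> of \<open>z\<close> matters: \<open>G\<close> vanishes where \<open>z\<close> is not at its maximum.\<close>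
  define z where "z x = \<psi> x * trunc k (u x)" for x
  have "z \<in> H01 \<Omega>" using sol k \<psi>H \<psi>I by (simp add: is_solution_def z_def[abs_def])
  then have zg: "H01_grad \<Omega> z (wgrad \<Omega> z)" by (rule H01_imp_H01_grad[OF op])
  have zk: "z x \<le> k" for x
  proof -
    have "\<psi> x * trunc k (u x) \<le> \<psi> x * k"
      using \<psi>01[of x] k by (intro mult_left_mono) (auto simp: trunc_def)
    also have "\<dots> \<le> 1 * k" using \<psi>01[of x] k by (intro mult_right_mono) auto
    finally have "\<psi> x * trunc k (u x) \<le> k" by simp
    then show ?thesis by (simp add: z_def)
  qed
  have "AE x in lebesgue_on \<Omega>. z x = k \<longrightarrow> wgrad \<Omega> z x = 0"
    using gradient_eq_0_at_maximum[OF op zg, of k] k zk by simp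
  then have z0: "AE x in lebesgue_on \<Omega>. G x \<bullet> wgrad \<Omega> z x = 0"
    using G0
  proof eventually_elim
    fix x assume "z x = k \<longrightarrow> wgrad \<Omega> z x = 0" "\<not> w x > 0 \<longrightarrow> G x = 0"
    then show "G x \<bullet> wgrad \<Omega> z x = 0" using active[of x] by (cases "w x > 0") (auto simp: z_def)
  qed
  have eq: "(\<integral>x. G x \<bullet> wgrad \<Omega> w x \<partial>lebesgue_on \<Omega>) + (\<Sum>i\<in>{0::nat}. \<integral>x. G x \<bullet> wgrad \<Omega> z x \<partial>lebesgue_on \<Omega>) + (\<integral>x. 0 * trunc k (u x) \<partial>lebesgue_on \<Omega>)
     = enn2real (\<integral>\<^sup>+x. F x (u x) * ennreal (\<phi> x) \<partial>lebesgue_on \<Omega>)"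
    using sol V \<phi>0 rep k unfolding is_solution_def G_def w_def[abs_def] z_def[abs_def] by blast
  have "\<alpha> * (\<integral>x. (norm (g\<phi> x))\<^sup>2 \<partial>lebesgue_on \<Omega>) = (\<integral>x. \<alpha> * (norm (g\<phi> x))\<^sup>2 \<partial>lebesgue_on \<Omega>)" by simp
  also have "\<dots> \<le> (\<integral>x. G x \<bullet> wgrad \<Omega> w x \<partial>lebesgue_on \<Omega>)"
  proof (rule integral_mono_AE)
    show "integrable (lebesgue_on \<Omega>) (\<lambda>x. \<alpha> * (norm (g\<phi> x))\<^sup>2)" using L2(4) by (simp add: Lp_2_iff)
    show "integrable (lebesgue_on \<Omega>) (\<lambda>x. G x \<bullet> wgrad \<Omega> w x)" by (rule inner_Lp_2_integrable[OF G2 L2(2)])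
    show "AE x in lebesgue_on \<Omega>. \<alpha> * (norm (g\<phi> x))\<^sup>2 \<le> G x \<bullet> wgrad \<Omega> w x"
      using \<phi>H(2) coercive
    proof eventually_elim
      fix x assume e: "wgrad \<Omega> \<phi> x = g\<phi> x" and c: "\<forall>\<xi>. (A x *v \<xi>) \<bullet> \<xi> \<ge> \<alpha> * (norm \<xi>)\<^sup>2"
      have "G x \<bullet> wgrad \<Omega> w x = (A x *v wgrad \<Omega> w x) \<bullet> g\<phi> x"
        unfolding G_def e transpose_matrix_vector dot_lmul_matrix by (rule inner_commute)
      then show "\<alpha> * (norm (g\<phi> x))\<^sup>2 \<le> G x \<bullet> wgrad \<Omega> w x"
        using c by (cases "w x \<in> {0<..m}") (auto simp: g\<phi>_def)
    qed
  qed
  also have "\<dots> = enn2real (\<integral>\<^sup>+x. F x (u x) * ennreal (\<phi> x) \<partial>lebesgue_on \<Omega>)"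
    using eq integral_eq_zero_AE[OF z0] by simp
  finally show ?thesis by (simp add: g\<phi>_def \<phi>_def w_def[abs_def])
qed

text \<open>
  The singularity of \<open>F\<close> at \<open>s = 0\<close> is invisible to functions living on \<open>{u > k}\<close>: there \<open>1/\<Gamma>(u)\<close> is at
  most \<open>1/\<Gamma>(k)\<close>, and elsewhere the integrand is \<open>0\<close> even if \<open>F\<close> is infinite.
\<close>

lemma source_term_le:
  fixes \<Omega> :: "(real^'n) set" and F :: "real^'n \<Rightarrow> real \<Rightarrow> ennreal" and h u :: "real^'n \<Rightarrow> real"
  assumes F: "AE x in lebesgue_on \<Omega>. \<forall>s>0. F x s \<le> ennreal (h x / \<Gamma> s)"
    and \<Gamma>: "\<And>s t. 0 \<le> s \<Longrightarrow> s < t \<Longrightarrow> \<Gamma> s < \<Gamma> t" "\<Gamma> 0 = 0"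
    and r: "r = 1 \<or> r > 1" and h: "h \<in> Lp \<Omega> (ennreal r)"
    and v: "v \<in> Lp \<Omega> (conjugate_exponent r)" "\<And>x. 0 \<le> v x"
    and supp: "\<And>x. v x > 0 \<Longrightarrow> u x > k" and k: "k > 0"
  shows "enn2real (\<integral>\<^sup>+x. F x (u x) * ennreal (v x) \<partial>lebesgue_on \<Omega>)
    \<le> Lp_norm \<Omega> (ennreal r) h / \<Gamma> k * Lp_norm \<Omega> (conjugate_exponent r) v"
proof -
  have \<Gamma>k: "\<Gamma> k > 0" using \<Gamma>(1)[of 0 k] \<Gamma>(2) k by simp
  note H = Hoelder_Lp[OF r h v(1)]
  have "(\<integral>\<^sup>+x. F x (u x) * ennreal (v x) \<partial>lebesgue_on \<Omega>) \<le> (\<integral>\<^sup>+x. ennreal (\<bar>h x\<bar> * \<bar>v x\<bar> / \<Gamma> k) \<partial>lebesgue_on \<Omega>)"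
  proof (rule nn_integral_mono_AE)
    show "AE x in lebesgue_on \<Omega>. F x (u x) * ennreal (v x) \<le> ennreal (\<bar>h x\<bar> * \<bar>v x\<bar> / \<Gamma> k)"
      using F
    proof eventually_elim
      fix x assume F: "\<forall>s>0. F x s \<le> ennreal (h x / \<Gamma> s)"
      show "F x (u x) * ennreal (v x) \<le> ennreal (\<bar>h x\<bar> * \<bar>v x\<bar> / \<Gamma> k)"
      proof (cases "v x > 0")
        case True
        then have u: "u x > k" by (rule supp)
        then have "\<Gamma> k < \<Gamma> (u x)" using \<Gamma>(1)[of k "u x"] k by simp
        then have le: "h x / \<Gamma> (u x) \<le> \<bar>h x\<bar> / \<Gamma> k"
          using \<Gamma>k by (intro frac_le) auto
        have "F x (u x) \<le> ennreal (\<bar>h x\<bar> / \<Gamma> k)"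
          using F[rule_format, of "u x"] u k by (intro order_trans[OF _ ennreal_leI[OF le]]) simp
        then have "F x (u x) * ennreal (v x) \<le> ennreal (\<bar>h x\<bar> / \<Gamma> k) * ennreal (v x)"
          by (rule mult_right_mono) simp
        also have "\<dots> = ennreal (\<bar>h x\<bar> * \<bar>v x\<bar> / \<Gamma> k)"
          using \<Gamma>k True by (simp add: ennreal_mult[symmetric])
        finally show ?thesis .
      next
        case False
        with v(2)[of x] have "v x = 0" by simp
        then show ?thesis by simp
      qed
    qed
  qed
  also have "\<dots> = ennreal (\<integral>x. \<bar>h x\<bar> * \<bar>v x\<bar> / \<Gamma> k \<partial>lebesgue_on \<Omega>)"
    using H(1) \<Gamma>k by (intro nn_integral_eq_integral) auto
  finally have "enn2real (\<integral>\<^sup>+x. F x (u x) * ennreal (v x) \<partial>lebesgue_on \<Omega>) \<le> (\<integral>x. \<bar>h x\<bar> * \<bar>v x\<bar> / \<Gamma> k \<partial>lebesgue_on \<Omega>)"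
    using \<Gamma>k by (intro enn2real_leI) auto
  also have "\<dots> \<le> Lp_norm \<Omega> (ennreal r) h * Lp_norm \<Omega> (conjugate_exponent r) v / \<Gamma> k"
    using H(2) \<Gamma>k by (simp add: divide_right_mono)
  finally show ?thesis by simp
qed

theorem proposition5p1:
  fixes \<Omega> :: "(real^'n) set"
    and A :: "real^'n \<Rightarrow> real^'n^'n"
    and F :: "real^'n \<Rightarrow> real \<Rightarrow> ennreal"
    and h u :: "real^'n \<Rightarrow> real"
    and \<Gamma> \<Gamma>' :: "real \<Rightarrow> real"
    and \<alpha> r C_S :: real
  assumes "open \<Omega>" and "bounded \<Omega>"
    and "\<And>i j. (\<lambda>x. A x $ i $ j) \<in> Lp \<Omega> \<infinity>"
    and "\<alpha> > 0"
    and "AE x in lebesgue_on \<Omega>. \<forall>\<xi>. (A x *v \<xi>) \<bullet> \<xi> \<ge> \<alpha> * (norm \<xi>)\<^sup>2"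
    and "Caratheodory_function \<Omega> F"
    and "AE x in lebesgue_on \<Omega>. \<forall>s>0. F x s \<le> ennreal (h x / \<Gamma> s)"
    and "AE x in lebesgue_on \<Omega>. h x \<ge> 0"
    and "admissible_exponent CARD('n) r"
    and "h \<in> Lp \<Omega> (ennreal r)"
    and "\<And>s. s \<ge> 0 \<Longrightarrow> \<Gamma> s \<ge> 0"
    and "\<And>s. s \<ge> 0 \<Longrightarrow> (\<Gamma> has_real_derivative \<Gamma>' s) (at s within {0..})"
    and "continuous_on {0..} \<Gamma>'"
    and "\<Gamma> 0 = 0"
    and "\<And>s. s > 0 \<Longrightarrow> \<Gamma>' s > 0"
    and "Sobolev_constant \<Omega> (conjugate_exponent r) C_S"
    and "is_solution \<Omega> A F u"
  shows "\<forall>k>0.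
    H01_norm \<Omega> (\<lambda>x. trunc_rest k (u x)) = Lp_norm \<Omega> 2 (wgrad \<Omega> (\<lambda>x. trunc_rest k (u x))) \<and>
    Lp_norm \<Omega> 2 (wgrad \<Omega> (\<lambda>x. trunc_rest k (u x)))
      \<le> C_S / \<alpha> * (Lp_norm \<Omega> (ennreal r) h / \<Gamma> k)"
proof (intro allI impI conjI)
  fix k :: real assume k: "k > 0"
  show "H01_norm \<Omega> (\<lambda>x. trunc_rest k (u x)) = Lp_norm \<Omega> 2 (wgrad \<Omega> (\<lambda>x. trunc_rest k (u x)))"
    by (simp add: H01_norm_def)
  note op = \<open>open \<Omega>\<close> and sol = \<open>is_solution \<Omega> A F u\<close> and S = \<open>Sobolev_constant \<Omega> (conjugate_exponent r) C_S\<close>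
  have Om: "\<Omega> \<in> sets lebesgue" using op by simp
  have r: "r = 1 \<or> r > 1"
  proof -
    consider "CARD('n) = 1" | "CARD('n) = 2" | "CARD('n) \<ge> 3" using zero_less_card_finite[where 'a='n] by linarith
    then show ?thesis
      using \<open>admissible_exponent CARD('n) r\<close> by cases (auto simp: admissible_exponent_def)
  qed
  have mono: "\<Gamma> s < \<Gamma> t" if "0 \<le> s" "s < t" for s t
    using less_if_derivative_pos[OF assms(12,15) that] .
  have \<Gamma>k: "\<Gamma> k > 0" using mono[of 0 k] \<open>\<Gamma> 0 = 0\<close> k by simp
  define w where "w = (\<lambda>x. trunc_rest k (u x))"
  define g where "g = wgrad \<Omega> w"
  define H where "H = Lp_norm \<Omega> (ennreal r) h / \<Gamma> k"
  define B where "B = C_S / \<alpha> * H"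
  have H0: "H \<ge> 0" unfolding H_def by (intro divide_nonneg_pos Lp_norm_nonneg \<Gamma>k)
  have B0: "B \<ge> 0"
    using Sobolev_constant_nonneg_or_null[OF op r S]
  proof
    assume "AE x in lebesgue_on \<Omega>. False"
    then have "(\<integral>x. \<bar>h x\<bar> powr r \<partial>lebesgue_on \<Omega>) = 0"
      by (intro integral_eq_zero_AE) (auto elim: eventually_mono)
    then have "H = 0" using r by (auto simp: H_def Lp_norm_def)
    then show ?thesis by (simp add: B_def)
  qed (use H0 \<open>\<alpha> > 0\<close> in \<open>simp add: B_def\<close>)
  have w: "H01_grad \<Omega> w g"
    using sol k by (auto intro!: H01_imp_H01_grad[OF op] simp: is_solution_def w_def g_def)
  then have g2: "g \<in> Lp \<Omega> 2" by (simp add: H01_grad_def)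
  define E where "E m = (\<integral>x. (norm (indicat_real {0<..m} (w x) *\<^sub>R g x))\<^sup>2 \<partial>lebesgue_on \<Omega>)" for m
  have E: "E m \<le> B\<^sup>2" if m: "m > 0" for m
  proof -
    define v where "v x = max 0 (min (w x) m)" for x
    have v: "H01_grad \<Omega> v (\<lambda>x. indicat_real {0<..m} (w x) *\<^sub>R g x)"
      unfolding v_def using m by (intro H01_grad_clamp[OF Om w]) simp
    note vH = H01_grad_imp_H01[OF op v]
    have E0: "0 \<le> E m" by (simp add: E_def)
    have "Lp_norm \<Omega> 2 (wgrad \<Omega> v) = sqrt (E m)"
    proof -
      have m1: "(\<lambda>x. (norm (indicat_real {0<..m} (w x) *\<^sub>R g x))\<^sup>2) \<in> borel_measurable (lebesgue_on \<Omega>)"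
        using v by (auto simp: H01_grad_def Lp_2_iff)
      have "wgrad \<Omega> v \<in> Lp \<Omega> 2"
        using v by (intro Lp_2_cong_AE[OF Om _ vH(2)]) (simp add: H01_grad_def)
      then have "(\<lambda>x. (norm (wgrad \<Omega> v x))\<^sup>2) \<in> borel_measurable (lebesgue_on \<Omega>)" by (auto simp: Lp_2_iff)
      then have "(\<integral>x. (norm (wgrad \<Omega> v x))\<^sup>2 \<partial>lebesgue_on \<Omega>) = E m"
        unfolding E_def using vH(2) m1 by (intro integral_cong_AE) auto
      then show ?thesis by (simp add: Lp_norm_2)
    qed
    then have vp: "v \<in> Lp \<Omega> (conjugate_exponent r)" "Lp_norm \<Omega> (conjugate_exponent r) v \<le> C_S * sqrt (E m)"
      using S vH(1) by (auto simp: Sobolev_constant_def)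
    have supp: "u x > k" if "v x > 0" for x
      using that k by (auto simp: v_def w_def trunc_rest_def trunc_def max_def min_def split: if_splits)
    have "\<alpha> * E m \<le> enn2real (\<integral>\<^sup>+x. F x (u x) * ennreal (v x) \<partial>lebesgue_on \<Omega>)"
      using clamped_rest_energy_le[OF op assms(3,5) sol k m] by (simp add: E_def v_def g_def w_def)
    also have "\<dots> \<le> H * Lp_norm \<Omega> (conjugate_exponent r) v"
      unfolding H_def
      by (rule source_term_le[OF assms(7) mono \<open>\<Gamma> 0 = 0\<close> r assms(10) vp(1) _ supp k]) (auto simp: v_def)
    also have "\<dots> \<le> H * (C_S * sqrt (E m))" using vp(2) H0 by (rule mult_left_mono)
    finally have "E m \<le> B * sqrt (E m)"
      using \<open>\<alpha> > 0\<close> by (simp add: B_def field_simps)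
    \<comment> \<open>One factor \<open>sqrt (E m)\<close> cancels; if it is \<open>0\<close>, the bound rests on \<open>B \<ge> 0\<close>.\<close>
    then have "sqrt (E m) * sqrt (E m) \<le> B * sqrt (E m)" using E0 by simp
    then have "sqrt (E m) \<le> B"
    proof (cases "E m = 0")
      case False
      then have "sqrt (E m) > 0" using E0 by simp
      with \<open>sqrt (E m) * sqrt (E m) \<le> B * sqrt (E m)\<close> show ?thesis by (rule mult_right_le_imp_le)
    qed (use B0 in simp)
    then have "(sqrt (E m))\<^sup>2 \<le> B\<^sup>2" using E0 by (intro power_mono) auto
    then show ?thesis using E0 by simp
  qed
  have "AE x in lebesgue_on \<Omega>. 0 \<le> u x" using sol by (simp add: is_solution_def)
  then have "AE x in lebesgue_on \<Omega>. 0 \<le> w x"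
    by eventually_elim (use k in \<open>simp add: w_def trunc_rest_def trunc_def\<close>)
  \<comment> \<open>The truncated gradients see only \<open>{w > 0}\<close>; nothing is lost because the gradient of \<open>w\<close> vanishes on \<open>{w = 0}\<close>.\<close>
  from gradient_eq_0_at_minimum[OF op w _ this]
  have gz: "AE x in lebesgue_on \<Omega>. 0 \<le> w x \<and> (w x = 0 \<longrightarrow> g x = 0)"
    using \<open>AE x in lebesgue_on \<Omega>. 0 \<le> w x\<close> by (auto intro: eventually_conj)
  have "(\<lambda>n. E (real (Suc n))) \<longlonglongrightarrow> (\<integral>x. (norm (g x))\<^sup>2 \<partial>lebesgue_on \<Omega>)"
    unfolding E_def
  proof (rule integral_dominated_convergence[where w="\<lambda>x. (norm (g x))\<^sup>2"])
    show i: "integrable (lebesgue_on \<Omega>) (\<lambda>x. (norm (g x))\<^sup>2)" using g2 by (simp add: Lp_2_iff)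
    then show "(\<lambda>x. (norm (g x))\<^sup>2) \<in> borel_measurable (lebesgue_on \<Omega>)" by simp
    have [measurable]: "w \<in> borel_measurable (lebesgue_on \<Omega>)" "g \<in> borel_measurable (lebesgue_on \<Omega>)"
      using w by (auto simp: H01_grad_def Lp_2_iff)
    show "(\<lambda>x. (norm (indicat_real {0<..real (Suc n)} (w x) *\<^sub>R g x))\<^sup>2) \<in> borel_measurable (lebesgue_on \<Omega>)" for n
      by measurable
    show "AE x in lebesgue_on \<Omega>. norm ((norm (indicat_real {0<..real (Suc n)} (w x) *\<^sub>R g x))\<^sup>2) \<le> (norm (g x))\<^sup>2" for n
      by (auto simp: indicator_def)
    show "AE x in lebesgue_on \<Omega>. (\<lambda>n. (norm (indicat_real {0<..real (Suc n)} (w x) *\<^sub>R g x))\<^sup>2) \<longlonglongrightarrow> (norm (g x))\<^sup>2"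
      using gz
    proof eventually_elim
      fix x assume x: "0 \<le> w x \<and> (w x = 0 \<longrightarrow> g x = 0)"
      obtain N where N: "w x \<le> real N" using real_arch_simple by blast
      have "\<forall>\<^sub>F n in sequentially. (norm (indicat_real {0<..real (Suc n)} (w x) *\<^sub>R g x))\<^sup>2 = (norm (g x))\<^sup>2"
        using eventually_ge_at_top[of N]
      proof eventually_elim
        fix n assume "N \<le> n"
        with N have "w x \<le> real (Suc n)" by simp
        with x show "(norm (indicat_real {0<..real (Suc n)} (w x) *\<^sub>R g x))\<^sup>2 = (norm (g x))\<^sup>2"
          by (cases "w x = 0") (auto simp: indicator_def)
      qed
      then show "(\<lambda>n. (norm (indicat_real {0<..real (Suc n)} (w x) *\<^sub>R g x))\<^sup>2) \<longlonglongrightarrow> (norm (g x))\<^sup>2"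
        by (rule tendsto_eventually)
    qed
  qed
  then have "(\<integral>x. (norm (g x))\<^sup>2 \<partial>lebesgue_on \<Omega>) \<le> B\<^sup>2"
    by (rule LIMSEQ_le_const2) (intro exI[of _ 0] allI impI E, simp)
  then have "Lp_norm \<Omega> 2 g \<le> B"
    unfolding Lp_norm_2 using B0 by (intro real_le_lsqrt) auto
  then show "Lp_norm \<Omega> 2 (wgrad \<Omega> (\<lambda>x. trunc_rest k (u x))) \<le> C_S / \<alpha> * (Lp_norm \<Omega> (ennreal r) h / \<Gamma> k)"
    by (simp add: g_def w_def B_def H_def)
qed

end
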